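(* Let $\Omega_1\subset\mathbb R^n$ be open, bounded and of class $\mathcal C^2$, $\Omega_2=(0,1)$, $\Omega=\Omega_1\times\Omega_2$. Let $\varepsilon>0$ and $\beta\in\mathcal C^1((0,+\infty))$ with $\beta(0)=0$, $\beta'(t)\in[\varepsilon,1/\varepsilon]$ for all $t$, and $t\mapsto\beta(t)t$ convex; set $a(t)=\beta(t)/t$. Let $f\in\mathcal C^\infty_c(\Omega)$ and let $u\in H^1_0(\Omega)$ be the weak solution of $$-\operatorname{div}_x(a(|\nabla_xu|)\nabla_xu)-u_{yy}=f\ \text{in }\Omega,\qquad u=0\ \text{on }\partial\Omega.$$ For $N\in\mathbb N$ let $h=1/(N+1)$, let $f_j(x)=f(x,jh)$ for $j=1,\dots,N$, and let $\mathbf u^h=(u^h_j)_{j=0}^{N+1}$ be the unique weak solution of $$-\operatorname{div}(a(|\nabla u^h_j|)\nabla u^h_j)-\frac{u^h_{j+1}-2u^h_j+u^h_{j-1}}{h^2}=f_j\text{ in }\Omega_1,\ u^h_j=0\text{ on }\partial\Omega_1\ (1\le j\le N),\ u^h_0=u^h_{N+1}=0.$$ Define on $\Omega$ the linear interpolation $$u^h(x,y)=u^h_j(x)+\frac{u^h_{j+1}(x)-u^h_j(x)}{h}(y-jh),\qquad j=\lfloor y/h\rfloor.$$ Then $(u^h)$ is bounded in $H^1_0(\Omega)$ and $u^h\rightharpoonup u$ weakly in $H^1_0(\Omega)$ as $h=1/(N+1)\to0$.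
   Context: Points of $\Omega$ are $(x,y)$, $x\in\mathbb R^n$, $y\in(0,1)$; $\lfloor z\rfloor$ is the integer $k$ with $k\le z<k+1$. The weak solution of the continuous problem is $u\in H^1_0(\Omega)$ with $\int_\Omega a(|\nabla_xu|)\nabla_xu\cdot\nabla_x\varphi+\int_\Omega u_y\varphi_y=\int_\Omega f\varphi$ for all $\varphi\in H^1_0(\Omega)$. The weak solution of the discrete system is $\mathbf u^h\in\{\mathbf w\in H^1_0(\Omega_1)^{N+2}:w_0=w_{N+1}=0\}$ with $\int_{\Omega_1}\sum_{j=1}^Na(|\nabla u^h_j|)\nabla u^h_j\cdot\nabla\varphi_j+\int_{\Omega_1}\sum_{j=0}^N\frac{u^h_{j+1}-u^h_j}{h}\frac{\varphi_{j+1}-\varphi_j}{h}=\int_{\Omega_1}\sum_{j=1}^Nf_j\varphi_j$ for all such $\boldsymbol\varphi$. *)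

theory Defs
  imports "HOL-Analysis.Analysis"
begin

fun Ck :: "nat \<Rightarrow> ('a::euclidean_space \<Rightarrow> real) \<Rightarrow> bool" where
  "Ck 0 f = continuous_on UNIV f"
| "Ck (Suc k) f = (f differentiable_on UNIV \<and>
      (\<forall>i\<in>Basis. Ck k (\<lambda>x. frechet_derivative f (at x) i)))"

definition smooth :: "('a::euclidean_space \<Rightarrow> real) \<Rightarrow> bool" where
  "smooth f \<longleftrightarrow> (\<forall>k. Ck k f)"

definition cgrad :: "('a::euclidean_space \<Rightarrow> real) \<Rightarrow> 'a \<Rightarrow> 'a" where
  "cgrad f x = (\<Sum>i\<in>Basis. frechet_derivative f (at x) i *\<^sub>R i)"

text \<open>C^2 boundary (local graph definition): near every boundary point, in a
  rotated coordinate system with normal axis e, the set is the subgraph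
  {x . x\<bullet>e < g(x')} of a C^2 function g of the remaining coordinates
  (g is extended to the whole space constantly along e).\<close>
definition C2_boundary :: "'a::euclidean_space set \<Rightarrow> bool" where
  "C2_boundary \<Omega> \<longleftrightarrow> (\<forall>p\<in>frontier \<Omega>. \<exists>r>0. \<exists>e g. norm e = 1 \<and> Ck 2 g \<and>
      (\<forall>x t. g (x + t *\<^sub>R e) = g x) \<and>
      \<Omega> \<inter> ball p r = {x \<in> ball p r. x \<bullet> e < g x})"

definition test_fun :: "'a::euclidean_space set \<Rightarrow> ('a \<Rightarrow> real) \<Rightarrow> bool" where
  "test_fun U \<phi> \<longleftrightarrow> smooth \<phi> \<and> compact (closure {x. \<phi> x \<noteq> 0}) \<and>
      closure {x. \<phi> x \<noteq> 0} \<subseteq> U"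

definition L2 :: "'a::euclidean_space set \<Rightarrow> ('a \<Rightarrow> 'b::euclidean_space) \<Rightarrow> bool" where
  "L2 U f \<longleftrightarrow> set_borel_measurable lebesgue U f \<and>
      set_integrable lebesgue U (\<lambda>x. (norm (f x))\<^sup>2)"

definition weak_grad :: "'a::euclidean_space set \<Rightarrow> ('a \<Rightarrow> real) \<Rightarrow> ('a \<Rightarrow> 'a) \<Rightarrow> bool" where
  "weak_grad U u G \<longleftrightarrow> (\<forall>\<phi>. test_fun U \<phi> \<longrightarrow> (\<forall>i\<in>Basis.
      (LINT x:U|lebesgue. u x * frechet_derivative \<phi> (at x) i)
        = - (LINT x:U|lebesgue. (G x \<bullet> i) * \<phi> x)))"

definition H1 :: "'a::euclidean_space set \<Rightarrow> ('a \<Rightarrow> real) \<Rightarrow> ('a \<Rightarrow> 'a) \<Rightarrow> bool" where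
  "H1 U u G \<longleftrightarrow> L2 U u \<and> L2 U G \<and> weak_grad U u G"

text \<open>The (a.e. unique) weak gradient.\<close>
definition wgrad :: "'a::euclidean_space set \<Rightarrow> ('a \<Rightarrow> real) \<Rightarrow> 'a \<Rightarrow> 'a" where
  "wgrad U u = (SOME G. H1 U u G)"

definition H10 :: "'a::euclidean_space set \<Rightarrow> ('a \<Rightarrow> real) \<Rightarrow> bool" where
  "H10 U u \<longleftrightarrow> (\<exists>G. H1 U u G \<and> (\<exists>\<phi>s. (\<forall>k. test_fun U (\<phi>s k)) \<and>
      (\<lambda>k. LINT x:U|lebesgue. (\<phi>s k x - u x)\<^sup>2 + (norm (cgrad (\<phi>s k) x - G x))\<^sup>2)
        \<longlonglongrightarrow> 0))"

definition H1_inner :: "'a::euclidean_space set \<Rightarrow> ('a \<Rightarrow> real) \<Rightarrow> ('a \<Rightarrow> real) \<Rightarrow> real" where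
  "H1_inner U u v = (LINT x:U|lebesgue. u x * v x + wgrad U u x \<bullet> wgrad U v x)"

definition H1_norm :: "'a::euclidean_space set \<Rightarrow> ('a \<Rightarrow> real) \<Rightarrow> real" where
  "H1_norm U u = sqrt (H1_inner U u u)"

definition weak_conv_H10 :: "'a::euclidean_space set \<Rightarrow> (nat \<Rightarrow> 'a \<Rightarrow> real) \<Rightarrow> ('a \<Rightarrow> real) \<Rightarrow> bool" where
  "weak_conv_H10 U us u \<longleftrightarrow> (\<forall>v. H10 U v \<longrightarrow> (\<lambda>N. H1_inner U (us N) v) \<longlonglongrightarrow> H1_inner U u v)"

definition Omega :: "'a::euclidean_space set \<Rightarrow> ('a \<times> real) set" where
  "Omega \<Omega>1 = \<Omega>1 \<times> {0<..<1}"

definition acoef :: "(real \<Rightarrow> real) \<Rightarrow> real \<Rightarrow> real" where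
  "acoef \<beta> t = \<beta> t / t"

definition weak_sol_cont ::
  "(real \<Rightarrow> real) \<Rightarrow> 'a::euclidean_space set \<Rightarrow> ('a \<times> real \<Rightarrow> real) \<Rightarrow> ('a \<times> real \<Rightarrow> real) \<Rightarrow> bool" where
  "weak_sol_cont \<beta> \<Omega>1 f u \<longleftrightarrow> H10 (Omega \<Omega>1) u \<and>
     (\<forall>\<phi>. H10 (Omega \<Omega>1) \<phi> \<longrightarrow>
        (LINT z:Omega \<Omega>1|lebesgue.
            acoef \<beta> (norm (fst (wgrad (Omega \<Omega>1) u z))) *
              (fst (wgrad (Omega \<Omega>1) u z) \<bullet> fst (wgrad (Omega \<Omega>1) \<phi> z)))
        + (LINT z:Omega \<Omega>1|lebesgue. snd (wgrad (Omega \<Omega>1) u z) * snd (wgrad (Omega \<Omega>1) \<phi> z))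
        = (LINT z:Omega \<Omega>1|lebesgue. f z * \<phi> z))"

definition weak_sol_disc ::
  "(real \<Rightarrow> real) \<Rightarrow> 'a::euclidean_space set \<Rightarrow> nat \<Rightarrow> (nat \<Rightarrow> 'a \<Rightarrow> real) \<Rightarrow> (nat \<Rightarrow> 'a \<Rightarrow> real) \<Rightarrow> bool" where
  "weak_sol_disc \<beta> \<Omega>1 N F w \<longleftrightarrow>
     (let h = 1 / real (N + 1) in
       (\<forall>j\<le>N+1. H10 \<Omega>1 (w j)) \<and> w 0 = (\<lambda>x. 0) \<and> w (N+1) = (\<lambda>x. 0) \<and>
       (\<forall>\<phi>::nat \<Rightarrow> 'a \<Rightarrow> real. (\<forall>j\<le>N+1. H10 \<Omega>1 (\<phi> j)) \<and> \<phi> 0 = (\<lambda>x. 0) \<and> \<phi> (N+1) = (\<lambda>x. 0) \<longrightarrow>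
          (LINT x:\<Omega>1|lebesgue. \<Sum>j=1..N.
              acoef \<beta> (norm (wgrad \<Omega>1 (w j) x)) * (wgrad \<Omega>1 (w j) x \<bullet> wgrad \<Omega>1 (\<phi> j) x))
          + (LINT x:\<Omega>1|lebesgue. \<Sum>j=0..N.
              ((w (j+1) x - w j x) / h) * ((\<phi> (j+1) x - \<phi> j x) / h))
          = (LINT x:\<Omega>1|lebesgue. \<Sum>j=1..N. F j x * \<phi> j x)))"

definition interp :: "nat \<Rightarrow> (nat \<Rightarrow> 'a \<Rightarrow> real) \<Rightarrow> 'a \<times> real \<Rightarrow> real" where
  "interp N w z = (let h = 1 / real (N + 1); x = fst z; y = snd z; j = nat \<lfloor>y / h\<rfloor> in
      w j x + (w (j+1) x - w j x) / h * (y - real j * h))"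

end

theory Submission
  imports Defs
begin

text \<open>
  The convergence is in fact strong, and no compactness is needed. The flux \<open>p \<mapsto> a(|p|) p\<close> is strongly
  monotone with constant \<open>\<epsilon>\<close> and Lipschitz with constant \<open>3 / \<epsilon>\<close>. Let \<open>\<phi>\<close> be a test function close
  to \<open>u\<close> in \<open>H\<^sup>1\<close>, and let \<open>v\<^sub>j\<close> be the difference of \<open>u\<^sup>h\<^sub>j\<close> and the slice \<open>\<phi>(\<cdot>, j h)\<close>. Test the discrete
  system with \<open>(v\<^sub>j)\<close> and the continuous equation with the interpolation of \<open>(v\<^sub>j)\<close>; both equations can be
  written as integrals over \<open>\<Omega>\<close>, since the hat functions and the indicators of the cells have integral \<open>h\<close>
  in \<open>y\<close>. As \<open>\<phi>\<close> and \<open>f\<close> are smooth, the consistency error is \<open>O(h)\<close>, and strong monotonicity and Young's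
  inequality bound the discrete energy of \<open>(v\<^sub>j)\<close> by a constant times \<open>\<parallel>\<phi> - u\<parallel>\<^sup>2 + L\<^sup>2 h\<^sup>2\<close>, where only
  \<open>L\<close> depends on \<open>\<phi>\<close>. Let first \<open>h\<close> tend to zero and then \<open>\<phi>\<close> tend to \<open>u\<close>.
\<close>

section \<open>Smooth functions\<close>

text \<open>Neither solution can be compared with the other directly. Slices of an H1 function at
  the nodes need not lie in H1, and the flux of an interpolated gradient is not the interpolation of
  the nodal fluxes. A smooth comparison function has slices, and its gradient changes by O(h)
  between a point and the two adjacent nodes, so fluxes at the nodes can be traded for the flux at
  the point. Coercivity controls only the derivatives of the difference, whereas the source term
  pairs with its values; these come from summation in y (\<open>discrete_Poincare\<close>). Two
  further issues shape the preparatory half. First, \<open>wgrad\<close> is an arbitrary choice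
  among weak gradients, so uniqueness almost everywhere must be known before an equation can be used
  with a concrete gradient. Second, interpolations are admissible in the continuous equation only if
  test functions approximate them. They are finite sums of products of a function of x and a hat
  function of y, which leads to tensor products and to mollified hats.\<close>

lemma Ck_SucI:
  assumes "\<And>x. (f has_derivative D x) (at x)" "\<And>i. i \<in> Basis \<Longrightarrow> Ck k (\<lambda>x. D x i)"
  shows "Ck (Suc k) f"
proof -
  have "frechet_derivative f (at x) = D x" for x
    using frechet_derivative_at[OF assms(1)] by simp
  then show ?thesis
    using assms by (auto simp: differentiable_on_def differentiable_def)
qed

lemma Ck_Suc_has_derivative:
  "Ck (Suc k) f \<Longrightarrow> (f has_derivative frechet_derivative f (at x)) (at x)"
  by (simp add: differentiable_on_def flip: frechet_derivative_works)

lemma Ck_SucD: "Ck (Suc k) f \<Longrightarrow> i \<in> Basis \<Longrightarrow> Ck k (\<lambda>x. frechet_derivative f (at x) i)"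
  by simp

lemma Ck_Suc_imp_Ck: "Ck (Suc k) f \<Longrightarrow> Ck k f"
proof (induction k arbitrary: f)
  case 0
  then show ?case by (simp add: differentiable_imp_continuous_on)
next
  case (Suc k)
  then show ?case by simp
qed

lemma Ck_const: "Ck k (\<lambda>x. c)"
proof (induction k arbitrary: c)
  case (Suc k)
  then show ?case by (intro Ck_SucI[where D = "\<lambda>x v. 0"]) auto
qed simp

lemma Ck_add: "Ck k f \<Longrightarrow> Ck k g \<Longrightarrow> Ck k (\<lambda>x. f x + g x)"
proof (induction k arbitrary: f g)
  case 0
  then show ?case by (auto intro: continuous_intros)
next
  case (Suc k)
  show ?case
    by (rule Ck_SucI[OF has_derivative_add[OF Suc.prems[THEN Ck_Suc_has_derivative]]])
      (intro Suc.IH Ck_SucD Suc.prems)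
qed

lemma Ck_mult: "Ck k f \<Longrightarrow> Ck k g \<Longrightarrow> Ck k (\<lambda>x. f x * g x)"
proof (induction k arbitrary: f g)
  case 0
  then show ?case by (auto intro: continuous_intros)
next
  case (Suc k)
  show ?case
    by (rule Ck_SucI[OF has_derivative_mult[OF Suc.prems[THEN Ck_Suc_has_derivative]]])
      (intro Ck_add Suc.IH Ck_SucD Suc.prems Ck_Suc_imp_Ck)
qed

lemma Ck_sum: "finite I \<Longrightarrow> (\<And>i. i \<in> I \<Longrightarrow> Ck k (f i)) \<Longrightarrow> Ck k (\<lambda>x. \<Sum>i\<in>I. f i x)"
  by (induction I rule: finite_induct) (auto intro: Ck_const Ck_add)

text \<open>The derivative of the composition in direction i is that of \<open>f\<close> in
  direction \<open>L i\<close>, which need not be a basis vector. As \<open>Ck\<close> speaks of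
  basis directions only, \<open>L i\<close> is expanded in the basis. Translations, scalings, slices
  and projections are all instances.\<close>

lemma Ck_affine:
  assumes "bounded_linear L"
  shows "Ck k f \<Longrightarrow> Ck k (\<lambda>x. f (L x + c))"
proof (induction k arbitrary: f)
  case 0
  have "continuous_on UNIV (\<lambda>x. L x + c)"
    using assms by (intro continuous_intros linear_continuous_on)
  with 0 show ?case
    using continuous_on_compose2[of UNIV f UNIV "\<lambda>x. L x + c"] by simp
next
  case (Suc k)
  have d: "((\<lambda>x. L x + c) has_derivative L) (at x)" for x
    using has_derivative_add_const[OF bounded_linear_imp_has_derivative[OF assms]] .
  have lin: "linear (frechet_derivative f (at x))" for x
    using Ck_Suc_has_derivative[OF Suc.prems] has_derivative_linear by blast
  have expand: "frechet_derivative f (at y) v = (\<Sum>j\<in>Basis. (v \<bullet> j) * frechet_derivative f (at y) j)" for y v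
    using linear_sum[OF lin[of y], of "\<lambda>j. (v \<bullet> j) *\<^sub>R j" Basis] linear_cmul[OF lin]
    by (simp add: euclidean_representation)
  have "Ck k (\<lambda>x. \<Sum>j\<in>Basis. (L i \<bullet> j) * frechet_derivative f (at (L x + c)) j)" for i
    by (intro Ck_sum Ck_mult Ck_const Suc.IH Ck_SucD Suc.prems) auto
  then have "Ck k (\<lambda>x. frechet_derivative f (at (L x + c)) (L i))" for i
    by (subst expand)
  then show ?case
    by (intro Ck_SucI[OF has_derivative_compose[OF d Ck_Suc_has_derivative[OF Suc.prems]]])
qed

lemma smooth_const: "smooth (\<lambda>x. c)"
  by (simp add: smooth_def Ck_const)

lemma smooth_add: "smooth f \<Longrightarrow> smooth g \<Longrightarrow> smooth (\<lambda>x. f x + g x)"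
  by (simp add: smooth_def Ck_add)

lemma smooth_mult: "smooth f \<Longrightarrow> smooth g \<Longrightarrow> smooth (\<lambda>x. f x * g x)"
  by (simp add: smooth_def Ck_mult)

lemma smooth_affine: "bounded_linear L \<Longrightarrow> smooth f \<Longrightarrow> smooth (\<lambda>x. f (L x + c))"
  by (simp add: smooth_def Ck_affine)

lemma smooth_prod: "finite I \<Longrightarrow> (\<And>i. i \<in> I \<Longrightarrow> smooth (f i)) \<Longrightarrow> smooth (\<lambda>x. \<Prod>i\<in>I. f i x)"
  by (induction I rule: finite_induct) (auto intro: smooth_const smooth_mult)

lemma smooth_partial: "smooth f \<Longrightarrow> i \<in> Basis \<Longrightarrow> smooth (\<lambda>x. frechet_derivative f (at x) i)"
  unfolding smooth_def using Ck_SucD by blast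

lemma smooth_has_derivative: "smooth f \<Longrightarrow> (f has_derivative frechet_derivative f (at x)) (at x)"
  unfolding smooth_def using Ck_Suc_has_derivative by blast

lemma smooth_continuous: "smooth f \<Longrightarrow> continuous_on S f"
  unfolding smooth_def using Ck.simps(1) continuous_on_subset by blast

lemma inner_cgrad:
  assumes "(f has_derivative D) (at x)"
  shows "cgrad f x \<bullet> v = D v"
proof -
  have "D v = (\<Sum>j\<in>Basis. (v \<bullet> j) * D j)"
    using linear_sum[OF has_derivative_linear[OF assms], of "\<lambda>j. (v \<bullet> j) *\<^sub>R j" Basis]
      linear_cmul[OF has_derivative_linear[OF assms]]
    by (simp add: euclidean_representation)
  then show ?thesis
    using frechet_derivative_at[OF assms]
    by (simp add: cgrad_def inner_sum_left inner_sum_right inner_commute mult.commute)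
qed

lemma cgrad_eqI: "(f has_derivative (\<lambda>v. g \<bullet> v)) (at x) \<Longrightarrow> cgrad f x = g"
  by (rule vector_eq_rdot[THEN iffD1]) (auto dest: inner_cgrad)

lemma smooth_has_derivative_cgrad: "smooth f \<Longrightarrow> (f has_derivative (\<lambda>v. cgrad f x \<bullet> v)) (at x)"
  using smooth_has_derivative[of f x] inner_cgrad[OF smooth_has_derivative, of f x] by presburger

lemma Ck_Suc_real:
  assumes "\<And>t. (f has_real_derivative f' t) (at t)" "Ck k f'"
  shows "Ck (Suc k) f"
  using assms by (intro Ck_SucI[where D = "\<lambda>t v. f' t * v"]) (auto simp: has_field_derivative_def mult_commute_abs)

lemma smooth_real:
  assumes "\<And>t. (f has_real_derivative f' t) (at t)" "smooth f'"
  shows "smooth f"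
  unfolding smooth_def
proof
  fix k show "Ck k f"
    using assms Ck_Suc_real[OF assms(1)] Ck_Suc_imp_Ck unfolding smooth_def by blast
qed

section \<open>Flat functions, bumps and smooth steps on the real line\<close>

definition flat :: "real poly \<Rightarrow> real \<Rightarrow> real" where
  "flat p t = (if t \<le> 0 then 0 else poly p (1 / t) * exp (- (1 / t)))"

lemma poly_times_exp_tendsto_0: "((\<lambda>s. poly p s * exp (- s)) \<longlongrightarrow> 0) at_top" for p :: "real poly"
proof -
  have "((\<lambda>s. \<Sum>i\<le>degree p. coeff p i * (s ^ i / exp s)) \<longlongrightarrow> (\<Sum>i\<le>degree p. coeff p i * 0)) at_top"
    by (intro tendsto_intros tendsto_power_div_exp_0)
  then show ?thesis
    by (simp add: poly_altdef exp_minus sum_distrib_right divide_inverse mult.assoc)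
qed

text \<open>With s = 1/t the chain rule turns p(s) exp(-s) into s^2 (p - p')(s) exp(-s). The family
  is thus closed under differentiation, and smoothness follows by induction on the order with p
  arbitrary.\<close>

lemma flat_has_derivative:
  "(flat p has_real_derivative flat ([:0, 0, 1:] * (p - pderiv p)) t) (at t)"
proof -
  consider "t < 0" | "t > 0" | "t = 0" by linarith
  then show ?thesis
  proof cases
    case 1
    have "((\<lambda>t. 0) has_real_derivative 0) (at t)" by simp
    then have "(flat p has_real_derivative 0) (at t)"
      by (rule has_field_derivative_transform_within_open[where S = "{..<0}"])
        (use 1 in \<open>auto simp: flat_def\<close>)
    then show ?thesis using 1 by (simp add: flat_def)
  next
    case 2
    have "((\<lambda>t. poly p (1 / t) * exp (- (1 / t))) has_real_derivative
        flat ([:0, 0, 1:] * (p - pderiv p)) t) (at t)"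
      using 2 by (auto intro!: derivative_eq_intros DERIV_chain2[OF poly_DERIV]
          simp: flat_def power2_eq_square field_simps)
    then show ?thesis
      by (rule has_field_derivative_transform_within_open[where S = "{0<..}"])
        (use 2 in \<open>auto simp: flat_def\<close>)
  next
    case 3
    \<comment> \<open>Dividing by t in the difference quotient at 0 replaces p(s) by s p(s), so the
      quotient is again of the same form and decays.\<close>
    have "((\<lambda>t. poly (pCons 0 p) (1 / t) * exp (- (1 / t))) \<longlongrightarrow> 0) (at_right 0)"
      using filterlim_compose[OF poly_times_exp_tendsto_0[of "pCons 0 p"] filterlim_inverse_at_top_right]
      by (simp add: inverse_eq_divide)
    then have "((\<lambda>t. (flat p t - flat p 0) / (t - 0)) \<longlongrightarrow> 0) (at_right 0)"
      by (rule Lim_transform_eventually)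
        (auto simp: eventually_at_filter flat_def)
    moreover have "((\<lambda>t. (flat p t - flat p 0) / (t - 0)) \<longlongrightarrow> 0) (at_left 0)"
      by (rule Lim_transform_eventually[OF tendsto_const])
        (auto simp: eventually_at_filter flat_def)
    ultimately show ?thesis
      unfolding has_field_derivative_iff 3 by (simp add: filterlim_split_at flat_def)
  qed
qed

lemma smooth_flat: "smooth (flat p)"
  unfolding smooth_def
proof
  fix k show "Ck k (flat p)"
  proof (induction k arbitrary: p)
    case 0
    then show ?case
      using DERIV_isCont[OF flat_has_derivative] by (auto intro: continuous_at_imp_continuous_on)
  next
    case (Suc k)
    show ?case by (rule Ck_Suc_real[OF flat_has_derivative Suc.IH])
  qed
qed

definition bump :: "real \<Rightarrow> real" where
  "bump t = flat 1 t * flat 1 (1 - t)"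

lemma smooth_bump: "smooth bump"
proof -
  have "smooth (\<lambda>t. flat 1 ((- 1) *\<^sub>R t + 1))"
    by (intro smooth_affine smooth_flat bounded_linear_scaleR_right)
  then show ?thesis
    unfolding bump_def[abs_def] by (intro smooth_mult smooth_flat) (simp add: algebra_simps)
qed

lemma bump_nonneg: "bump t \<ge> 0"
  by (simp add: bump_def flat_def)

lemma bump_pos: "0 < t \<Longrightarrow> t < 1 \<Longrightarrow> bump t > 0"
  by (simp add: bump_def flat_def)

lemma bump_0: "t \<le> 0 \<or> t \<ge> 1 \<Longrightarrow> bump t = 0"
  by (auto simp: bump_def flat_def)

lemma smooth_antiderivative:
  fixes g :: "real \<Rightarrow> real"
  assumes "smooth g"
  obtains G where "smooth G" "\<And>t. (G has_real_derivative g t) (at t)"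
proof -
  have c: "continuous_on S g" for S
    using smooth_continuous[OF assms] .
  define G where "G t = integral {0..t} g - integral {t..0} g" for t
  have "(G has_real_derivative g t) (at t)" for t
  proof -
    \<comment> \<open>A base point to the left of both t and 0 puts t in the interior of the
      interval of integration, whatever its sign. Changing the base point only adds a
      constant.\<close>
    define a where "a = min t 0 - 1"
    have "((\<lambda>u. integral {a..u} g) has_vector_derivative g t) (at t within {a..max t 0 + 1})"
      by (rule integral_has_vector_derivative[OF c]) (auto simp: a_def)
    then have "((\<lambda>u. integral {a..u} g) has_vector_derivative g t) (at t)"
      by (subst (asm) at_within_interior) (auto simp: a_def)
    then have "((\<lambda>u. integral {a..u} g - integral {a..0} g) has_vector_derivative g t - 0) (at t)"
      by (intro has_vector_derivative_diff has_vector_derivative_const)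
    moreover have "integral {a..u} g - integral {a..0} g = G u" if "u > a" for u
    proof (cases "u \<ge> 0")
      case True
      then have "integral {a..0} g + integral {0..u} g = integral {a..u} g"
        by (intro Henstock_Kurzweil_Integration.integral_combine integrable_continuous_real c) (auto simp: a_def)
      then show ?thesis using True by (cases "u = 0") (auto simp: G_def)
    next
      case False
      then have "integral {a..u} g + integral {u..0} g = integral {a..0} g"
        using that by (intro Henstock_Kurzweil_Integration.integral_combine integrable_continuous_real c) auto
      then show ?thesis using False by (auto simp: G_def)
    qed
    ultimately show ?thesis
      using has_vector_derivative_transform_within_open[of _ "g t" t "{a<..}" G]
      by (auto simp: a_def has_real_derivative_iff_has_vector_derivative)
  qed
  then show ?thesis using that smooth_real[OF _ assms] by blast
qed

text \<open>The step is a normalised antiderivative B of \<open>bump\<close>: constant on each side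
  of the unit interval because \<open>bump\<close> vanishes there, and B 0 < B 1 because
  \<open>bump\<close> is positive inside.\<close>

lemma smooth_step_exists:
  "\<exists>S::real \<Rightarrow> real. smooth S \<and> (\<forall>t\<le>0. S t = 0) \<and> (\<forall>t\<ge>1. S t = 1) \<and> (\<forall>t. 0 \<le> S t \<and> S t \<le> 1)"
proof -
  obtain B where B: "smooth B" "\<And>t. (B has_real_derivative bump t) (at t)"
    using smooth_antiderivative[OF smooth_bump] by blast
  have mono: "B s \<le> B t" if "s \<le> t" for s t
    using DERIV_nonneg_imp_nondecreasing[OF that] B(2) bump_nonneg by blast
  have cont: "continuous_on T B" for T
    using smooth_continuous[OF B(1)] .
  have lo: "B t = B 0" if "t \<le> 0" for t
  proof (cases "t = 0")
    case False
    have "(B has_real_derivative 0) (at x)" if "t < x" "x < 0" for x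
      using B(2)[of x] bump_0[of x] that by simp
    with False that show ?thesis
      using DERIV_isconst_end[of t 0 B] cont by simp
  qed simp
  have hi: "B t = B 1" if "t \<ge> 1" for t
  proof (cases "t = 1")
    case False
    have "(B has_real_derivative 0) (at x)" if "1 < x" "x < t" for x
      using B(2)[of x] bump_0[of x] that by simp
    with False that show ?thesis
      using DERIV_isconst_end[of 1 t B] cont by simp
  qed simp
  have pos: "B 0 < B 1"
  proof (rule DERIV_pos_imp_increasing_open[of 0 1 B])
    show "\<exists>y. (B has_real_derivative y) (at t) \<and> 0 < y" if "0 < t" "t < 1" for t
      using B(2) bump_pos that by blast
  qed (use cont in auto)
  define S where "S t = (1 / (B 1 - B 0)) * (B t + (- B 0))" for t
  have "smooth S"
    unfolding S_def[abs_def] by (intro smooth_mult smooth_const smooth_add B)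
  moreover have "0 \<le> S t" "S t \<le> 1" for t
  proof -
    have "B 0 \<le> B t"
      using mono[of 0 t] lo[of t] by linarith
    then show "0 \<le> S t"
      using pos by (simp add: S_def)
    have "B t \<le> B 1"
      using mono[of t 1] hi[of t] by linarith
    then show "S t \<le> 1"
      using pos by (simp add: S_def)
  qed
  moreover have "S t = 0" if "t \<le> 0" for t
    by (simp add: S_def lo[OF that])
  moreover have "S t = 1" if "t \<ge> 1" for t
    using pos by (simp add: S_def hi[OF that])
  ultimately show ?thesis
    by blast
qed

definition sstep :: "real \<Rightarrow> real" where
  "sstep = (SOME S. smooth S \<and> (\<forall>t\<le>0. S t = 0) \<and> (\<forall>t\<ge>1. S t = 1) \<and> (\<forall>t. 0 \<le> S t \<and> S t \<le> 1))"

lemma sstep: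
  shows smooth_sstep: "smooth sstep"
    and sstep_0: "t \<le> 0 \<Longrightarrow> sstep t = 0"
    and sstep_1: "t \<ge> 1 \<Longrightarrow> sstep t = 1"
    and sstep_ge_0: "0 \<le> sstep t" and sstep_le_1: "sstep t \<le> 1"
  using someI_ex[OF smooth_step_exists, folded sstep_def] by auto

section \<open>Square integrable functions\<close>

text \<open>A measure replaces the set argument of \<open>L2\<close>, so that the same lemmas serve
  the whole space, \<Omega>, the unit interval and the cylinder. \<open>L2_iff_sqint\<close>
  translates.\<close>

definition sqint :: "'a measure \<Rightarrow> ('a \<Rightarrow> 'b::euclidean_space) \<Rightarrow> bool" where
  "sqint M f \<longleftrightarrow> f \<in> borel_measurable M \<and> integrable M (\<lambda>x. (norm (f x))\<^sup>2)"

lemma sqint_measurable [measurable_dest]: "sqint M f \<Longrightarrow> f \<in> borel_measurable M"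
  by (simp add: sqint_def)

lemma sqint_integrable: "sqint M f \<Longrightarrow> integrable M (\<lambda>x. (norm (f x))\<^sup>2)"
  by (simp add: sqint_def)

lemma sqint_integrable_power2: "sqint M f \<Longrightarrow> integrable M (\<lambda>x. (f x)\<^sup>2)" for f :: "_ \<Rightarrow> real"
  using sqint_integrable[of M f] by simp

lemma sqint_boundI:
  assumes "sqint M f" "g \<in> borel_measurable M" "AE x in M. norm (g x) \<le> c * norm (f x)"
  shows "sqint M g"
  unfolding sqint_def
proof
  show "integrable M (\<lambda>x. (norm (g x))\<^sup>2)"
  proof (rule Bochner_Integration.integrable_bound)
    show "integrable M (\<lambda>x. c\<^sup>2 * (norm (f x))\<^sup>2)"
      using sqint_integrable[OF assms(1)] by simp
    show "AE x in M. norm ((norm (g x))\<^sup>2) \<le> norm (c\<^sup>2 * (norm (f x))\<^sup>2)"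
      using assms(3)
    proof eventually_elim
      case (elim x)
      then show ?case
        using power_mono[OF elim, of 2] by (simp add: power_mult_distrib)
    qed
  qed (use assms in measurable)
qed fact

lemma sqint_cong_AE:
  assumes "sqint M f" "g \<in> borel_measurable M" "AE x in M. g x = f x"
  shows "sqint M g"
  by (rule sqint_boundI[where c = 1, OF assms(1,2)]) (use assms(3) in auto)

lemma sqint_bounded:
  assumes "finite_measure M" "g \<in> borel_measurable M" "\<And>x. x \<in> space M \<Longrightarrow> norm (g x) \<le> c"
  shows "sqint M g"
proof -
  have "sqint M (\<lambda>x. 1::real)"
    using finite_measure.integrable_const[OF assms(1)] by (simp add: sqint_def)
  then show ?thesis
    by (rule sqint_boundI[where c = c]) (use assms in auto)
qed

lemma sqint_zero: "sqint M (\<lambda>x. 0)"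
  by (simp add: sqint_def)

lemma sqint_scaleR: "sqint M f \<Longrightarrow> sqint M (\<lambda>x. c *\<^sub>R f x)"
  by (rule sqint_boundI[where c = "\<bar>c\<bar>"]) auto

lemma sqint_cmult: "sqint M f \<Longrightarrow> sqint M (\<lambda>x. c * f x)" for c :: real
  using sqint_scaleR[of M f c] by simp

lemma norm_add_power2_le: "(norm (x + y))\<^sup>2 \<le> 2 * (norm x)\<^sup>2 + 2 * (norm y)\<^sup>2"
  for x y :: "'a::real_normed_vector"
proof -
  have "(norm (x + y))\<^sup>2 \<le> (norm x + norm y)\<^sup>2"
    by (simp add: norm_triangle_ineq power_mono)
  also have "\<dots> \<le> 2 * (norm x)\<^sup>2 + 2 * (norm y)\<^sup>2"
    using zero_le_power2[of "norm x - norm y"] by (simp add: power2_eq_square algebra_simps)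
  finally show ?thesis .
qed

lemma sqint_add:
  assumes "sqint M f" "sqint M g"
  shows "sqint M (\<lambda>x. f x + g x)"
  unfolding sqint_def
proof
  show "integrable M (\<lambda>x. (norm (f x + g x))\<^sup>2)"
    by (rule Bochner_Integration.integrable_bound[of M "\<lambda>x. 2 * (norm (f x))\<^sup>2 + 2 * (norm (g x))\<^sup>2"])
      (use assms norm_add_power2_le in \<open>auto simp: sqint_def\<close>)
qed (use assms in \<open>auto simp: sqint_def\<close>)

lemma sqint_diff:
  assumes "sqint M f" "sqint M g"
  shows "sqint M (\<lambda>x. f x - g x)"
  using sqint_add[OF assms(1) sqint_scaleR[OF assms(2), of "-1"]] by simp

lemma sqint_sum: "finite I \<Longrightarrow> (\<And>i. i \<in> I \<Longrightarrow> sqint M (f i)) \<Longrightarrow> sqint M (\<lambda>x. \<Sum>i\<in>I. f i x)"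
  by (induction I rule: finite_induct) (auto intro: sqint_zero sqint_add)

lemma sqint_norm: "sqint M f \<Longrightarrow> sqint M (\<lambda>x. norm (f x))"
  by (rule sqint_boundI[where c = 1 and f = f]) auto

lemma sqint_Pair: 
  assumes "sqint M f" "sqint M g"
  shows "sqint M (\<lambda>x. (f x, g x))"
  using assms by (auto simp: sqint_def norm_Pair)

lemma sqint_fst:
  assumes "sqint M f"
  shows "sqint M (\<lambda>x. fst (f x))"
proof (rule sqint_boundI[where c = 1, OF assms])
  show "(\<lambda>x. fst (f x)) \<in> borel_measurable M"
    by (rule measurable_compose[OF sqint_measurable[OF assms]])
      (intro borel_measurable_continuous_onI continuous_intros)
  show "AE x in M. norm (fst (f x)) \<le> 1 * norm (f x)"
    using norm_fst_le[of "fst (f x)" "snd (f x)" for x] by simp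
qed

lemma sqint_snd:
  assumes "sqint M f"
  shows "sqint M (\<lambda>x. snd (f x))"
proof (rule sqint_boundI[where c = 1, OF assms])
  show "(\<lambda>x. snd (f x)) \<in> borel_measurable M"
    by (rule measurable_compose[OF sqint_measurable[OF assms]])
      (intro borel_measurable_continuous_onI continuous_intros)
  show "AE x in M. norm (snd (f x)) \<le> 1 * norm (f x)"
    using norm_snd_le[of "snd (f x)" "fst (f x)" for x] by simp
qed

lemma inner_le_power2: "\<bar>x \<bullet> y\<bar> \<le> (norm x)\<^sup>2 + (norm y)\<^sup>2" for x y :: "'a::real_inner"
proof -
  have "\<bar>x \<bullet> y\<bar> \<le> norm x * norm y"
    by (rule Cauchy_Schwarz_ineq2)
  also have "\<dots> \<le> (norm x)\<^sup>2 + (norm y)\<^sup>2"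
    using zero_le_power2[of "norm x - norm y"] zero_le_power2[of "norm x + norm y"]
    unfolding power2_diff power2_sum by linarith
  finally show ?thesis .
qed

lemma sqint_inner:
  assumes "sqint M f" "sqint M g"
  shows "integrable M (\<lambda>x. f x \<bullet> g x)"
  by (rule Bochner_Integration.integrable_bound[of M "\<lambda>x. (norm (f x))\<^sup>2 + (norm (g x))\<^sup>2"])
    (use assms inner_le_power2 in \<open>auto simp: sqint_def\<close>)

lemma sqint_mult: "sqint M f \<Longrightarrow> sqint M g \<Longrightarrow> integrable M (\<lambda>x. f x * g x)"
  for f g :: "'a \<Rightarrow> real"
  using sqint_inner[of M f g] by simp

lemma sqint_inner_fixed: "sqint M f \<Longrightarrow> sqint M (\<lambda>x. f x \<bullet> i)"
  by (rule sqint_boundI[where c = "norm i" and f = f])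
    (auto simp: mult.commute[of "norm i"] Cauchy_Schwarz_ineq2)

text \<open>The usual discriminant argument: the integral of the squared norm of f + t g is a
  quadratic polynomial in t that is never negative.\<close>

lemma sqint_Cauchy_Schwarz:
  assumes f: "sqint M f" and g: "sqint M g"
  shows "\<bar>LINT x|M. f x \<bullet> g x\<bar> \<le> sqrt (LINT x|M. (norm (f x))\<^sup>2) * sqrt (LINT x|M. (norm (g x))\<^sup>2)"
proof -
  define A B C where "A = (LINT x|M. (norm (f x))\<^sup>2)" and "B = (LINT x|M. f x \<bullet> g x)"
    and "C = (LINT x|M. (norm (g x))\<^sup>2)"
  have q: "0 \<le> A + 2 * t * B + t\<^sup>2 * C" for t
  proof -
    have "0 \<le> (LINT x|M. (norm (f x + t *\<^sub>R g x))\<^sup>2)"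
      by simp
    also have "\<dots> = (LINT x|M. (norm (f x))\<^sup>2 + 2 * t * (f x \<bullet> g x) + t\<^sup>2 * (norm (g x))\<^sup>2)"
    proof (rule Bochner_Integration.integral_cong)
      show "(norm (f x + t *\<^sub>R g x))\<^sup>2 = (norm (f x))\<^sup>2 + 2 * t * (f x \<bullet> g x) + t\<^sup>2 * (norm (g x))\<^sup>2" for x
        using dot_norm[of "f x" "t *\<^sub>R g x"] by (simp add: power_mult_distrib)
    qed simp
    also have "\<dots> = A + 2 * t * B + t\<^sup>2 * C"
      using sqint_integrable[OF f] sqint_integrable[OF g] sqint_inner[OF f g]
      by (simp add: A_def B_def C_def)
    finally show ?thesis .
  qed
  have "B\<^sup>2 \<le> A * C"
  proof (cases "C = 0")
    case True
    have "B = 0"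
    proof (rule ccontr)
      assume "B \<noteq> 0"
      \<comment> \<open>For C = 0 the polynomial is affine; this t gives it the value -1.\<close>
      then show False
        using q[of "- (A + 1) / (2 * B)"] True by (simp add: field_simps)
    qed
    then show ?thesis using True by simp
  next
    case False
    moreover have "C \<ge> 0" by (simp add: C_def)
    ultimately have "C > 0" by simp
    \<comment> \<open>The minimiser t = -B / C of the quadratic.\<close>
    then show ?thesis
      using q[of "- B / C"] by (simp add: field_simps power2_eq_square)
  qed
  then have "\<bar>B\<bar> \<le> sqrt (A * C)"
    using real_le_rsqrt by (metis power2_abs)
  then show ?thesis
    by (simp add: A_def B_def C_def real_sqrt_mult)
qed

section \<open>From set integrals and \<open>L2\<close> to restricted Lebesgue measure\<close>

lemma set_integral_lebesgue_on:
  fixes f :: "'a::euclidean_space \<Rightarrow> 'b::{banach, second_countable_topology}"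
  assumes "U \<in> sets lebesgue"
  shows "(LINT x:U|lebesgue. f x) = integral\<^sup>L (lebesgue_on U) f"
  using assms by (simp add: integral_restrict_space set_lebesgue_integral_def)

lemma L2_iff_sqint:
  assumes "U \<in> sets lebesgue"
  shows "L2 U f \<longleftrightarrow> sqint (lebesgue_on U) f"
  using assms
  by (simp add: L2_def sqint_def set_borel_measurable_def set_integrable_def integrable_restrict_space
      borel_measurable_restrict_space_iff)

lemma sqint_lebesgue_on:
  assumes "sqint lebesgue f" "U \<in> sets lebesgue"
  shows "sqint (lebesgue_on U) f"
  unfolding sqint_def
proof
  show "f \<in> borel_measurable (lebesgue_on U)"
    using assms by (simp add: sqint_def measurable_restrict_space1)
  show "integrable (lebesgue_on U) (\<lambda>x. (norm (f x))\<^sup>2)"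
    using integrable_mult_indicator[OF assms(2) sqint_integrable[OF assms(1)]] assms(2)
    by (simp add: integrable_restrict_space)
qed

lemma sqint_indicator_compact:
  fixes K :: "'a::euclidean_space set"
  assumes "compact K"
  shows "sqint lebesgue (indicat_real K)"
  using assms lmeasurable_compact[of K]
  by (auto simp: sqint_def power2_eq_square fmeasurable_def simp flip: indicator_inter_arith)

section \<open>Test functions\<close>

lemma test_funI:
  assumes "smooth \<phi>" "compact K" "K \<subseteq> U" "\<And>x. x \<notin> K \<Longrightarrow> \<phi> x = 0"
  shows "test_fun U \<phi>"
proof -
  have "closure {x. \<phi> x \<noteq> 0} \<subseteq> K"
    using assms(2,4) by (intro closure_minimal compact_imp_closed) auto
  moreover have "compact (closure {x. \<phi> x \<noteq> 0})"
    using calculation assms(2) bounded_subset[OF compact_imp_bounded] by (metis closed_closure compact_eq_bounded_closed)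
  ultimately show ?thesis
    using assms by (auto simp: test_fun_def)
qed

lemma test_funE:
  assumes "test_fun U \<phi>"
  obtains K where "smooth \<phi>" "compact K" "K \<subseteq> U" "\<And>x. x \<notin> K \<Longrightarrow> \<phi> x = 0"
proof
  show "\<And>x. x \<notin> closure {x. \<phi> x \<noteq> 0} \<Longrightarrow> \<phi> x = 0"
    using closure_subset[of "{x. \<phi> x \<noteq> 0}"] by auto
qed (use assms in \<open>auto simp: test_fun_def\<close>)

lemma test_fun_smooth: "test_fun U \<phi> \<Longrightarrow> smooth \<phi>"
  by (simp add: test_fun_def)

lemma test_fun_eq_0: "test_fun U \<phi> \<Longrightarrow> x \<notin> U \<Longrightarrow> \<phi> x = 0"
  by (meson subsetD test_funE)

lemma test_fun_zero: "test_fun U (\<lambda>x. 0)"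
  by (rule test_funI[of _ "{}"]) (auto intro: smooth_const)

lemma test_fun_add:
  assumes "test_fun U \<phi>" "test_fun U \<psi>"
  shows "test_fun U (\<lambda>x. \<phi> x + \<psi> x)"
proof -
  from assms obtain K L where "smooth \<phi>" "compact K" "K \<subseteq> U" "\<And>x. x \<notin> K \<Longrightarrow> \<phi> x = 0"
    "smooth \<psi>" "compact L" "L \<subseteq> U" "\<And>x. x \<notin> L \<Longrightarrow> \<psi> x = 0"
    by (metis test_funE)
  then show ?thesis
    by (intro test_funI[of _ "K \<union> L"]) (auto intro: smooth_add)
qed

lemma test_fun_mult:
  assumes "test_fun U \<phi>" "smooth \<psi>"
  shows "test_fun U (\<lambda>x. \<psi> x * \<phi> x)"
proof -
  from assms(1) obtain K where "smooth \<phi>" "compact K" "K \<subseteq> U" "\<And>x. x \<notin> K \<Longrightarrow> \<phi> x = 0"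
    by (rule test_funE) (rule that)
  then show ?thesis
    using assms(2) by (intro test_funI[of _ K]) (auto intro: smooth_mult)
qed

lemma test_fun_cmult: "test_fun U \<phi> \<Longrightarrow> test_fun U (\<lambda>x. c * \<phi> x)"
  by (rule test_fun_mult[OF _ smooth_const])

lemma test_fun_partial:
  assumes "test_fun U \<phi>" "i \<in> Basis"
  shows "test_fun U (\<lambda>x. frechet_derivative \<phi> (at x) i)"
proof -
  from assms(1) obtain K where K: "smooth \<phi>" "compact K" "K \<subseteq> U" "\<And>x. x \<notin> K \<Longrightarrow> \<phi> x = 0"
    by (rule test_funE) (rule that)
  have "frechet_derivative \<phi> (at x) i = 0" if "x \<notin> K" for x
  proof -
    have "(\<phi> has_derivative (\<lambda>v. 0)) (at x)"
      by (rule has_derivative_transform_within_open[of "\<lambda>x. 0" _ _ _ "- K"])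
        (use that K compact_imp_closed in auto)
    then show ?thesis
      by (metis frechet_derivative_at)
  qed
  then show ?thesis
    using K assms(2) by (intro test_funI[of _ K]) (auto intro: smooth_partial)
qed

lemma frechet_derivative_eq_cgrad:
  "smooth \<phi> \<Longrightarrow> frechet_derivative \<phi> (at x) i = cgrad \<phi> x \<bullet> i"
  using inner_cgrad[OF smooth_has_derivative] by metis

lemma compactly_supported_bounded:
  fixes g :: "'a::euclidean_space \<Rightarrow> real"
  assumes "continuous_on UNIV g" "compact K" "\<And>x. x \<notin> K \<Longrightarrow> g x = 0"
  obtains B where "B \<ge> 0" "\<And>x. \<bar>g x\<bar> \<le> B"
proof -
  have "bounded (g ` K)"
    using assms by (intro compact_imp_bounded compact_continuous_image) (auto intro: continuous_on_subset)
  then obtain B where B: "\<And>x. x \<in> K \<Longrightarrow> \<bar>g x\<bar> \<le> B"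
    by (auto simp: bounded_iff)
  then show ?thesis
    using that[of "\<bar>B\<bar>"] assms(3) by (metis abs_ge_self abs_ge_zero abs_zero order_trans)
qed

lemma test_fun_bounded:
  assumes "test_fun U \<phi>"
  obtains B where "B \<ge> 0" "\<And>x. \<bar>\<phi> x\<bar> \<le> B"
  using assms compactly_supported_bounded by (metis smooth_continuous test_funE)

lemma test_fun_sqint:
  assumes "test_fun U \<phi>"
  shows "sqint lebesgue \<phi>"
proof -
  from assms obtain K where K: "smooth \<phi>" "compact K" "\<And>x. x \<notin> K \<Longrightarrow> \<phi> x = 0"
    by (rule test_funE) (rule that)
  obtain B where B: "\<And>x. \<bar>\<phi> x\<bar> \<le> B"
    using test_fun_bounded[OF assms] by blast
  have "sqint lebesgue (indicat_real K)"
    by (rule sqint_indicator_compact[OF K(2)])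
  then show ?thesis
  proof (rule sqint_boundI[where c = B])
    show "\<phi> \<in> borel_measurable lebesgue"
      using smooth_continuous[OF K(1)] by (intro measurable_completion) (simp add: borel_measurable_continuous_onI)
    show "AE x in lebesgue. norm (\<phi> x) \<le> B * norm (indicat_real K x)"
      using B K(3) by (auto simp: indicator_def intro!: AE_I2)
  qed
qed

lemma test_fun_sqint_cgrad:
  assumes "test_fun U \<phi>"
  shows "sqint lebesgue (cgrad \<phi>)"
  unfolding cgrad_def[abs_def]
proof (rule sqint_sum)
  fix i :: 'a assume i: "i \<in> Basis"
  have "sqint lebesgue (\<lambda>x. frechet_derivative \<phi> (at x) i)"
    using test_fun_sqint[OF test_fun_partial[OF assms i]] .
  moreover have "(\<lambda>x. frechet_derivative \<phi> (at x) i *\<^sub>R i) \<in> borel_measurable lebesgue"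
    using calculation by (intro borel_measurable_scaleR) (auto dest: sqint_measurable)
  ultimately show "sqint lebesgue (\<lambda>x. frechet_derivative \<phi> (at x) i *\<^sub>R i)"
    by (rule sqint_boundI[where c = 1]) (use i in auto)
qed simp

lemma test_fun_integrable:
  assumes "test_fun U \<phi>"
  shows "integrable lebesgue \<phi>"
proof -
  from assms obtain K where K: "smooth \<phi>" "compact K" "\<And>x. x \<notin> K \<Longrightarrow> \<phi> x = 0"
    by (rule test_funE) (rule that)
  have "integrable lebesgue (\<lambda>x. indicat_real K x *\<^sub>R \<phi> x)"
    using borel_integrable_compact[OF K(2) smooth_continuous[OF K(1)]]
    by (simp add: integrable_completion borel_measurable_integrable cong: indicator_scaleR_eq_if)
  moreover have "(\<lambda>x. indicat_real K x *\<^sub>R \<phi> x) = \<phi>"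
    using K(3) by (intro ext) (auto simp: indicator_def)
  ultimately show ?thesis by simp
qed

lemma test_fun_cgrad_bounded:
  assumes "test_fun U \<phi>"
  obtains L where "L \<ge> 0" "\<And>x. norm (cgrad \<phi> x) \<le> L"
proof -
  have "\<exists>B. \<forall>x. \<bar>frechet_derivative \<phi> (at x) i\<bar> \<le> B" if "i \<in> Basis" for i
    using test_fun_bounded[OF test_fun_partial[OF assms that]] by metis
  then obtain B where B: "\<And>i x. i \<in> Basis \<Longrightarrow> \<bar>frechet_derivative \<phi> (at x) i\<bar> \<le> B i"
    by metis
  have "norm (cgrad \<phi> x) \<le> (\<Sum>i\<in>Basis. B i)" for x
    unfolding cgrad_def by (rule order_trans[OF norm_sum]) (auto intro!: sum_mono B)
  then show ?thesis
    using that[of "\<Sum>i\<in>Basis. B i"] order_trans[OF norm_ge_zero] by blast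
qed

lemma test_fun_lipschitz:
  assumes "test_fun U \<phi>"
  obtains L where "L \<ge> 0" "\<And>x y. \<bar>\<phi> x - \<phi> y\<bar> \<le> L * norm (x - y)"
proof -
  obtain L where L: "L \<ge> 0" "\<And>x. norm (cgrad \<phi> x) \<le> L"
    using test_fun_cgrad_bounded[OF assms] by blast
  have "norm (\<phi> x - \<phi> y) \<le> L * norm (x - y)" for x y
  proof (rule differentiable_bound[of UNIV])
    show "(\<phi> has_derivative (\<lambda>v. cgrad \<phi> x \<bullet> v)) (at x within UNIV)" for x
      using smooth_has_derivative_cgrad[OF test_fun_smooth[OF assms]] by simp
    show "onorm (\<lambda>v. cgrad \<phi> x \<bullet> v) \<le> L" for x
      by (rule onorm_bound[OF L(1)])
        (use Cauchy_Schwarz_ineq2[of "cgrad \<phi> x"] mult_right_mono[OF L(2)[of x] norm_ge_zero] in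
          \<open>simp, blast intro: order_trans\<close>)
  qed auto
  then show ?thesis
    using that[OF L(1)] by simp
qed

section \<open>Integration by parts for test functions\<close>

lemma integral_partial_eq_0:
  fixes \<phi> :: "'a::euclidean_space \<Rightarrow> real"
  assumes "test_fun U \<phi>" "i \<in> Basis"
  shows "(LINT x|lebesgue. frechet_derivative \<phi> (at x) i) = 0"
proof -
  note sm = test_fun_smooth[OF assms(1)]
  have m: "\<phi> \<in> borel_measurable lborel"
    using smooth_continuous[OF sm] by (simp add: borel_measurable_continuous_onI)
  have int: "integrable lborel \<phi>"
    using test_fun_integrable[OF assms(1)] integrable_completion[OF m] by simp
  obtain L where L: "L \<ge> 0" "\<And>x y. \<bar>\<phi> x - \<phi> y\<bar> \<le> L * norm (x - y)"
    using test_fun_lipschitz[OF assms(1)] by blast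
  obtain K where K: "compact K" "\<And>x. x \<notin> K \<Longrightarrow> \<phi> x = 0"
    using assms(1) by (rule test_funE) (rule that)
  obtain R where R: "\<And>x. x \<in> K \<Longrightarrow> norm x \<le> R"
    using compact_imp_bounded[OF K(1)] by (auto simp: bounded_iff)
  define c :: "nat \<Rightarrow> real" where "c n = inverse (real (Suc n))" for n
  have c: "c n > 0" "c n \<le> 1" for n
    by (simp_all add: c_def inverse_le_1_iff)
  \<comment> \<open>Difference quotients have mean zero by translation invariance.\<close>
  define D where "D n x = (\<phi> (c n *\<^sub>R i + x) - \<phi> x) / c n" for n x
  have shift: "integrable lborel (\<lambda>x. \<phi> (a + x))" "(LINT x|lborel. \<phi> (a + x)) = (LINT x|lborel. \<phi> x)" for a
    using integrable_distr_eq[of "(+) a" lborel borel \<phi>] integral_distr[of "(+) a" lborel borel \<phi>] m int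
    by (simp_all add: lborel_distr_plus)
  have "(LINT x|lborel. D n x) = 0" for n
    unfolding D_def using shift int by simp
  moreover have "(\<lambda>n. LINT x|lborel. D n x) \<longlonglongrightarrow> (LINT x|lborel. frechet_derivative \<phi> (at x) i)"
  \<comment> \<open>The shifts have length at most 1, so all difference quotients vanish outside the
    ball of radius R + 1, and the Lipschitz constant bounds them inside.\<close>
  proof (rule integral_dominated_convergence[where w = "\<lambda>x. L * indicat_real (cball 0 (R + 1)) x"])
    show "(\<lambda>x. frechet_derivative \<phi> (at x) i) \<in> borel_measurable lborel"
      using smooth_continuous[OF smooth_partial[OF sm assms(2)]] by (simp add: borel_measurable_continuous_onI)
    show "D n \<in> borel_measurable lborel" for n
      unfolding D_def using shift(1) int by (auto dest: borel_measurable_integrable)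
    show "integrable lborel (\<lambda>x. L * indicat_real (cball 0 (R + 1)) x)"
      by (intro integrable_mult_right integrable_real_indicator emeasure_bounded_finite) auto
    show "AE x in lborel. (\<lambda>n. D n x) \<longlonglongrightarrow> frechet_derivative \<phi> (at x) i"
    proof (rule AE_I2)
      fix x
      have "((\<lambda>t. \<phi> (t *\<^sub>R i + x)) has_derivative (\<lambda>t. frechet_derivative \<phi> (at (0 *\<^sub>R i + x)) (t *\<^sub>R i))) (at 0)"
        by (rule has_derivative_compose[OF _ smooth_has_derivative[OF sm]])
          (auto intro!: derivative_eq_intros)
      moreover have "frechet_derivative \<phi> (at x) (t *\<^sub>R i) = frechet_derivative \<phi> (at x) i * t" for t
        using linear_cmul[OF has_derivative_linear[OF smooth_has_derivative[OF sm]]] by simp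
      ultimately have "((\<lambda>t. \<phi> (t *\<^sub>R i + x)) has_real_derivative frechet_derivative \<phi> (at x) i) (at 0)"
        by (simp add: has_field_derivative_def)
      then have "((\<lambda>t. (\<phi> (t *\<^sub>R i + x) - \<phi> x) / t) \<longlongrightarrow> frechet_derivative \<phi> (at x) i) (at 0)"
        by (simp add: has_field_derivative_iff)
      moreover have "filterlim c (at 0) sequentially"
        unfolding filterlim_at using c(1) LIMSEQ_inverse_real_of_nat
        by (auto simp: c_def[abs_def] less_imp_neq[THEN not_sym])
      ultimately show "(\<lambda>n. D n x) \<longlonglongrightarrow> frechet_derivative \<phi> (at x) i"
        unfolding D_def by (rule filterlim_compose)
    qed
    show "AE x in lborel. norm (D n x) \<le> L * indicat_real (cball 0 (R + 1)) x" for n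
    proof (rule AE_I2)
      fix x
      have "norm (D n x) \<le> L"
        using L(2)[of "c n *\<^sub>R i + x" x] c[of n] assms(2) by (simp add: D_def field_simps)
      moreover have "D n x = 0" if "norm x > R + 1"
      proof -
        have "norm x \<le> norm (c n *\<^sub>R i + x) + norm (c n *\<^sub>R i)"
          by (metis add_diff_cancel_left' norm_triangle_ineq4 add.commute)
        then have "norm (c n *\<^sub>R i + x) > R"
          using that c[of n] assms(2) by simp
        then have "c n *\<^sub>R i + x \<notin> K" "x \<notin> K"
          using R that by force+
        then show ?thesis
          using K(2) by (simp add: D_def)
      qed
      ultimately show "norm (D n x) \<le> L * indicat_real (cball 0 (R + 1)) x"
        using L(1) by (auto simp: indicator_def)
    qed
  qed
  ultimately have "(LINT x|lborel. frechet_derivative \<phi> (at x) i) = 0"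
    by (simp add: LIMSEQ_const_iff)
  then show ?thesis
    using smooth_continuous[OF smooth_partial[OF sm assms(2)]]
    by (subst integral_completion) (simp_all add: borel_measurable_continuous_onI)
qed

lemma integral_lebesgue_on_eq_lebesgue:
  fixes f :: "'a::euclidean_space \<Rightarrow> 'b::{banach, second_countable_topology}"
  assumes "U \<in> sets lebesgue" "\<And>x. x \<notin> U \<Longrightarrow> f x = 0"
  shows "integral\<^sup>L (lebesgue_on U) f = integral\<^sup>L lebesgue f"
proof -
  have "(\<lambda>x. indicat_real U x *\<^sub>R f x) = f"
    using assms(2) by (intro ext) (auto simp: indicator_def)
  then show ?thesis
    using assms(1) by (simp add: integral_restrict_space)
qed

lemma test_fun_integration_by_parts:
  assumes "U \<in> sets lebesgue" "test_fun U \<phi>" "test_fun U \<psi>" "i \<in> Basis"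
  shows "(LINT x|lebesgue_on U. \<phi> x * frechet_derivative \<psi> (at x) i)
       = - (LINT x|lebesgue_on U. (cgrad \<phi> x \<bullet> i) * \<psi> x)"
proof -
  note sm = test_fun_smooth[OF assms(2)] test_fun_smooth[OF assms(3)]
  note d = test_fun_partial[OF assms(2,4)] test_fun_partial[OF assms(3,4)]
  have der: "((\<lambda>x. \<phi> x * \<psi> x) has_derivative
      (\<lambda>v. \<phi> x * frechet_derivative \<psi> (at x) v + frechet_derivative \<phi> (at x) v * \<psi> x)) (at x)" for x
    by (rule has_derivative_mult[OF sm[THEN smooth_has_derivative]])
  have "frechet_derivative (\<lambda>x. \<phi> x * \<psi> x) (at x) i
      = \<phi> x * frechet_derivative \<psi> (at x) i + frechet_derivative \<phi> (at x) i * \<psi> x" for x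
    using frechet_derivative_at[OF der, THEN fun_cong, of x i] by simp
  then have "0 = (LINT x|lebesgue. \<phi> x * frechet_derivative \<psi> (at x) i + frechet_derivative \<phi> (at x) i * \<psi> x)"
    using integral_partial_eq_0[OF test_fun_mult[OF assms(3) sm(1)] assms(4)] by simp
  also have "\<dots> = (LINT x|lebesgue. \<phi> x * frechet_derivative \<psi> (at x) i) + (LINT x|lebesgue. frechet_derivative \<phi> (at x) i * \<psi> x)"
    using d assms by (intro Bochner_Integration.integral_add sqint_mult test_fun_sqint)
  finally have "(LINT x|lebesgue. \<phi> x * frechet_derivative \<psi> (at x) i)
      = - (LINT x|lebesgue. frechet_derivative \<phi> (at x) i * \<psi> x)"
    by simp
  moreover have "(LINT x|lebesgue_on U. \<phi> x * frechet_derivative \<psi> (at x) i)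
      = (LINT x|lebesgue. \<phi> x * frechet_derivative \<psi> (at x) i)"
    using test_fun_eq_0[OF d(2)] by (intro integral_lebesgue_on_eq_lebesgue assms) simp
  moreover have "(LINT x|lebesgue_on U. (cgrad \<phi> x \<bullet> i) * \<psi> x)
      = (LINT x|lebesgue. frechet_derivative \<phi> (at x) i * \<psi> x)"
    using test_fun_eq_0[OF assms(3)] unfolding frechet_derivative_eq_cgrad[OF sm(1)]
    by (intro integral_lebesgue_on_eq_lebesgue assms) simp
  ultimately show ?thesis by simp
qed

text \<open>Squared distances avoid roots; the price is the factor 2 in
  \<open>sqdist_triangle\<close> and \<open>sqdist_add\<close>, which is harmless for density
  arguments and explains the tolerances \<open>e / 4\<close> below.\<close>

definition sqdist :: "'a measure \<Rightarrow> ('a \<Rightarrow> 'b::euclidean_space) \<Rightarrow> ('a \<Rightarrow> 'b) \<Rightarrow> real" where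
  "sqdist M f g = (LINT x|M. (norm (f x - g x))\<^sup>2)"

lemma sqdist_commute: "sqdist M f g = sqdist M g f"
  by (simp add: sqdist_def norm_minus_commute)

lemma sqdist_nonneg: "0 \<le> sqdist M f g"
  by (simp add: sqdist_def)

lemma sqdist_triangle:
  assumes "sqint M f" "sqint M g" "sqint M h"
  shows "sqdist M f h \<le> 2 * sqdist M f g + 2 * sqdist M g h"
proof -
  note i = sqint_integrable[OF sqint_diff[OF assms(1,3)]]
    sqint_integrable[OF sqint_diff[OF assms(1,2)]] sqint_integrable[OF sqint_diff[OF assms(2,3)]]
  have "sqdist M f h \<le> (LINT x|M. 2 * (norm (f x - g x))\<^sup>2 + 2 * (norm (g x - h x))\<^sup>2)"
    unfolding sqdist_def
  proof (rule integral_mono)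
    show "(norm (f x - h x))\<^sup>2 \<le> 2 * (norm (f x - g x))\<^sup>2 + 2 * (norm (g x - h x))\<^sup>2" for x
      using norm_add_power2_le[of "f x - g x" "g x - h x"] by simp
  qed (use i in auto)
  then show ?thesis
    using i by (simp add: sqdist_def)
qed

lemma sqdist_add:
  assumes "sqint M f" "sqint M g" "sqint M f'" "sqint M g'"
  shows "sqdist M (\<lambda>x. f x + g x) (\<lambda>x. f' x + g' x) \<le> 2 * sqdist M f f' + 2 * sqdist M g g'"
proof -
  note i = sqint_integrable[OF sqint_diff[OF sqint_add[OF assms(1,2)] sqint_add[OF assms(3,4)]]]
    sqint_integrable[OF sqint_diff[OF assms(1,3)]] sqint_integrable[OF sqint_diff[OF assms(2,4)]]
  have "sqdist M (\<lambda>x. f x + g x) (\<lambda>x. f' x + g' x)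
      \<le> (LINT x|M. 2 * (norm (f x - f' x))\<^sup>2 + 2 * (norm (g x - g' x))\<^sup>2)"
    unfolding sqdist_def
  proof (rule integral_mono)
    show "(norm (f x + g x - (f' x + g' x)))\<^sup>2 \<le> 2 * (norm (f x - f' x))\<^sup>2 + 2 * (norm (g x - g' x))\<^sup>2" for x
      using norm_add_power2_le[of "f x - f' x" "g x - g' x"] by (simp add: algebra_simps)
  qed (use i in auto)
  then show ?thesis
    using i by (simp add: sqdist_def)
qed

section \<open>The space $H^1_0$\<close>

abbreviation jet :: "('a::euclidean_space \<Rightarrow> real) \<Rightarrow> 'a \<Rightarrow> real \<times> 'a" where
  "jet \<phi> \<equiv> (\<lambda>x. (\<phi> x, cgrad \<phi> x))"

text \<open>\<open>H10\<close> with the gradient named: the pair (w, G) lies in the L2 closure of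
  the jets of test functions. That G is a weak gradient is a consequence
  (\<open>H10g_weak_grad\<close>). Linear combinations, limits and tensor products can be formed on
  such pairs without touching the choice operator in \<open>wgrad\<close>.\<close>

definition H10g :: "'a::euclidean_space set \<Rightarrow> ('a \<Rightarrow> real) \<Rightarrow> ('a \<Rightarrow> 'a) \<Rightarrow> bool" where
  "H10g U w G \<longleftrightarrow> sqint (lebesgue_on U) (\<lambda>x. (w x, G x)) \<and>
     (\<forall>e>0. \<exists>\<phi>. test_fun U \<phi> \<and>
       sqdist (lebesgue_on U) (jet \<phi>) (\<lambda>x. (w x, G x)) < e)"

lemma H10g_sqint_Pair: "H10g U w G \<Longrightarrow> sqint (lebesgue_on U) (\<lambda>x. (w x, G x))"
  by (simp add: H10g_def)

lemma H10g_sqint: "H10g U w G \<Longrightarrow> sqint (lebesgue_on U) w"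
  and H10g_sqint_grad: "H10g U w G \<Longrightarrow> sqint (lebesgue_on U) G"
  using sqint_fst[OF H10g_sqint_Pair] sqint_snd[OF H10g_sqint_Pair] by simp_all

lemma test_fun_sqint_Pair:
  "U \<in> sets lebesgue \<Longrightarrow> test_fun V \<phi> \<Longrightarrow> sqint (lebesgue_on U) (jet \<phi>)"
  by (intro sqint_Pair sqint_lebesgue_on test_fun_sqint test_fun_sqint_cgrad)

lemma H10g_test_fun:
  assumes "U \<in> sets lebesgue" "test_fun U \<phi>"
  shows "H10g U \<phi> (cgrad \<phi>)"
  unfolding H10g_def
  using test_fun_sqint_Pair[OF assms] assms(2) by (auto simp: sqdist_def intro!: exI[of _ \<phi>])

lemma H10g_closed:
  assumes "U \<in> sets lebesgue" "sqint (lebesgue_on U) (\<lambda>x. (w x, G x))"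
    and "\<And>e. e > 0 \<Longrightarrow> \<exists>v V. H10g U v V \<and> sqdist (lebesgue_on U) (\<lambda>x. (v x, V x)) (\<lambda>x. (w x, G x)) < e"
  shows "H10g U w G"
  unfolding H10g_def
proof (intro conjI allI impI)
  fix e :: real assume "e > 0"
  then obtain v V where v: "H10g U v V" "sqdist (lebesgue_on U) (\<lambda>x. (v x, V x)) (\<lambda>x. (w x, G x)) < e / 4"
    using assms(3)[of "e / 4"] by auto
  moreover obtain \<phi> where \<phi>: "test_fun U \<phi>" "sqdist (lebesgue_on U) (jet \<phi>) (\<lambda>x. (v x, V x)) < e / 4"
    using v(1) \<open>e > 0\<close> unfolding H10g_def by (meson divide_pos_pos zero_less_numeral)
  ultimately have "sqdist (lebesgue_on U) (jet \<phi>) (\<lambda>x. (w x, G x)) < e"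
    using sqdist_triangle[OF test_fun_sqint_Pair[OF assms(1) \<phi>(1)] H10g_sqint_Pair[OF v(1)] assms(2)] by linarith
  with \<phi>(1) show "\<exists>\<phi>. test_fun U \<phi> \<and> sqdist (lebesgue_on U) (jet \<phi>) (\<lambda>x. (w x, G x)) < e"
    by blast
qed fact

lemma cgrad_add: "smooth \<phi> \<Longrightarrow> smooth \<psi> \<Longrightarrow> cgrad (\<lambda>x. \<phi> x + \<psi> x) x = cgrad \<phi> x + cgrad \<psi> x"
  by (rule cgrad_eqI) (use has_derivative_add[OF smooth_has_derivative_cgrad smooth_has_derivative_cgrad] in \<open>simp add: inner_add_left\<close>)

lemma cgrad_cmult: "smooth \<phi> \<Longrightarrow> cgrad (\<lambda>x. c * \<phi> x) x = c *\<^sub>R cgrad \<phi> x"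
  by (rule cgrad_eqI) (use has_derivative_mult_right[OF smooth_has_derivative_cgrad] in simp)

lemma H10g_zero:
  assumes "U \<in> sets lebesgue"
  shows "H10g U (\<lambda>x. 0) (\<lambda>x. 0)"
proof -
  have "cgrad (\<lambda>x::'a. 0) = (\<lambda>x. 0)"
    by (intro ext cgrad_eqI) simp
  then show ?thesis
    using H10g_test_fun[OF assms test_fun_zero] by simp
qed

lemma H10g_add:
  assumes U: "U \<in> sets lebesgue" and v: "H10g U v V" and w: "H10g U w W"
  shows "H10g U (\<lambda>x. v x + w x) (\<lambda>x. V x + W x)"
  unfolding H10g_def
proof (intro conjI allI impI)
  note s = H10g_sqint_Pair[OF v] H10g_sqint_Pair[OF w]
  show "sqint (lebesgue_on U) (\<lambda>x. (v x + w x, V x + W x))"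
    using sqint_add[OF s] by simp
  fix e :: real assume e: "e > 0"
  obtain \<phi> where \<phi>: "test_fun U \<phi>" "sqdist (lebesgue_on U) (jet \<phi>) (\<lambda>x. (v x, V x)) < e / 4"
    using v e unfolding H10g_def by (meson divide_pos_pos zero_less_numeral)
  obtain \<psi> where \<psi>: "test_fun U \<psi>" "sqdist (lebesgue_on U) (jet \<psi>) (\<lambda>x. (w x, W x)) < e / 4"
    using w e unfolding H10g_def by (meson divide_pos_pos zero_less_numeral)
  have "sqdist (lebesgue_on U) (\<lambda>x. (\<phi> x + \<psi> x, cgrad (\<lambda>x. \<phi> x + \<psi> x) x)) (\<lambda>x. (v x + w x, V x + W x)) < e"
    using sqdist_add[OF test_fun_sqint_Pair[OF U \<phi>(1)] test_fun_sqint_Pair[OF U \<psi>(1)] s] \<phi> \<psi>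
    by (simp add: cgrad_add test_fun_smooth)
  then show "\<exists>\<phi>. test_fun U \<phi> \<and> sqdist (lebesgue_on U) (jet \<phi>) (\<lambda>x. (v x + w x, V x + W x)) < e"
    using test_fun_add[OF \<phi>(1) \<psi>(1)] by blast
qed

lemma H10g_cmult:
  assumes U: "U \<in> sets lebesgue" and v: "H10g U v V"
  shows "H10g U (\<lambda>x. c * v x) (\<lambda>x. c *\<^sub>R V x)"
  unfolding H10g_def
proof (intro conjI allI impI)
  note s = H10g_sqint_Pair[OF v]
  show "sqint (lebesgue_on U) (\<lambda>x. (c * v x, c *\<^sub>R V x))"
    using sqint_scaleR[OF s, of c] by simp
  fix e :: real assume e: "e > 0"
  \<comment> \<open>The summand 1 covers c = 0 without a case distinction.\<close>
  then have "e / (c\<^sup>2 + 1) > 0"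
    by (simp add: add_nonneg_pos)
  then obtain \<phi> where \<phi>: "test_fun U \<phi>" "sqdist (lebesgue_on U) (jet \<phi>) (\<lambda>x. (v x, V x)) < e / (c\<^sup>2 + 1)"
    using v unfolding H10g_def by meson
  have "sqdist (lebesgue_on U) (\<lambda>x. (c * \<phi> x, cgrad (\<lambda>x. c * \<phi> x) x)) (\<lambda>x. (c * v x, c *\<^sub>R V x))
      = (LINT x|lebesgue_on U. c\<^sup>2 * (norm ((\<phi> x, cgrad \<phi> x) - (v x, V x)))\<^sup>2)"
    unfolding sqdist_def
  proof (rule Bochner_Integration.integral_cong)
    have "(c * \<phi> x, cgrad (\<lambda>x. c * \<phi> x) x) - (c * v x, c *\<^sub>R V x) = c *\<^sub>R ((\<phi> x, cgrad \<phi> x) - (v x, V x))" for x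
      by (simp add: cgrad_cmult[OF test_fun_smooth[OF \<phi>(1)]] scaleR_diff_right right_diff_distrib)
    then show "(norm ((c * \<phi> x, cgrad (\<lambda>x. c * \<phi> x) x) - (c * v x, c *\<^sub>R V x)))\<^sup>2
        = c\<^sup>2 * (norm ((\<phi> x, cgrad \<phi> x) - (v x, V x)))\<^sup>2" for x
      by (simp only: norm_scaleR power_mult_distrib power2_abs)
  qed simp
  also have "\<dots> = c\<^sup>2 * sqdist (lebesgue_on U) (jet \<phi>) (\<lambda>x. (v x, V x))"
    by (simp add: sqdist_def)
  also have "\<dots> \<le> c\<^sup>2 * (e / (c\<^sup>2 + 1))"
    using \<phi>(2) by (intro mult_left_mono) auto
  also have "\<dots> < e"
    using e by (simp add: divide_less_eq add_nonneg_pos distrib_left)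
  finally show "\<exists>\<phi>. test_fun U \<phi> \<and> sqdist (lebesgue_on U) (jet \<phi>) (\<lambda>x. (c * v x, c *\<^sub>R V x)) < e"
    using test_fun_cmult[OF \<phi>(1), of c] by blast
qed

lemma H10g_diff:
  assumes "U \<in> sets lebesgue" "H10g U v V" "H10g U w W"
  shows "H10g U (\<lambda>x. v x - w x) (\<lambda>x. V x - W x)"
  using H10g_add[OF assms(1,2) H10g_cmult[OF assms(1,3), of "-1"]] by simp

lemma H10g_sum:
  assumes "U \<in> sets lebesgue" "finite I" "\<And>i. i \<in> I \<Longrightarrow> H10g U (v i) (V i)"
  shows "H10g U (\<lambda>x. \<Sum>i\<in>I. v i x) (\<lambda>x. \<Sum>i\<in>I. V i x)"
  using assms(2,3) by (induction I rule: finite_induct) (auto intro: H10g_zero H10g_add assms(1))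

lemma H10g_cong_AE:
  assumes "U \<in> sets lebesgue" "H10g U v V" "w \<in> borel_measurable (lebesgue_on U)" "W \<in> borel_measurable (lebesgue_on U)"
    and "AE x in lebesgue_on U. w x = v x" "AE x in lebesgue_on U. W x = V x"
  shows "H10g U w W"
proof -
  note s = H10g_sqint_Pair[OF assms(2)]
  have ae: "AE x in lebesgue_on U. (w x, W x) = (v x, V x)"
    using assms(5,6) by eventually_elim simp
  have "sqint (lebesgue_on U) (\<lambda>x. (w x, W x))"
    by (rule sqint_cong_AE[OF s _ ae]) (use assms(3,4) in measurable)
  moreover have "sqdist (lebesgue_on U) f (\<lambda>x. (w x, W x)) = sqdist (lebesgue_on U) f (\<lambda>x. (v x, V x))"
    if "sqint (lebesgue_on U) f" for f
    unfolding sqdist_def using ae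
    by (intro integral_cong_AE) (use sqint_diff[OF that s] sqint_diff[OF that calculation] in \<open>auto dest!: sqint_measurable\<close>)
  ultimately show ?thesis
    using assms(2) test_fun_sqint_Pair[OF assms(1)] unfolding H10g_def by metis
qed

text \<open>For fixed \<psi> the defect in the integration by parts formula is the L2 pairing of the
  pair (w, G) with a fixed square integrable field V. It vanishes on jets of test functions, hence
  on their closure by Cauchy-Schwarz.\<close>

lemma H10g_weak_grad:
  assumes U: "U \<in> sets lebesgue" and w: "H10g U w G"
  shows "weak_grad U w G"
  unfolding weak_grad_def set_integral_lebesgue_on[OF U]
proof (intro allI impI ballI)
  fix \<psi> :: "'a \<Rightarrow> real" and i :: 'a
  assume \<psi>: "test_fun U \<psi>" and i: "i \<in> Basis"
  let ?M = "lebesgue_on U" and ?d = "\<lambda>x. frechet_derivative \<psi> (at x) i"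
  have s\<psi>: "sqint ?M \<psi>" "sqint ?M ?d"
    using \<psi> i U by (auto intro: sqint_lebesgue_on test_fun_sqint test_fun_partial)
  note sw = H10g_sqint_Pair[OF w]
  define V where "V x = (?d x, \<psi> x *\<^sub>R i)" for x
  have sV: "sqint ?M V"
    unfolding V_def[abs_def] using s\<psi> i
    by (intro sqint_Pair sqint_boundI[OF s\<psi>(1), where g = "\<lambda>x. \<psi> x *\<^sub>R i" and c = 1])
      (auto dest: sqint_measurable)
  define C where "C = sqrt (LINT x|?M. (norm (V x))\<^sup>2)"
  have "\<bar>LINT x|?M. (w x, G x) \<bullet> V x\<bar> \<le> sqrt e * C" if e: "e > 0" for e
  proof -
    obtain \<phi> where \<phi>: "test_fun U \<phi>" "sqdist ?M (jet \<phi>) (\<lambda>x. (w x, G x)) < e"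
      using w e unfolding H10g_def by blast
    note s\<phi> = test_fun_sqint_Pair[OF U \<phi>(1)]
    have "(LINT x|?M. (\<phi> x, cgrad \<phi> x) \<bullet> V x) = (LINT x|?M. \<phi> x * ?d x) + (LINT x|?M. cgrad \<phi> x \<bullet> i * \<psi> x)"
    proof -
      have "integrable ?M (\<lambda>x. \<phi> x * ?d x)"
        using sqint_fst[OF s\<phi>] s\<psi> by (intro sqint_mult) auto
      moreover have "integrable ?M (\<lambda>x. cgrad \<phi> x \<bullet> i * \<psi> x)"
        using sqint_inner_fixed[OF sqint_snd[OF s\<phi>]] s\<psi> by (intro sqint_mult) auto
      ultimately show ?thesis
        by (simp add: V_def mult.commute)
    qed
    then have "(LINT x|?M. (w x, G x) \<bullet> V x) = (LINT x|?M. (w x, G x) \<bullet> V x) - (LINT x|?M. (\<phi> x, cgrad \<phi> x) \<bullet> V x)"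
      using test_fun_integration_by_parts[OF U \<phi>(1) \<psi> i] by simp
    also have "\<dots> = (LINT x|?M. ((w x, G x) - (\<phi> x, cgrad \<phi> x)) \<bullet> V x)"
      unfolding inner_diff_left
      by (rule Bochner_Integration.integral_diff[OF sqint_inner[OF sw sV] sqint_inner[OF s\<phi> sV], symmetric])
    finally have "\<bar>LINT x|?M. (w x, G x) \<bullet> V x\<bar> \<le> sqrt (sqdist ?M (\<lambda>x. (w x, G x)) (jet \<phi>)) * C"
      using sqint_Cauchy_Schwarz[OF sqint_diff[OF sw s\<phi>] sV] by (simp only: sqdist_def C_def)
    also have "\<dots> \<le> sqrt e * C"
      using \<phi>(2) by (intro mult_right_mono) (auto simp: sqdist_commute C_def)
    finally show ?thesis .
  qed
  then have "\<bar>LINT x|?M. (w x, G x) \<bullet> V x\<bar> \<le> 0 + e" if "e > 0" for e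
  proof -
    have "C \<ge> 0" by (simp add: C_def)
    \<comment> \<open>The previous bound is used with the tolerance
      \<open>(e / (C + 1))\<^sup>2\<close>, whose root times C is at most e, also when C =
      0.\<close>
    have "sqrt ((e / (C + 1))\<^sup>2) * C \<le> e"
      unfolding real_sqrt_abs
      using that \<open>C \<ge> 0\<close> by (simp add: field_simps del: power_divide)
    moreover have "(e / (C + 1))\<^sup>2 > 0"
      using that \<open>C \<ge> 0\<close> by simp
    ultimately show ?thesis
      using \<open>\<And>e. 0 < e \<Longrightarrow> \<bar>LINT x|?M. (w x, G x) \<bullet> V x\<bar> \<le> sqrt e * C\<close>[of "(e / (C + 1))\<^sup>2"] by linarith
  qed
  then have "(LINT x|?M. (w x, G x) \<bullet> V x) = 0"
    using field_le_epsilon[of "\<bar>LINT x|?M. (w x, G x) \<bullet> V x\<bar>" 0] by auto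
  moreover have "(LINT x|?M. (w x, G x) \<bullet> V x) = (LINT x|?M. w x * ?d x) + (LINT x|?M. G x \<bullet> i * \<psi> x)"
  proof -
    have "integrable ?M (\<lambda>x. w x * ?d x)" "integrable ?M (\<lambda>x. G x \<bullet> i * \<psi> x)"
      using H10g_sqint[OF w] sqint_inner_fixed[OF H10g_sqint_grad[OF w]] s\<psi> by (auto intro: sqint_mult)
    then show ?thesis
      by (simp add: V_def mult.commute)
  qed
  ultimately show "(LINT x|?M. w x * ?d x) = - (LINT x|?M. G x \<bullet> i * \<psi> x)"
    by linarith
qed

lemma H10g_imp_H1: "U \<in> sets lebesgue \<Longrightarrow> H10g U w G \<Longrightarrow> H1 U w G"
  by (simp add: H1_def L2_iff_sqint H10g_sqint H10g_sqint_grad H10g_weak_grad)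

lemma H10_iff_H10g:
  assumes U: "U \<in> sets lebesgue"
  shows "H10 U w \<longleftrightarrow> (\<exists>G. H10g U w G)"
proof
  assume "H10 U w"
  then obtain G \<phi> where G: "H1 U w G" and \<phi>: "\<And>k. test_fun U (\<phi> k)"
    and "(\<lambda>k. LINT x:U|lebesgue. (\<phi> k x - w x)\<^sup>2 + (norm (cgrad (\<phi> k) x - G x))\<^sup>2) \<longlonglongrightarrow> 0"
    unfolding H10_def by blast
  then have lim: "(\<lambda>k. sqdist (lebesgue_on U) (jet (\<phi> k)) (\<lambda>x. (w x, G x))) \<longlonglongrightarrow> 0"
    by (simp add: set_integral_lebesgue_on[OF U] sqdist_def norm_Pair)
  have "\<exists>\<phi>. test_fun U \<phi> \<and> sqdist (lebesgue_on U) (jet \<phi>) (\<lambda>x. (w x, G x)) < e"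
    if "e > 0" for e
    using order_tendstoD(2)[OF lim that] \<phi> unfolding eventually_sequentially by blast
  then have "H10g U w G"
    using G by (auto simp: H10g_def H1_def L2_iff_sqint[OF U] intro: sqint_Pair)
  then show "\<exists>G. H10g U w G" by blast
next
  assume "\<exists>G. H10g U w G"
  then obtain G where G: "H10g U w G" ..
  have "\<exists>\<phi>. test_fun U \<phi> \<and> sqdist (lebesgue_on U) (jet \<phi>) (\<lambda>x. (w x, G x)) < inverse (real (Suc k))" for k
    using G unfolding H10g_def by simp
  then obtain \<phi> where \<phi>: "\<And>k. test_fun U (\<phi> k)"
    "\<And>k. sqdist (lebesgue_on U) (jet (\<phi> k)) (\<lambda>x. (w x, G x)) < inverse (real (Suc k))"
    by metis
  have "(\<lambda>k. sqdist (lebesgue_on U) (jet (\<phi> k)) (\<lambda>x. (w x, G x))) \<longlonglongrightarrow> 0"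
    by (rule tendsto_sandwich[OF _ _ tendsto_const LIMSEQ_inverse_real_of_nat])
      (auto simp: sqdist_nonneg simp del: of_nat_Suc intro!: always_eventually less_imp_le[OF \<phi>(2)])
  then have "(\<lambda>k. LINT x:U|lebesgue. (\<phi> k x - w x)\<^sup>2 + (norm (cgrad (\<phi> k) x - G x))\<^sup>2) \<longlonglongrightarrow> 0"
    by (simp add: set_integral_lebesgue_on[OF U] sqdist_def norm_Pair)
  with \<phi>(1) H10g_imp_H1[OF U G] show "H10 U w"
    unfolding H10_def by blast
qed

section \<open>The fundamental lemma of the calculus of variations\<close>

text \<open>Dynkin argument: open boxes are stable under intersection and generate the Borel sets,
  and the sets over which h has integral zero are closed under disjoint countable unions. Closure
  under complements is where the vanishing total integral enters.\<close>

lemma AE_zero_if_box_integrals_zero: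
  fixes h :: "'a::euclidean_space \<Rightarrow> real"
  assumes int: "integrable lborel h" and tot: "integral\<^sup>L lborel h = 0"
    and box: "\<And>a b. (LINT x:box a b|lborel. h x) = 0"
  shows "AE x in lborel. h x = 0"
proof (rule sigma_finite_measure.density_zero[OF sigma_finite_lborel int])
  fix A :: "'a set" assume "A \<in> sets lborel"
  then have A: "A \<in> sigma_sets UNIV (range (\<lambda>(a, b). box a b))"
    by (simp add: borel_eq_box)
  have stable: "Int_stable (range (\<lambda>(a, b). box a (b::'a)))"
    by (auto simp: Int_stable_def box_Int_box)
  have "range (\<lambda>(a, b). box a (b::'a)) \<subseteq> Pow UNIV"
    by auto
  from stable this A show "(LINT x:A|lborel. h x) = 0"
  proof (induction rule: sigma_sets_induct_disjoint)
    case (compl A)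
    then have m: "A \<in> sets lborel"
      by (simp add: borel_eq_box)
    have "(LINT x:UNIV - A|lborel. h x) = (LINT x|lborel. h x - indicator A x *\<^sub>R h x)"
      unfolding set_lebesgue_integral_def
      by (rule Bochner_Integration.integral_cong) (auto simp: indicator_def)
    also have "\<dots> = integral\<^sup>L lborel h - (LINT x:A|lborel. h x)"
      unfolding set_lebesgue_integral_def
      by (rule Bochner_Integration.integral_diff[OF int integrable_mult_indicator[OF m int]])
    finally show ?case
      using compl tot by simp
  next
    case (union F)
    then have m: "F i \<in> sets lborel" for i
      by (auto simp: borel_eq_box)
    have "(LINT x:(\<Union>i. F i)|lborel. h x) = (\<Sum>i. (LINT x:F i|lborel. h x))"
    proof (rule lebesgue_integral_countable_add)
      show "set_integrable lborel (\<Union> (range F)) h"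
        using m int unfolding set_integrable_def by (intro integrable_mult_indicator) auto
    qed (use m union in \<open>auto simp: disjoint_family_on_def\<close>)
    then show ?case
      using union by simp
  qed (use box in \<open>auto simp: set_lebesgue_integral_def\<close>)
qed

text \<open>Smooth approximations from below of the indicator of an open box, one rising step per
  face. Each of them vanishes outside the open box, so it has compact support in the closed
  one.\<close>

definition bbump :: "'a::euclidean_space \<Rightarrow> 'a \<Rightarrow> nat \<Rightarrow> 'a \<Rightarrow> real" where
  "bbump a b k x = (\<Prod>i\<in>Basis. sstep (real k * (x \<bullet> i - a \<bullet> i)) * sstep (real k * (b \<bullet> i - x \<bullet> i)))"

lemma bbump_eq_0:
  assumes "x \<notin> box a b"
  shows "bbump a b k x = 0"
proof -
  obtain i where i: "i \<in> Basis" "x \<bullet> i \<le> a \<bullet> i \<or> b \<bullet> i \<le> x \<bullet> i"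
    using assms by (force simp: mem_box)
  then have "sstep (real k * (x \<bullet> i - a \<bullet> i)) * sstep (real k * (b \<bullet> i - x \<bullet> i)) = 0"
    by (auto simp: sstep_0 mult_nonneg_nonpos)
  then show ?thesis
    using i(1) by (auto simp: bbump_def)
qed

lemma bbump_bounds: "0 \<le> bbump a b k x" "bbump a b k x \<le> 1"
  unfolding bbump_def
  by (auto intro!: prod_nonneg prod_le_1 mult_nonneg_nonneg mult_le_one sstep_ge_0 sstep_le_1)

lemma test_fun_bbump:
  assumes "cbox a b \<subseteq> U"
  shows "test_fun U (bbump a b k)"
proof (rule test_funI[OF _ compact_cbox assms])
  have "smooth (\<lambda>x. sstep (real k *\<^sub>R (x \<bullet> i) + - (real k * (a \<bullet> i))))" for i
    by (rule smooth_affine[OF _ smooth_sstep]) (intro bounded_linear_intros)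
  moreover have "smooth (\<lambda>x. sstep (- real k *\<^sub>R (x \<bullet> i) + real k * (b \<bullet> i)))" for i
    by (rule smooth_affine[OF _ smooth_sstep]) (intro bounded_linear_intros)
  ultimately show "smooth (bbump a b k)"
    unfolding bbump_def[abs_def]
    by (intro smooth_prod smooth_mult) (auto simp: algebra_simps)
  show "bbump a b k x = 0" if "x \<notin> cbox a b" for x
    using that bbump_eq_0 box_subset_cbox by blast
qed

lemma bbump_tendsto: "(\<lambda>k. bbump a b k x) \<longlonglongrightarrow> indicat_real (box a b) x"
proof (cases "x \<in> box a b")
  case True
  have one: "(\<lambda>k. sstep (real k * t)) \<longlonglongrightarrow> 1" if "t > 0" for t
  proof (rule tendsto_eventually)
    have "filterlim (\<lambda>k. real k * t) at_top sequentially"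
      by (rule filterlim_at_top_mult_tendsto_pos[OF tendsto_const that filterlim_real_sequentially])
    then have "\<forall>\<^sub>F k in sequentially. real k * t \<ge> 1"
      by (simp add: filterlim_at_top)
    then show "\<forall>\<^sub>F k in sequentially. sstep (real k * t) = 1"
      by eventually_elim (rule sstep_1)
  qed
  have "(\<lambda>k. bbump a b k x) \<longlonglongrightarrow> (\<Prod>i\<in>(Basis::'a set). 1 * 1)"
    unfolding bbump_def using True
    by (intro tendsto_prod tendsto_mult one) (auto simp: mem_box)
  with True show ?thesis by simp
qed (simp add: bbump_eq_0)

text \<open>Testing with \<open>bbump\<close> and dominated convergence give zero integrals over all
  open boxes whose closure lies in U. The Dynkin argument then works inside one closed box at a
  time, and countably many closed boxes cover U.\<close>

lemma fundamental_lemma: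
  fixes g :: "'a::euclidean_space \<Rightarrow> real"
  assumes U: "open U" and g: "sqint (lebesgue_on U) g"
    and zero: "\<And>\<phi>. test_fun U \<phi> \<Longrightarrow> (LINT x|lebesgue_on U. g x * \<phi> x) = 0"
  shows "AE x in lebesgue_on U. g x = 0"
proof -
  have U': "U \<in> sets lebesgue" using U by simp
  define g0 where "g0 x = indicat_real U x * g x" for x
  have g0: "sqint lebesgue g0"
  proof -
    have "(norm (g0 x))\<^sup>2 = indicat_real U x *\<^sub>R (norm (g x))\<^sup>2" for x
      by (simp add: g0_def indicator_def)
    then show ?thesis
      using g U' unfolding sqint_def
      by (simp add: g0_def[abs_def] integrable_restrict_space borel_measurable_restrict_space_iff)
  qed
  have sub: "(LINT x|lebesgue. indicat_real (box a b) x * g0 x) = 0" if ab: "cbox a b \<subseteq> U" for a b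
  proof -
    have "(\<lambda>k. LINT x|lebesgue. bbump a b k x * g0 x) \<longlonglongrightarrow> (LINT x|lebesgue. indicat_real (box a b) x * g0 x)"
    proof (rule integral_dominated_convergence[where w = "\<lambda>x. indicat_real (cbox a b) x * \<bar>g0 x\<bar>"])
      have "sqint lebesgue (indicat_real (cbox a b))"
        by (rule sqint_indicator_compact[OF compact_cbox])
      then show "integrable lebesgue (\<lambda>x. indicat_real (cbox a b) x * \<bar>g0 x\<bar>)"
        using sqint_norm[OF g0] by (intro sqint_mult) auto
      show "(\<lambda>x. bbump a b k x * g0 x) \<in> borel_measurable lebesgue" for k
        using sqint_measurable[OF g0] sqint_measurable[OF test_fun_sqint[OF test_fun_bbump[OF ab]]]
        by (rule borel_measurable_times[rotated])
      show "AE x in lebesgue. norm (bbump a b k x * g0 x) \<le> indicat_real (cbox a b) x * \<bar>g0 x\<bar>" for k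
      proof (rule AE_I2)
        fix x
        show "norm (bbump a b k x * g0 x) \<le> indicat_real (cbox a b) x * \<bar>g0 x\<bar>"
        proof (cases "x \<in> cbox a b")
          case True
          then show ?thesis
            using bbump_bounds[of a b k x] by (auto simp: abs_mult intro!: mult_left_le_one_le)
        next
          case False
          then have "x \<notin> box a b"
            using box_subset_cbox by blast
          then show ?thesis
            by (simp add: bbump_eq_0)
        qed
      qed
      show "(\<lambda>x. indicat_real (box a b) x * g0 x) \<in> borel_measurable lebesgue"
        using sqint_measurable[OF g0] by (intro borel_measurable_times borel_measurable_indicator) auto
      show "AE x in lebesgue. (\<lambda>k. bbump a b k x * g0 x) \<longlonglongrightarrow> indicat_real (box a b) x * g0 x"
        by (intro AE_I2 tendsto_mult bbump_tendsto tendsto_const)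
    qed
    moreover have "(LINT x|lebesgue. bbump a b k x * g0 x) = 0" for k
    proof -
      have "(LINT x|lebesgue_on U. g x * bbump a b k x) = (LINT x|lebesgue. bbump a b k x * g0 x)"
        using U' by (simp add: integral_restrict_space g0_def mult_ac)
      then show ?thesis
        using zero[OF test_fun_bbump[OF ab]] by simp
    qed
    ultimately show ?thesis
      by (simp add: LIMSEQ_const_iff)
  qed
  have cb: "AE x in lebesgue. x \<in> cbox a b \<longrightarrow> g0 x = 0" if ab: "cbox a b \<subseteq> U" for a b
  proof -
    \<comment> \<open>The Dynkin argument lives on Borel sets, while the given function is only
      Lebesgue measurable; it is replaced by a Borel version and cut off to the box.\<close>
    obtain g1 where g1: "g1 \<in> borel_measurable lborel" "AE x in lborel. g0 x = g1 x"
      using completion_ex_borel_measurable_real[OF sqint_measurable[OF g0]] by blast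
    define h where "h x = indicat_real (box a b) x * g1 x" for x
    have mh: "h \<in> borel_measurable lborel"
      unfolding h_def[abs_def] using g1(1) by (intro borel_measurable_times borel_measurable_indicator) auto
    have ih: "integrable lborel h"
    proof -
      have "sqint lebesgue (indicat_real (box a b))"
      proof (rule sqint_boundI[OF sqint_indicator_compact[OF compact_cbox, of a b], where c = 1])
        show "AE x in lebesgue. norm (indicat_real (box a b) x) \<le> 1 * norm (indicat_real (cbox a b) x)"
          using subsetD[OF box_subset_cbox[of a b]] by (intro AE_I2) (simp add: indicator_def)
      qed (intro borel_measurable_indicator, simp)
      then have "integrable lebesgue (\<lambda>x. indicat_real (box a b) x * g0 x)"
        using g0 by (rule sqint_mult)
      then have "integrable lebesgue h"
      proof (rule integrable_cong_AE_imp)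
        show "h \<in> borel_measurable lebesgue"
          using mh by (rule measurable_completion)
        show "AE x in lebesgue. indicat_real (box a b) x * g0 x = h x"
          using AE_completion[OF g1(2)] by eventually_elim (simp add: h_def)
      qed
      then show ?thesis
        by (simp add: integrable_completion[OF mh])
    qed
    have hint: "(LINT x:box c d|lborel. h x) = (LINT x|lebesgue. indicat_real (box a b \<inter> box c d) x * g0 x)" for c d
    proof -
      have "(LINT x:box c d|lborel. h x) = (LINT x|lebesgue. indicat_real (box a b \<inter> box c d) x * g1 x)"
        using g1(1) by (subst integral_completion)
          (auto simp: set_lebesgue_integral_def h_def indicator_inter_arith mult_ac)
      also have "\<dots> = (LINT x|lebesgue. indicat_real (box a b \<inter> box c d) x * g0 x)"
      proof (rule integral_cong_AE)
        show "AE x in lebesgue. indicat_real (box a b \<inter> box c d) x * g1 x = indicat_real (box a b \<inter> box c d) x * g0 x"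
          using AE_completion[OF g1(2)] by eventually_elim simp
        have "g1 \<in> borel_measurable lebesgue"
          using g1(1) by (rule measurable_completion)
        then show "(\<lambda>x. indicat_real (box a b \<inter> box c d) x * g1 x) \<in> borel_measurable lebesgue"
          by (intro borel_measurable_times borel_measurable_indicator) auto
        show "(\<lambda>x. indicat_real (box a b \<inter> box c d) x * g0 x) \<in> borel_measurable lebesgue"
          using sqint_measurable[OF g0] by (intro borel_measurable_times borel_measurable_indicator) auto
      qed
      finally show ?thesis .
    qed
    have "AE x in lborel. h x = 0"
    proof (rule AE_zero_if_box_integrals_zero[OF ih])
      show bx: "(LINT x:box c d|lborel. h x) = 0" for c d
        unfolding hint box_Int_box
        by (rule sub) (use ab in \<open>auto simp flip: Int_interval\<close>)
      \<comment> \<open>As h vanishes outside \<open>box a b\<close>, its total integral is itself a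
        box integral.\<close>
      have "(LINT x:box a b|lborel. h x) = integral\<^sup>L lborel h"
        unfolding set_lebesgue_integral_def
        by (rule Bochner_Integration.integral_cong) (auto simp: h_def indicator_def)
      then show "integral\<^sup>L lborel h = 0"
        using bx by metis
    qed
    then have "AE x in lebesgue. h x = 0"
      by (rule AE_completion)
    \<comment> \<open>The covering uses closed boxes but h lives on the open one; the faces between
      them form a null set.\<close>
    moreover have "AE x in lebesgue. x \<notin> cbox a b - box a b"
      using AE_not_in negligible_frontier_interval unfolding negligible_iff_null_sets by blast
    ultimately show ?thesis
      using AE_completion[OF g1(2)] by eventually_elim (auto simp: h_def)
  qed
  obtain \<D> where \<D>: "countable \<D>" "\<D> \<subseteq> Pow U" "\<And>X. X \<in> \<D> \<Longrightarrow> \<exists>a b. X = cbox a b" "\<Union>\<D> = U"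
    using open_countable_Union_open_cbox[OF U] by blast
  have "AE x in lebesgue. x \<in> X \<longrightarrow> g0 x = 0" if "X \<in> \<D>" for X
    using \<D>(2,3) that cb by blast
  then have "AE x in lebesgue. \<forall>X\<in>\<D>. x \<in> X \<longrightarrow> g0 x = 0"
    unfolding AE_ball_countable[OF \<D>(1)] by blast
  then have "AE x in lebesgue. x \<in> U \<longrightarrow> g x = 0"
  proof eventually_elim
    case (elim x)
    show ?case
    proof
      assume x: "x \<in> U"
      then have "g0 x = 0"
        using elim \<D>(4) by blast
      with x show "g x = 0"
        by (simp add: g0_def)
    qed
  qed
  then show ?thesis
    using U' by (simp add: AE_restrict_space_iff)
qed

lemma H1_grad_unique:
  assumes U: "open U" and G: "H1 U w G" and G': "H1 U w G'"
  shows "AE x in lebesgue_on U. G x = G' x"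
proof -
  have U': "U \<in> sets lebesgue" using U by simp
  note s = G[unfolded H1_def L2_iff_sqint[OF U']] G'[unfolded H1_def L2_iff_sqint[OF U']]
  have "AE x in lebesgue_on U. (G x - G' x) \<bullet> i = 0" if i: "i \<in> Basis" for i
  proof (rule fundamental_lemma[OF U])
    show "sqint (lebesgue_on U) (\<lambda>x. (G x - G' x) \<bullet> i)"
      using s by (intro sqint_inner_fixed sqint_diff) auto
    fix \<phi> assume \<phi>: "test_fun U \<phi>"
    have "sqint (lebesgue_on U) \<phi>"
      using \<phi> U' by (intro sqint_lebesgue_on test_fun_sqint)
    then have "integrable (lebesgue_on U) (\<lambda>x. G x \<bullet> i * \<phi> x)" "integrable (lebesgue_on U) (\<lambda>x. G' x \<bullet> i * \<phi> x)"
      using s by (auto intro!: sqint_mult sqint_inner_fixed)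
    moreover have "(LINT x|lebesgue_on U. G x \<bullet> i * \<phi> x) = (LINT x|lebesgue_on U. G' x \<bullet> i * \<phi> x)"
    proof -
      have "(LINT x|lebesgue_on U. w x * frechet_derivative \<phi> (at x) i) = - (LINT x|lebesgue_on U. H x \<bullet> i * \<phi> x)"
        if "weak_grad U w H" for H
        using that \<phi> i unfolding weak_grad_def set_integral_lebesgue_on[OF U'] by blast
      note eq = this
      have "weak_grad U w G" "weak_grad U w G'"
        using s by blast+
      from eq[OF this(1)] eq[OF this(2)] show ?thesis
        by linarith
    qed
    ultimately show "(LINT x|lebesgue_on U. (G x - G' x) \<bullet> i * \<phi> x) = 0"
      by (simp add: inner_diff_left left_diff_distrib)
  qed
  then have "AE x in lebesgue_on U. \<forall>i\<in>Basis. (G x - G' x) \<bullet> i = 0"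
    by (intro AE_finite_allI) auto
  then show ?thesis
  proof eventually_elim
    case (elim x)
    show ?case
      by (rule euclidean_eqI) (use elim in \<open>simp add: inner_diff_left\<close>)
  qed
qed

text \<open>Uniqueness of weak gradients makes the arbitrary choice in \<open>wgrad\<close> agree
  almost everywhere with any gradient computed by hand. Through this lemma the concrete gradients of
  interpolations enter the weak formulations.\<close>

lemma wgrad_AE:
  assumes "open U" "H10g U w G"
  shows "AE x in lebesgue_on U. wgrad U w x = G x"
proof -
  have "H1 U w G"
    using assms by (intro H10g_imp_H1) auto
  then show ?thesis
    using H1_grad_unique[OF assms(1)] someI[of "H1 U w"] unfolding wgrad_def by blast
qed

lemma H10g_wgrad:
  assumes U: "open U" and "H10 U w"
  shows "H10g U w (wgrad U w)"
proof -
  have U': "U \<in> sets lebesgue" using U by simp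
  obtain G where G: "H10g U w G"
    using assms(2) H10_iff_H10g[OF U'] by blast
  have "H1 U w (wgrad U w)"
    unfolding wgrad_def using H10g_imp_H1[OF U' G] by (rule someI[of "H1 U w"])
  then show ?thesis
    using wgrad_AE[OF U G] H10g_sqint[OF G]
    by (intro H10g_cong_AE[OF U' G]) (auto simp: H1_def L2_iff_sqint[OF U'] dest: sqint_measurable)
qed

section \<open>Tensor products\<close>

text \<open>The second factor has infinite measure, but zero times infinity is zero in
  \<open>ennreal\<close>. These cylinders are what makes statements almost everywhere in one
  variable hold almost everywhere on the product.\<close>

lemma null_sets_Times_UNIV:
  fixes N :: "'a::euclidean_space set"
  assumes "N \<in> null_sets lborel"
  shows "N \<times> (UNIV :: 'b::euclidean_space set) \<in> null_sets lborel"
    and "(UNIV :: 'b set) \<times> N \<in> null_sets lborel"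
proof -
  have N: "N \<in> sets borel" "emeasure lborel N = 0"
    using assms by (auto simp: null_sets_def)
  have "N \<times> (UNIV :: 'b set) \<in> sets (lborel \<Otimes>\<^sub>M lborel)" "(UNIV :: 'b set) \<times> N \<in> sets (lborel \<Otimes>\<^sub>M lborel)"
    using N by (auto intro: pair_measureI)
  moreover have "emeasure (lborel \<Otimes>\<^sub>M lborel) (N \<times> (UNIV :: 'b set)) = 0"
    "emeasure (lborel \<Otimes>\<^sub>M lborel) ((UNIV :: 'b set) \<times> N) = 0"
    using N by (simp_all add: lborel.emeasure_pair_measure_Times)
  ultimately show "N \<times> (UNIV :: 'b set) \<in> null_sets lborel" "(UNIV :: 'b set) \<times> N \<in> null_sets lborel"
    unfolding lborel_prod null_sets_def by blast+
qed

lemma AE_lborel_fst: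
  assumes "AE x in lborel. P x"
  shows "AE z in lborel. P (fst (z :: 'a::euclidean_space \<times> 'b::euclidean_space))"
proof -
  obtain N where N: "{x. \<not> P x} \<subseteq> N" "N \<in> null_sets lborel"
    using assms by (auto elim!: AE_E simp: null_sets_def)
  show ?thesis
    by (rule AE_I'[OF null_sets_Times_UNIV(1)[OF N(2)]]) (use N(1) in auto)
qed

lemma AE_lborel_snd:
  assumes "AE y in lborel. P y"
  shows "AE z in lborel. P (snd (z :: 'a::euclidean_space \<times> 'b::euclidean_space))"
proof -
  obtain N where N: "{x. \<not> P x} \<subseteq> N" "N \<in> null_sets lborel"
    using assms by (auto elim!: AE_E simp: null_sets_def)
  show ?thesis
    by (rule AE_I'[OF null_sets_Times_UNIV(2)[OF N(2)]]) (use N(1) in auto)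
qed

text \<open>Lebesgue measure on a product is the completion of the product measure, so measurability
  of a projection between completions also needs that preimages of null sets are null.\<close>

lemma measurable_fst_lebesgue:
    "fst \<in> (lebesgue :: ('a::euclidean_space \<times> 'b::euclidean_space) measure) \<rightarrow>\<^sub>M lebesgue"
  and measurable_snd_lebesgue:
    "snd \<in> (lebesgue :: ('a \<times> 'b) measure) \<rightarrow>\<^sub>M lebesgue"
proof -
  let ?M = "lebesgue :: ('a \<times> 'b) measure"
  have m: "fst \<in> ?M \<rightarrow>\<^sub>M lborel" "snd \<in> ?M \<rightarrow>\<^sub>M lborel"
    by (intro measurable_completion; simp add: borel_measurable_continuous_onI continuous_on_fst continuous_on_snd)+
  have v: "fst -` A = A \<times> (UNIV :: 'b set)" "snd -` B = (UNIV :: 'a set) \<times> B" for A :: "'a set" and B :: "'b set"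
    by auto
  have n: "null_sets (lborel :: 'a measure) \<subseteq> null_sets (distr ?M lborel fst)"
    "null_sets (lborel :: 'b measure) \<subseteq> null_sets (distr ?M lborel snd)"
    using m null_sets_Times_UNIV[THEN null_sets_completionI]
    by (auto simp: null_sets_distr_iff v) (auto simp: null_sets_def)
  show "fst \<in> ?M \<rightarrow>\<^sub>M (lebesgue :: 'a measure)" "snd \<in> ?M \<rightarrow>\<^sub>M (lebesgue :: 'b measure)"
    by (rule completion.measurable_completion2[OF m(1) n(1)] completion.measurable_completion2[OF m(2) n(2)])+
qed

lemma measurable_lebesgue_on_fst:
  assumes "f \<in> borel_measurable (lebesgue_on A)"
  shows "(\<lambda>z. f (fst z)) \<in> borel_measurable (lebesgue_on (A \<times> B))"
  by (rule measurable_compose[OF measurable_restrict_space2[OF _ measurable_restrict_space1[OF measurable_fst_lebesgue]] assms])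
    (auto simp: space_restrict_space)

lemma measurable_lebesgue_on_snd:
  assumes "f \<in> borel_measurable (lebesgue_on B)"
  shows "(\<lambda>z. f (snd z)) \<in> borel_measurable (lebesgue_on (A \<times> B))"
  by (rule measurable_compose[OF measurable_restrict_space2[OF _ measurable_restrict_space1[OF measurable_snd_lebesgue]] assms])
    (auto simp: space_restrict_space)

lemma integral_tensor_lborel:
  fixes g :: "'a::euclidean_space \<Rightarrow> real" and k :: "'b::euclidean_space \<Rightarrow> real"
  assumes "integrable lborel g" "integrable lborel k"
  shows "integrable lborel (\<lambda>z. g (fst z) * k (snd z))"
    and "(LINT z|lborel. g (fst z) * k (snd z)) = (LINT x|lborel. g x) * (LINT y|lborel. k y)"
proof -
  have [measurable]: "g \<in> borel_measurable borel" "k \<in> borel_measurable borel"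
    using assms by (auto dest: borel_measurable_integrable)
  have i: "integrable (lborel \<Otimes>\<^sub>M lborel) (\<lambda>z. g (fst z) * k (snd z))"
  proof (rule lborel_pair.Fubini_integrable)
    show "integrable lborel (\<lambda>x. LINT y|lborel. norm (g (fst (x, y)) * k (snd (x, y))))"
      using assms(1) by (simp add: abs_mult)
  qed (use assms(2) in simp_all)
  then show "integrable lborel (\<lambda>z. g (fst z) * k (snd z))"
    by (simp add: lborel_prod)
  show "(LINT z|lborel. g (fst z) * k (snd z)) = (LINT x|lborel. g x) * (LINT y|lborel. k y)"
    using lborel_pair.integral_fst'[OF i] by (simp add: lborel_prod)
qed

text \<open>Fubini is applied to Borel versions of both factors; cylinders over null sets being
  null, the product of these versions agrees almost everywhere with the original product.\<close>

lemma integral_tensor_lebesgue: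
  fixes g :: "'a::euclidean_space \<Rightarrow> real" and k :: "'b::euclidean_space \<Rightarrow> real"
  assumes g: "integrable lebesgue g" and k: "integrable lebesgue k"
  shows "integrable lebesgue (\<lambda>z. g (fst z) * k (snd z))" (is ?A)
    and "(LINT z|lebesgue. g (fst z) * k (snd z)) = (LINT x|lebesgue. g x) * (LINT y|lebesgue. k y)" (is ?B)
proof -
  obtain g' where g': "g' \<in> borel_measurable lborel" "AE x in lborel. g x = g' x"
    using completion_ex_borel_measurable_real[OF borel_measurable_integrable[OF g]] by blast
  obtain k' where k': "k' \<in> borel_measurable lborel" "AE x in lborel. k x = k' x"
    using completion_ex_borel_measurable_real[OF borel_measurable_integrable[OF k]] by blast
  have ig: "integrable lebesgue g'"
    by (rule integrable_cong_AE_imp[OF g measurable_completion[OF g'(1)] AE_completion[OF g'(2)]])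
  have ik: "integrable lebesgue k'"
    by (rule integrable_cong_AE_imp[OF k measurable_completion[OF k'(1)] AE_completion[OF k'(2)]])
  note t = integral_tensor_lborel[OF ig[unfolded integrable_completion[OF g'(1)]] ik[unfolded integrable_completion[OF k'(1)]]]
  have mt: "(\<lambda>z. g' (fst z) * k' (snd z)) \<in> borel_measurable lborel"
    using t(1) by (rule borel_measurable_integrable)
  have ae: "AE z in lebesgue. g' (fst z) * k' (snd z) = g (fst z) * k (snd z)"
    using AE_completion[OF AE_lborel_fst[OF g'(2)]] AE_completion[OF AE_lborel_snd[OF k'(2)]]
    by eventually_elim simp
  have m: "(\<lambda>z. g (fst z) * k (snd z)) \<in> borel_measurable lebesgue"
    by (intro borel_measurable_times measurable_compose[OF measurable_fst_lebesgue borel_measurable_integrable[OF g]]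
        measurable_compose[OF measurable_snd_lebesgue borel_measurable_integrable[OF k]])
  have it: "integrable lebesgue (\<lambda>z. g' (fst z) * k' (snd z))"
    using t(1) by (simp add: integrable_completion[OF mt])
  show ?A
    by (rule integrable_cong_AE_imp[OF it m ae])
  have "(LINT z|lebesgue. g (fst z) * k (snd z)) = (LINT z|lebesgue. g' (fst z) * k' (snd z))"
    by (rule integral_cong_AE[OF borel_measurable_integrable[OF it] m ae, symmetric])
  also have "\<dots> = (LINT x|lebesgue. g' x) * (LINT y|lebesgue. k' y)"
    using t(2) by (simp add: integral_completion[OF mt] integral_completion[OF g'(1)] integral_completion[OF k'(1)])
  also have "(LINT x|lebesgue. g' x) = (LINT x|lebesgue. g x)"
    by (rule integral_cong_AE[OF borel_measurable_integrable[OF g] borel_measurable_integrable[OF ig] AE_completion[OF g'(2)], symmetric])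
  also have "(LINT y|lebesgue. k' y) = (LINT y|lebesgue. k y)"
    by (rule integral_cong_AE[OF borel_measurable_integrable[OF k] borel_measurable_integrable[OF ik] AE_completion[OF k'(2)], symmetric])
  finally show ?B .
qed

lemma integral_tensor:
  fixes g :: "'a::euclidean_space \<Rightarrow> real" and k :: "'b::euclidean_space \<Rightarrow> real"
  assumes "open A" "open B" "integrable (lebesgue_on A) g" "integrable (lebesgue_on B) k"
  shows "integrable (lebesgue_on (A \<times> B)) (\<lambda>z. g (fst z) * k (snd z))"
    and "(LINT z|lebesgue_on (A \<times> B). g (fst z) * k (snd z)) = (LINT x|lebesgue_on A. g x) * (LINT y|lebesgue_on B. k y)"
proof -
  have AB: "A \<in> sets lebesgue" "B \<in> sets lebesgue" "A \<times> B \<in> sets lebesgue"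
    using assms by (auto simp: open_Times)
  have e: "(\<lambda>z. indicat_real (A \<times> B) z *\<^sub>R (g (fst z) * k (snd z)))
      = (\<lambda>z. (indicat_real A (fst z) *\<^sub>R g (fst z)) * (indicat_real B (snd z) *\<^sub>R k (snd z)))"
    by (auto simp: indicator_times)
  have i: "integrable lebesgue (\<lambda>x. indicat_real A x *\<^sub>R g x)" "integrable lebesgue (\<lambda>x. indicat_real B x *\<^sub>R k x)"
    using assms(3,4) AB by (simp_all add: integrable_restrict_space)
  note t = integral_tensor_lebesgue[OF i, folded e]
  show "integrable (lebesgue_on (A \<times> B)) (\<lambda>z. g (fst z) * k (snd z))"
    using t(1) AB(3) by (simp add: integrable_restrict_space)
  show "(LINT z|lebesgue_on (A \<times> B). g (fst z) * k (snd z)) = (LINT x|lebesgue_on A. g x) * (LINT y|lebesgue_on B. k y)"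
    using t(2) AB by (simp add: integral_restrict_space)
qed

text \<open>\<open>tens (w, G) (k, H)\<close> is the pair consisting of the product \<open>w \<otimes> k\<close> and its formal gradient.\<close>
definition tens :: "('a::euclidean_space \<Rightarrow> real \<times> 'a) \<Rightarrow> ('b::euclidean_space \<Rightarrow> real \<times> 'b) \<Rightarrow> 'a \<times> 'b \<Rightarrow> real \<times> 'a \<times> 'b" where
  "tens W E z = (fst (W (fst z)) * fst (E (snd z)), fst (E (snd z)) *\<^sub>R snd (W (fst z)), fst (W (fst z)) *\<^sub>R snd (E (snd z)))"

lemma tens_diff_left: "tens W E z - tens W' E z = tens (\<lambda>x. W x - W' x) E z"
  and tens_diff_right: "tens W E z - tens W E' z = tens W (\<lambda>y. E y - E' y) z"
  by (simp_all add: tens_def algebra_simps)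

text \<open>The two sides differ by the product of the squared norms of the two gradients. The bound
  makes \<open>tens\<close> a bounded bilinear map between L2 spaces, which allows approximation in
  each factor separately.\<close>

lemma norm_tens_le: "(norm (tens W E z))\<^sup>2 \<le> (norm (W (fst z)))\<^sup>2 * (norm (E (snd z)))\<^sup>2"
proof -
  have "(norm (tens W E z))\<^sup>2 \<le> ((fst (W (fst z)))\<^sup>2 + (norm (snd (W (fst z))))\<^sup>2) * ((fst (E (snd z)))\<^sup>2 + (norm (snd (E (snd z))))\<^sup>2)"
    by (simp add: tens_def norm_Pair algebra_simps power_mult_distrib)
  also have "\<dots> = (norm (W (fst z)))\<^sup>2 * (norm (E (snd z)))\<^sup>2"
    by (simp add: norm_prod_def)
  finally show ?thesis .
qed

lemma sqint_tens:
  assumes "open A" "open B" and W: "sqint (lebesgue_on A) W" and E: "sqint (lebesgue_on B) E"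
  shows "sqint (lebesgue_on (A \<times> B)) (tens W E)"
    and "(LINT z|lebesgue_on (A \<times> B). (norm (tens W E z))\<^sup>2)
      \<le> (LINT x|lebesgue_on A. (norm (W x))\<^sup>2) * (LINT y|lebesgue_on B. (norm (E y))\<^sup>2)"
proof -
  note t = integral_tensor[OF assms(1,2) sqint_integrable[OF W] sqint_integrable[OF E]]
  have m: "tens W E \<in> borel_measurable (lebesgue_on (A \<times> B))"
    unfolding tens_def[abs_def]
    using sqint_fst[OF W] sqint_snd[OF W] sqint_fst[OF E] sqint_snd[OF E]
    by (intro borel_measurable_Pair borel_measurable_times borel_measurable_scaleR
        measurable_lebesgue_on_fst measurable_lebesgue_on_snd) (auto dest: sqint_measurable)
  have i: "integrable (lebesgue_on (A \<times> B)) (\<lambda>z. (norm (tens W E z))\<^sup>2)"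
  proof (rule Bochner_Integration.integrable_bound[OF t(1)])
    show "AE z in lebesgue_on (A \<times> B). norm ((norm (tens W E z))\<^sup>2) \<le> norm ((norm (W (fst z)))\<^sup>2 * (norm (E (snd z)))\<^sup>2)"
      by (rule AE_I2) (simp add: norm_tens_le)
  qed (use m in measurable)
  then show "sqint (lebesgue_on (A \<times> B)) (tens W E)"
    using m by (simp add: sqint_def)
  show "(LINT z|lebesgue_on (A \<times> B). (norm (tens W E z))\<^sup>2)
      \<le> (LINT x|lebesgue_on A. (norm (W x))\<^sup>2) * (LINT y|lebesgue_on B. (norm (E y))\<^sup>2)"
    unfolding t(2)[symmetric] by (intro integral_mono i t(1) norm_tens_le)
qed

lemma test_fun_tensor:
  assumes "test_fun A \<phi>" "test_fun B \<psi>"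
  shows "test_fun (A \<times> B) (\<lambda>z. \<phi> (fst z) * \<psi> (snd z))"
proof -
  obtain K where K: "smooth \<phi>" "compact K" "K \<subseteq> A" "\<And>x. x \<notin> K \<Longrightarrow> \<phi> x = 0"
    using assms(1) by (rule test_funE) (rule that)
  obtain L where L: "smooth \<psi>" "compact L" "L \<subseteq> B" "\<And>x. x \<notin> L \<Longrightarrow> \<psi> x = 0"
    using assms(2) by (rule test_funE) (rule that)
  show ?thesis
  proof (rule test_funI)
    show "smooth (\<lambda>z. \<phi> (fst z) * \<psi> (snd z))"
      using smooth_affine[OF bounded_linear_fst K(1), of 0] smooth_affine[OF bounded_linear_snd L(1), of 0]
      by (intro smooth_mult) simp_all
    show "compact (K \<times> L)" "K \<times> L \<subseteq> A \<times> B"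
      using K L by (auto intro: compact_Times)
    show "\<phi> (fst z) * \<psi> (snd z) = 0" if "z \<notin> K \<times> L" for z
      using that K(4) L(4) by (cases z) auto
  qed
qed

lemma cgrad_tensor:
  assumes "smooth \<phi>" "smooth \<psi>"
  shows "((\<phi> (fst z) * \<psi> (snd z)), cgrad (\<lambda>z. \<phi> (fst z) * \<psi> (snd z)) z)
    = tens (jet \<phi>) (jet \<psi>) z"
proof -
  have "((\<lambda>z. \<phi> (fst z) * \<psi> (snd z)) has_derivative
      (\<lambda>v. \<phi> (fst z) * (cgrad \<psi> (snd z) \<bullet> snd v) + (cgrad \<phi> (fst z) \<bullet> fst v) * \<psi> (snd z))) (at z)"
    by (intro has_derivative_mult has_derivative_compose[OF bounded_linear_imp_has_derivative[OF bounded_linear_fst]]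
        has_derivative_compose[OF bounded_linear_imp_has_derivative[OF bounded_linear_snd]]
        smooth_has_derivative_cgrad assms)
  then have "((\<lambda>z. \<phi> (fst z) * \<psi> (snd z)) has_derivative
      (\<lambda>v. (\<psi> (snd z) *\<^sub>R cgrad \<phi> (fst z), \<phi> (fst z) *\<^sub>R cgrad \<psi> (snd z)) \<bullet> v)) (at z)"
    by (simp add: inner_prod_def algebra_simps)
  then show ?thesis
    by (simp add: tens_def cgrad_eqI)
qed

text \<open>Products of test functions are test functions on the product set. Closedness is used
  twice: first w is approximated while the other factor is a test function, then k is approximated
  with w already general.\<close>

lemma H10g_tensor:
  assumes "open A" "open B" and w: "H10g A w G" and k: "H10g B k H"
  shows "H10g (A \<times> B) (\<lambda>z. w (fst z) * k (snd z)) (\<lambda>z. (k (snd z) *\<^sub>R G (fst z), w (fst z) *\<^sub>R H (snd z)))"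
proof -
  have AB: "A \<in> sets lebesgue" "B \<in> sets lebesgue" "A \<times> B \<in> sets lebesgue"
    using assms by (auto simp: open_Times)
  define W E where "W x = (w x, G x)" and "E y = (k y, H y)" for x y
  have sW: "sqint (lebesgue_on A) W" and sE: "sqint (lebesgue_on B) E"
    using w k unfolding W_def[abs_def] E_def[abs_def] by (auto dest: H10g_sqint_Pair)
  let ?N = "\<lambda>A W. LINT x|lebesgue_on A. (norm (W x))\<^sup>2"
  have step1: "H10g (A \<times> B) (\<lambda>z. fst (tens W (jet \<psi>) z)) (\<lambda>z. snd (tens W (jet \<psi>) z))"
    if \<psi>: "test_fun B \<psi>" for \<psi>
  proof (rule H10g_closed[OF AB(3)])
    define P where "P y = (\<psi> y, cgrad \<psi> y)" for y
    have sP: "sqint (lebesgue_on B) P"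
      unfolding P_def[abs_def] by (rule test_fun_sqint_Pair[OF AB(2) \<psi>])
    show "sqint (lebesgue_on (A \<times> B)) (\<lambda>z. (fst (tens W (jet \<psi>) z), snd (tens W (jet \<psi>) z)))"
      using sqint_tens(1)[OF assms(1,2) sW sP] by (simp add: P_def[abs_def])
    fix e :: real assume e: "e > 0"
    have nP: "?N B P \<ge> 0" by simp
    have "e / (?N B P + 1) > 0" by (intro divide_pos_pos add_nonneg_pos e nP) simp
    then obtain \<phi> where \<phi>: "test_fun A \<phi>" "sqdist (lebesgue_on A) (jet \<phi>) W < e / (?N B P + 1)"
      using w unfolding H10g_def W_def[abs_def] by meson
    have s\<phi>: "sqint (lebesgue_on A) (jet \<phi>)"
      by (rule test_fun_sqint_Pair[OF AB(1) \<phi>(1)])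
    have "sqdist (lebesgue_on (A \<times> B)) (tens (jet \<phi>) P) (tens W P)
        \<le> sqdist (lebesgue_on A) (jet \<phi>) W * ?N B P"
      unfolding sqdist_def tens_diff_left
      by (rule sqint_tens(2)[OF assms(1,2) sqint_diff[OF s\<phi> sW] sP])
    also have "\<dots> \<le> e / (?N B P + 1) * ?N B P"
      using \<phi>(2) nP by (intro mult_right_mono) auto
    also have "\<dots> < e"
      using e nP by (simp add: divide_less_eq distrib_left add_nonneg_pos)
    finally have "sqdist (lebesgue_on (A \<times> B)) (tens (jet \<phi>) P) (tens W P) < e" .
    moreover have "(\<lambda>z. (\<phi> (fst z) * \<psi> (snd z), cgrad (\<lambda>z. \<phi> (fst z) * \<psi> (snd z)) z)) = tens (jet \<phi>) P"
      unfolding P_def[abs_def] using cgrad_tensor[OF \<phi>(1)[THEN test_fun_smooth] \<psi>[THEN test_fun_smooth]] by (rule ext)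
    moreover have "H10g (A \<times> B) (\<lambda>z. \<phi> (fst z) * \<psi> (snd z)) (cgrad (\<lambda>z. \<phi> (fst z) * \<psi> (snd z)))"
      by (rule H10g_test_fun[OF AB(3) test_fun_tensor[OF \<phi>(1) \<psi>]])
    ultimately show "\<exists>v V. H10g (A \<times> B) v V \<and> sqdist (lebesgue_on (A \<times> B)) (\<lambda>z. (v z, V z))
       (\<lambda>z. (fst (tens W (jet \<psi>) z), snd (tens W (jet \<psi>) z))) < e"
      by (intro exI[of _ "\<lambda>z. \<phi> (fst z) * \<psi> (snd z)"] exI[of _ "cgrad (\<lambda>z. \<phi> (fst z) * \<psi> (snd z))"])
        (simp add: P_def[abs_def])
  qed
  have "H10g (A \<times> B) (\<lambda>z. fst (tens W E z)) (\<lambda>z. snd (tens W E z))"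
  proof (rule H10g_closed[OF AB(3)])
    show "sqint (lebesgue_on (A \<times> B)) (\<lambda>z. (fst (tens W E z), snd (tens W E z)))"
      using sqint_tens(1)[OF assms(1,2) sW sE] by simp
    fix e :: real assume e: "e > 0"
    have nW: "?N A W \<ge> 0" by simp
    have "e / (?N A W + 1) > 0" by (intro divide_pos_pos add_nonneg_pos e nW) simp
    then obtain \<psi> where \<psi>: "test_fun B \<psi>" "sqdist (lebesgue_on B) (jet \<psi>) E < e / (?N A W + 1)"
      using k unfolding H10g_def E_def[abs_def] by meson
    define P where "P y = (\<psi> y, cgrad \<psi> y)" for y
    have sP: "sqint (lebesgue_on B) P"
      unfolding P_def[abs_def] by (rule test_fun_sqint_Pair[OF AB(2) \<psi>(1)])
    have "sqdist (lebesgue_on (A \<times> B)) (tens W P) (tens W E) \<le> ?N A W * sqdist (lebesgue_on B) P E"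
      unfolding sqdist_def tens_diff_right
      by (rule sqint_tens(2)[OF assms(1,2) sW sqint_diff[OF sP sE]])
    also have "\<dots> \<le> ?N A W * (e / (?N A W + 1))"
      using \<psi>(2) nW by (intro mult_left_mono) (auto simp: P_def[abs_def])
    also have "\<dots> < e"
      using e nW by (simp add: divide_less_eq distrib_left add_nonneg_pos)
    finally have "sqdist (lebesgue_on (A \<times> B)) (tens W P) (tens W E) < e" .
    then show "\<exists>v V. H10g (A \<times> B) v V \<and> sqdist (lebesgue_on (A \<times> B)) (\<lambda>z. (v z, V z))
       (\<lambda>z. (fst (tens W E z), snd (tens W E z))) < e"
      using step1[OF \<psi>(1)]
      by (intro exI[of _ "\<lambda>z. fst (tens W P z)"] exI[of _ "\<lambda>z. snd (tens W P z)"])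
        (simp add: P_def[abs_def])
  qed
  then show ?thesis
    by (simp add: tens_def W_def E_def)
qed

section \<open>Hat functions and interpolation\<close>

text \<open>With h = 1/(N+1), this is the piecewise linear hat of height 1 at the node i h, written
  as a second difference of ramps max(y - c, 0). Derivative, mollification and integral thereby
  reduce to those of a single ramp.\<close>

definition hat :: "nat \<Rightarrow> nat \<Rightarrow> real \<Rightarrow> real" where
  "hat N i y = real (N + 1) * (max (y - (real i - 1) / real (N + 1)) 0 - 2 * max (y - real i / real (N + 1)) 0
     + max (y - (real i + 1) / real (N + 1)) 0)"

text \<open>With \<open>heav 0 = 1\<close> the derivative \<open>dhat\<close> agrees with the difference quotients everywhere
  on the unit interval, also at the grid points.\<close>
definition heav :: "real \<Rightarrow> real" where
  "heav t = (if 0 \<le> t then 1 else 0)"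

definition dhat :: "nat \<Rightarrow> nat \<Rightarrow> real \<Rightarrow> real" where
  "dhat N i y = real (N + 1) * (heav (y - (real i - 1) / real (N + 1)) - 2 * heav (y - real i / real (N + 1))
     + heav (y - (real i + 1) / real (N + 1)))"

text \<open>An antiderivative of \<open>sstep\<close>: constant to the left of 0 and of slope 1 to
  the right of 1. As the slope lies between 0 and 1 throughout, it stays within distance 1 of the
  ramp, and \<kappa> is the delay picked up on the unit interval.\<close>

lemma smooth_ramp_exists:
  obtains P :: "real \<Rightarrow> real" and \<kappa> where "smooth P" "\<And>t. (P has_real_derivative sstep t) (at t)"
    "\<And>t. t \<le> 0 \<Longrightarrow> P t = 0" "\<And>t. t \<ge> 1 \<Longrightarrow> P t = t - \<kappa>" "\<And>t. \<bar>P t - max t 0\<bar> \<le> 1"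
proof -
  obtain Q where Q: "smooth Q" "\<And>t. (Q has_real_derivative sstep t) (at t)"
    using smooth_antiderivative[OF smooth_sstep] by blast
  define P where "P t = Q t + (- Q 0)" for t
  have smP: "smooth P"
    unfolding P_def[abs_def] by (intro smooth_add Q smooth_const)
  have dP: "(P has_real_derivative sstep t) (at t)" for t
    unfolding P_def[abs_def] using Q(2) by (auto intro!: derivative_eq_intros)
  have cont: "continuous_on T P" for T
    using smooth_continuous[OF smP] .
  have P0: "P t = 0" if "t \<le> 0" for t
  proof (cases "t = 0")
    case False
    have "(P has_real_derivative 0) (at x)" if "t < x" "x < 0" for x
      using dP[of x] sstep_0[of x] that by simp
    with False that show ?thesis
      using DERIV_isconst_end[of t 0 P] cont by (simp add: P_def)
  qed (simp add: P_def)
  have P1: "P t - t = P 1 - 1" if "t \<ge> 1" for t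
  proof (cases "t = 1")
    case False
    have "((\<lambda>x. P x - x) has_real_derivative 0) (at x)" if "1 < x" "x < t" for x
      using dP[of x] sstep_1[of x] that by (auto intro!: derivative_eq_intros)
    with False that show ?thesis
      using DERIV_isconst_end[of 1 t "\<lambda>x. P x - x"] cont by (simp add: continuous_on_diff)
  qed simp
  have up: "P s \<le> P t" if "s \<le> t" for s t
    using DERIV_nonneg_imp_nondecreasing[OF that] dP sstep_ge_0 by blast
  have down: "P t - t \<le> P s - s" if "s \<le> t" for s t
  proof (rule DERIV_nonpos_imp_nonincreasing[OF that, of "\<lambda>x. P x - x"])
    show "\<exists>y. ((\<lambda>x. P x - x) has_real_derivative y) (at x) \<and> y \<le> 0" for x
      using dP[of x] sstep_le_1[of x] by (intro exI[of _ "sstep x - 1"]) (auto intro!: derivative_eq_intros)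
  qed
  have "\<bar>P t - max t 0\<bar> \<le> 1" for t
  proof -
    consider "t \<le> 0" | "0 \<le> t" "t \<le> 1" | "t \<ge> 1" by linarith
    then show ?thesis
    proof cases
      case 1
      then show ?thesis by (simp add: P0)
    next
      case 2
      then show ?thesis
        using up[of 0 t] down[of 0 t] P0[of 0] by simp
    next
      case 3
      then show ?thesis
        using up[of 0 1] down[of 0 1] P0[of 0] P1[of t] by simp
    qed
  qed
  with smP dP P0 P1 show ?thesis
    using that[of P "1 - P 1"] by (simp add: algebra_simps)
qed

text \<open>The argument equals t / d k + c, which eventually leaves the transition zone of the step
  on the side given by the sign of t. The point t = 0 is a kink of the hat and is neglected as a
  null set.\<close>

lemma sstep_scaled_tendsto_heav:
  assumes d: "\<And>k. d k > 0" "d \<longlonglongrightarrow> 0" and t: "t \<noteq> 0"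
  shows "(\<lambda>k. sstep ((t + c * d k) / d k)) \<longlonglongrightarrow> heav t"
proof (cases "t > 0")
  case True
  have "((\<lambda>k. t + (c - 1) * d k) \<longlonglongrightarrow> t + (c - 1) * 0)"
    by (intro tendsto_intros d)
  then have "\<forall>\<^sub>F k in sequentially. 0 < t + (c - 1) * d k"
    using order_tendstoD(1)[of _ t sequentially 0] True by simp
  then have "\<forall>\<^sub>F k in sequentially. sstep ((t + c * d k) / d k) = heav t"
  proof eventually_elim
    case (elim k)
    then show ?case
      using d(1)[of k] True by (subst sstep_1) (simp_all add: heav_def field_simps)
  qed
  then show ?thesis by (rule tendsto_eventually)
next
  case False
  have "((\<lambda>k. t + c * d k) \<longlonglongrightarrow> t + c * 0)"
    by (intro tendsto_intros d)
  then have "\<forall>\<^sub>F k in sequentially. t + c * d k < 0"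
    using order_tendstoD(2)[of _ t sequentially 0] False t by simp
  then have "\<forall>\<^sub>F k in sequentially. sstep ((t + c * d k) / d k) = heav t"
  proof eventually_elim
    case (elim k)
    then show ?case
      using d(1)[of k] False t by (subst sstep_0) (auto simp: heav_def divide_nonpos_pos)
  qed
  then show ?thesis by (rule tendsto_eventually)
qed

lemma heav_measurable [measurable]: "heav \<in> borel_measurable borel"
  unfolding heav_def[abs_def] by measurable

lemma finite_measure_lebesgue_on:
  fixes S :: "'a::euclidean_space set"
  assumes "bounded S" "S \<in> sets lebesgue"
  shows "finite_measure (lebesgue_on S)"
proof (rule finite_measureI)
  show "emeasure (lebesgue_on S) (space (lebesgue_on S)) \<noteq> \<infinity>"
    using fmeasurableD2[OF bounded_set_imp_lmeasurable[OF assms]] assms(2)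
    by (simp add: emeasure_restrict_space space_restrict_space del: emeasure_completion)
qed

lemma borel_measurable_lebesgue_on:
  "f \<in> borel_measurable borel \<Longrightarrow> f \<in> borel_measurable (lebesgue_on S)"
  by (intro measurable_restrict_space1 measurable_completion) simp

lemma H10g_cong:
  assumes "U \<in> sets lebesgue" "H10g U v V" "\<And>x. x \<in> U \<Longrightarrow> w x = v x" "\<And>x. x \<in> U \<Longrightarrow> W x = V x"
  shows "H10g U w W"
proof (rule H10g_cong_AE[OF assms(1,2)])
  show "w \<in> borel_measurable (lebesgue_on U)"
    using sqint_measurable[OF H10g_sqint[OF assms(2)]] assms(3)
    by (subst measurable_cong[where g = v]) (auto simp: space_restrict_space)
  show "W \<in> borel_measurable (lebesgue_on U)"
    using sqint_measurable[OF H10g_sqint_grad[OF assms(2)]] assms(4)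
    by (subst measurable_cong[where g = V]) (auto simp: space_restrict_space)
qed (auto intro!: AE_I2 simp: space_restrict_space assms)

lemma abs_heav_le: "\<bar>heav t\<bar> \<le> 1"
  by (simp add: heav_def)

text \<open>The approximating test functions replace each ramp by the smooth ramp at width
  \<open>d k\<close>. Values converge uniformly; derivatives stay bounded and converge off the three
  kinks, so dominated convergence gives convergence of the jets.\<close>

lemma H10g_hat:
  assumes i: "1 \<le> i" "i \<le> N"
  shows "H10g {0<..<1} (hat N i) (dhat N i)"
proof -
  let ?U = "{0<..<1::real}"
  have fm: "finite_measure (lebesgue_on ?U)"
    by (intro finite_measure_lebesgue_on) auto
  define n where "n = real (N + 1)"
  define a b c where "a = (real i - 1) / n" and "b = real i / n" and "c = (real i + 1) / n"
  have n: "n \<ge> 1" by (simp add: n_def)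
  have abc: "0 \<le> a" "c \<le> 1" "b = a + 1 / n" "c = a + 2 / n"
  proof -
    show "0 \<le> a" "c \<le> 1"
      using i n by (simp_all add: a_def c_def n_def)
    show "b = a + 1 / n" "c = a + 2 / n"
      by (simp_all add: a_def b_def c_def diff_divide_distrib add_divide_distrib)
  qed
  have hat: "hat N i y = n * (max (y - a) 0 - 2 * max (y - b) 0 + max (y - c) 0)" for y
    by (simp add: hat_def n_def a_def b_def c_def)
  have dhat: "dhat N i y = n * (heav (y - a) - 2 * heav (y - b) + heav (y - c))" for y
    by (simp add: dhat_def n_def a_def b_def c_def)
  \<comment> \<open>The width is at most half the mesh size. Hence all three smoothed ramps vanish
    to the left of a + 2 d k, and all three are on their affine branch to the right of c - d
    k.\<close>
  define d where "d k = 1 / n * inverse (real (Suc (Suc k)))" for k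
  have d: "d k > 0" "d k \<le> 1 / (2 * n)" for k
  proof -
    show "d k > 0"
      unfolding d_def using n by (intro mult_pos_pos) auto
    have "inverse (real (Suc (Suc k))) \<le> inverse 2"
      by (rule le_imp_inverse_le) auto
    then have "1 / n * inverse (real (Suc (Suc k))) \<le> 1 / n * inverse 2"
      by (intro mult_left_mono) (use n in auto)
    then show "d k \<le> 1 / (2 * n)"
      by (simp add: d_def inverse_eq_divide)
  qed
  have d0: "d \<longlonglongrightarrow> 0"
    unfolding d_def[abs_def] by (rule tendsto_mult_right_zero) (rule LIMSEQ_Suc[OF LIMSEQ_inverse_real_of_nat])
  obtain P \<kappa> where P: "smooth P" "\<And>t. (P has_real_derivative sstep t) (at t)"
    "\<And>t. t \<le> 0 \<Longrightarrow> P t = 0" "\<And>t. t \<ge> 1 \<Longrightarrow> P t = t - \<kappa>" "\<And>t. \<bar>P t - max t 0\<bar> \<le> 1"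
    using smooth_ramp_exists by blast
  define Q where "Q k s = d k * P (s / d k)" for k s
  have Q: "\<bar>Q k s - max s 0\<bar> \<le> d k" for k s
  proof -
    have "Q k s - max s 0 = d k * (P (s / d k) - max (s / d k) 0)"
      using d(1)[of k] by (simp add: Q_def max_def field_simps)
    then show ?thesis
      using P(5)[of "s / d k"] d(1)[of k] by (simp add: abs_mult)
  qed
  \<comment> \<open>The outer ramps are shifted inwards, which makes the support compact in \<open>(0, 1)\<close>; to the right of
    the support the three ramps cancel because of \<open>a - 2 * b + c = 0\<close>.\<close>
  define \<psi> where "\<psi> k y = n * (Q k (y - a - 2 * d k) - 2 * Q k (y - b) + Q k (y - c + 2 * d k))" for k y
  define \<psi>' where "\<psi>' k y = n * (sstep ((y - a + (-2) * d k) / d k) - 2 * sstep ((y - b + 0 * d k) / d k) + sstep ((y - c + 2 * d k) / d k))" for k y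
  have cg: "cgrad (\<psi> k) y = \<psi>' k y" for k y
  proof (rule cgrad_eqI)
    have dQ: "((\<lambda>y. Q k (y + e)) has_real_derivative sstep ((y + e) / d k)) (at y)" for e
    proof -
      have "((\<lambda>y. P ((y + e) / d k)) has_real_derivative sstep ((y + e) / d k) * (1 / d k)) (at y)"
        by (rule DERIV_chain2[OF P(2)]) (use d(1)[of k] in \<open>auto intro!: derivative_eq_intros\<close>)
      from DERIV_cmult[OF this, of "d k"] show ?thesis
        unfolding Q_def by (simp add: less_imp_neq[OF d(1), THEN not_sym])
    qed
    have "(\<psi> k has_real_derivative \<psi>' k y) (at y)"
      unfolding \<psi>_def[abs_def] \<psi>'_def
      using dQ[of "- a - 2 * d k"] dQ[of "- b"] dQ[of "- c + 2 * d k"]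
      by (auto intro!: derivative_eq_intros simp: algebra_simps)
    then show "(\<psi> k has_derivative (\<lambda>v. \<psi>' k y \<bullet> v)) (at y)"
      by (simp add: has_field_derivative_def)
  qed
  have test: "test_fun ?U (\<psi> k)" for k
  proof (rule test_funI[of _ "{a + 2 * d k..c - d k}"])
    have "smooth (\<lambda>y. Q k (y + e))" for e
    proof -
      have "smooth (\<lambda>y. P ((1 / d k) *\<^sub>R y + e / d k))"
        by (intro smooth_affine P bounded_linear_scaleR_right)
      then show ?thesis
        unfolding Q_def by (intro smooth_mult smooth_const) (simp add: add_divide_distrib)
    qed
    from this[of "- a - 2 * d k"] this[of "- b"] this[of "- c + 2 * d k"]
    have "smooth (\<lambda>y. n * (Q k (y + (- a - 2 * d k)) + (- 2) * Q k (y + (- b)) + Q k (y + (- c + 2 * d k))))"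
      by (intro smooth_mult smooth_add smooth_const)
    then show "smooth (\<psi> k)"
      unfolding \<psi>_def[abs_def] by (simp add: algebra_simps)
    show "{a + 2 * d k..c - d k} \<subseteq> ?U"
      using abc d(1)[of k] by auto
    have dn: "2 * d k \<le> 1 / n" using d(2)[of k] by simp
    fix y assume "y \<notin> {a + 2 * d k..c - d k}"
    then consider "y < a + 2 * d k" | "y > c - d k" by fastforce
    then show "\<psi> k y = 0"
    proof cases
      case 1
      have z: "Q k s = 0" if "s \<le> 0" for s
        using P(3) that d(1)[of k] by (simp add: Q_def divide_nonpos_pos)
      show ?thesis
        using 1 dn abc d(1)[of k] z by (simp add: \<psi>_def)
    next
      case 2
      have z: "Q k s = s - d k * \<kappa>" if "s \<ge> d k" for s
        using P(4)[of "s / d k"] that d(1)[of k] by (simp add: Q_def field_simps)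
      have "Q k (y - a - 2 * d k) = (y - a - 2 * d k) - d k * \<kappa>" "Q k (y - b) = y - b - d k * \<kappa>"
        "Q k (y - c + 2 * d k) = y - c + 2 * d k - d k * \<kappa>"
        by (rule z, use 2 dn abc d(1)[of k] in \<open>simp add: field_simps\<close>)+
      then show ?thesis
        using abc by (simp add: \<psi>_def)
    qed
  qed simp
  have mhat: "hat N i \<in> borel_measurable borel" "dhat N i \<in> borel_measurable borel"
    unfolding hat_def[abs_def] dhat_def[abs_def] by measurable
  have dhat_le: "\<bar>dhat N i y\<bar> \<le> 4 * n" for y
    using abs_heav_le[of "y - a"] abs_heav_le[of "y - b"] abs_heav_le[of "y - c"] n
    unfolding dhat abs_mult by (simp add: mult.commute[of 4])
  have \<psi>'_le: "\<bar>\<psi>' k y\<bar> \<le> 4 * n" for k y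
    using sstep_ge_0 sstep_le_1 n unfolding \<psi>'_def abs_mult
    by (simp add: mult.commute[of 4]) (smt (verit, best) sstep_ge_0 sstep_le_1)
  \<comment> \<open>Smoothing costs d k per ramp and the shift another 2 d k for the outer two: 3 +
    2 * 1 + 3 = 8, the middle ramp having weight 2.\<close>
  have \<psi>_le: "\<bar>\<psi> k y - hat N i y\<bar> \<le> n * (8 * d k)" for k y
  proof -
    have tri: "\<bar>X - 2 * Y + Z\<bar> \<le> 8 * D" if "\<bar>X\<bar> \<le> 3 * D" "\<bar>Y\<bar> \<le> D" "\<bar>Z\<bar> \<le> 3 * D" for X Y Z D :: real
      using that by linarith
    have e: "\<psi> k y - hat N i y = n * ((Q k (y - a - 2 * d k) - max (y - a) 0) - 2 * (Q k (y - b) - max (y - b) 0)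
        + (Q k (y - c + 2 * d k) - max (y - c) 0))"
      unfolding \<psi>_def hat by (simp add: algebra_simps)
    have "\<bar>Q k (y - a - 2 * d k) - max (y - a) 0\<bar> \<le> 3 * d k"
      using Q[of k "y - a - 2 * d k"] d(1)[of k] by linarith
    moreover have "\<bar>Q k (y - c + 2 * d k) - max (y - c) 0\<bar> \<le> 3 * d k"
      using Q[of k "y - c + 2 * d k"] d(1)[of k] by linarith
    ultimately show ?thesis
      unfolding e abs_mult using Q[of k "y - b"] n by (intro mult_mono tri) auto
  qed
  have sq: "sqint (lebesgue_on ?U) (\<lambda>y. (hat N i y, dhat N i y))"
  proof (rule sqint_Pair)
    show "sqint (lebesgue_on ?U) (dhat N i)"
      by (rule sqint_bounded[OF fm borel_measurable_lebesgue_on[OF mhat(2)]]) (use dhat_le in simp)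
    show "sqint (lebesgue_on ?U) (hat N i)"
    proof (rule sqint_bounded[OF fm borel_measurable_lebesgue_on[OF mhat(1)]])
      fix y assume "y \<in> space (lebesgue_on ?U)"
      then have y: "0 < y" "y < 1" by (auto simp: space_restrict_space)
      have "\<bar>max (y - a) 0 - 2 * max (y - b) 0 + max (y - c) 0\<bar> \<le> 4"
      proof -
        have tri: "\<bar>X - 2 * Y + Z\<bar> \<le> 4" if "\<bar>X\<bar> \<le> 1" "\<bar>Y\<bar> \<le> 1" "\<bar>Z\<bar> \<le> 1" for X Y Z :: real
          using that by linarith
        have "0 \<le> b" "0 \<le> c"
          using abc(1,3,4) n by simp_all
        then show ?thesis
          using y abc(1) by (intro tri) auto
      qed
      then show "norm (hat N i y) \<le> n * 4"
        using n unfolding hat by (simp add: abs_mult)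
    qed
  qed
  let ?D = "\<lambda>k y. (norm ((\<psi> k y, cgrad (\<psi> k) y) - (hat N i y, dhat N i y)))\<^sup>2"
  have "(\<lambda>k. LINT y|lebesgue_on ?U. ?D k y) \<longlonglongrightarrow> (LINT y|lebesgue_on ?U. 0)"
  proof (rule integral_dominated_convergence[where w = "\<lambda>y. 16 + (8 * n)\<^sup>2"])
    show "integrable (lebesgue_on ?U) (\<lambda>y. 16 + (8 * n)\<^sup>2)"
      by (rule finite_measure.integrable_const[OF fm])
    show "?D k \<in> borel_measurable (lebesgue_on ?U)" for k
      using sqint_integrable[OF sqint_diff[OF test_fun_sqint_Pair[OF _ test[of k]] sq]] by auto
    show "AE y in lebesgue_on ?U. norm (?D k y) \<le> 16 + (8 * n)\<^sup>2" for k
    proof (rule AE_I2)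
      fix y
      have "n * (8 * d k) \<le> 4" using d(2)[of k] n by (simp add: field_simps)
      then have "(\<psi> k y - hat N i y)\<^sup>2 \<le> 4\<^sup>2"
        using \<psi>_le[of k y] by (intro abs_le_square_iff[THEN iffD1]) simp
      moreover have "(\<psi>' k y - dhat N i y)\<^sup>2 \<le> (8 * n)\<^sup>2"
        using \<psi>'_le[of k y] dhat_le[of y] n by (intro abs_le_square_iff[THEN iffD1]) simp
      ultimately show "norm (?D k y) \<le> 16 + (8 * n)\<^sup>2"
        by (simp add: norm_Pair cg)
    qed
    \<comment> \<open>At the kinks the derivatives need not converge to \<open>dhat\<close>.\<close>
    have "AE y in lebesgue. y \<noteq> a \<and> y \<noteq> b \<and> y \<noteq> c"
      using AE_completion[OF AE_lborel_singleton[of a]] AE_completion[OF AE_lborel_singleton[of b]]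
        AE_completion[OF AE_lborel_singleton[of c]] by eventually_elim simp
    then have "AE y in lebesgue. y \<in> ?U \<longrightarrow> (y \<noteq> a \<and> y \<noteq> b \<and> y \<noteq> c)"
      by eventually_elim blast
    moreover have "?U \<inter> space lebesgue \<in> sets lebesgue" by simp
    ultimately have "AE y in lebesgue_on ?U. y \<noteq> a \<and> y \<noteq> b \<and> y \<noteq> c"
      using AE_restrict_space_iff by blast
    then show "AE y in lebesgue_on ?U. (\<lambda>k. ?D k y) \<longlonglongrightarrow> 0"
    proof eventually_elim
      case (elim y)
      have "(\<lambda>k. \<psi>' k y) \<longlonglongrightarrow> dhat N i y"
        unfolding \<psi>'_def dhat using elim
        by (intro tendsto_intros sstep_scaled_tendsto_heav d d0) auto
      moreover have "(\<lambda>k. \<psi> k y) \<longlonglongrightarrow> hat N i y"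
      proof (rule Lim_transform2[OF tendsto_const])
        show "(\<lambda>k. hat N i y - \<psi> k y) \<longlonglongrightarrow> 0"
        proof (rule Lim_null_comparison)
          show "\<forall>\<^sub>F k in sequentially. norm (hat N i y - \<psi> k y) \<le> n * (8 * d k)"
            using \<psi>_le by (simp add: abs_minus_commute)
          show "(\<lambda>k. n * (8 * d k)) \<longlonglongrightarrow> 0"
            by (intro tendsto_mult_right_zero d0)
        qed
      qed
      ultimately have "(\<lambda>k. (\<psi> k y - hat N i y)\<^sup>2 + (\<psi>' k y - dhat N i y)\<^sup>2) \<longlonglongrightarrow> (hat N i y - hat N i y)\<^sup>2 + (dhat N i y - dhat N i y)\<^sup>2"
        by (intro tendsto_intros)
      then show ?case
        by (simp add: norm_Pair cg)
    qed
  qed simp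
  then have lim: "(\<lambda>k. sqdist (lebesgue_on ?U) (jet (\<psi> k)) (\<lambda>y. (hat N i y, dhat N i y))) \<longlonglongrightarrow> 0"
    by (simp add: sqdist_def)
  show ?thesis
    unfolding H10g_def
  proof (intro conjI allI impI sq)
    fix e :: real assume "e > 0"
    then obtain k where "sqdist (lebesgue_on ?U) (jet (\<psi> k)) (\<lambda>y. (hat N i y, dhat N i y)) < e"
      using order_tendstoD(2)[OF lim] unfolding eventually_sequentially by blast
    then show "\<exists>\<phi>. test_fun ?U \<phi> \<and> sqdist (lebesgue_on ?U) (jet \<phi>) (\<lambda>y. (hat N i y, dhat N i y)) < e"
      using test by blast
  qed
qed

section \<open>Mesh cells and interpolation in y\<close>

definition cell :: "nat \<Rightarrow> real \<Rightarrow> nat" where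
  "cell N y = nat \<lfloor>y * real (N + 1)\<rfloor>"

definition frc :: "nat \<Rightarrow> real \<Rightarrow> real" where
  "frc N y = y * real (N + 1) - real (cell N y)"

text \<open>Values in any real vector space are allowed, so that nodal functions, nodal gradients
  and nodal integrands such as flux times gradient are all interpolated by the same
  operator.\<close>

definition itp :: "nat \<Rightarrow> (nat \<Rightarrow> 'a \<Rightarrow> 'b::real_vector) \<Rightarrow> 'a \<times> real \<Rightarrow> 'b" where
  "itp N g z = (1 - frc N (snd z)) *\<^sub>R g (cell N (snd z)) (fst z) + frc N (snd z) *\<^sub>R g (cell N (snd z) + 1) (fst z)"

text \<open>On each cell the entry with the index of its left node is taken; applied to the forward
  quotients \<open>dq\<close> it is the y-derivative of \<open>itp\<close>.\<close>

definition cst :: "nat \<Rightarrow> (nat \<Rightarrow> 'a \<Rightarrow> 'b) \<Rightarrow> 'a \<times> real \<Rightarrow> 'b" where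
  "cst N g z = g (cell N (snd z)) (fst z)"

definition dq :: "nat \<Rightarrow> (nat \<Rightarrow> 'a \<Rightarrow> real) \<Rightarrow> nat \<Rightarrow> 'a \<Rightarrow> real" where
  "dq N w j x = real (N + 1) * (w (j + 1) x - w j x)"

lemma cell_frc:
  assumes "0 < y" "y < 1"
  shows "cell N y \<le> N" "0 \<le> frc N y" "frc N y < 1" "y * real (N + 1) = real (cell N y) + frc N y"
proof -
  have p: "0 \<le> y * real (N + 1)" "y * real (N + 1) < real (N + 1)"
    using assms mult_strict_right_mono[OF assms(2), of "real (N + 1)"] by auto
  then show 1: "0 \<le> frc N y" "frc N y < 1" "y * real (N + 1) = real (cell N y) + frc N y"
    unfolding frc_def cell_def by linarith+
  have "real (cell N y) < real (N + 1)"
    using 1 p by linarith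
  then show "cell N y \<le> N"
    by linarith
qed

lemma interp_eq_itp: "interp N w z = itp N w z"
proof -
  define j where "j = cell N (snd z)"
  have eq: "nat \<lfloor>snd z / (1 / real (N + 1))\<rfloor> = j"
    by (simp add: j_def cell_def)
  have gen: "v / (1 / n) * (y - real j * (1 / n)) = v * (y * n - real j)" if "n > 0" for v n y :: real
    using that by (simp add: field_simps)
  have "real (N + 1) > 0" by simp
  note gen = gen[OF this]
  have "interp N w z = w j (fst z) + (w (j + 1) (fst z) - w j (fst z)) * (snd z * real (N + 1) - real j)"
    unfolding interp_def Let_def eq gen by simp
  then show ?thesis
    by (simp add: itp_def frc_def flip: j_def) (simp add: algebra_simps)
qed

text \<open>In the variable t = y (N+1) the three ramps have integer kinks, so only the position of
  i relative to the cell of y matters.\<close>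

lemma hat_eq:
  assumes "0 < y" "y < 1"
  shows "hat N i y = (if i = cell N y then 1 - frc N y else if i = cell N y + 1 then frc N y else 0)"
proof -
  define n where "n = real (N + 1)"
  have n: "n > 0" by (simp add: n_def)
  define j where "j = cell N y"
  define t where "t = real j + frc N y"
  note c = cell_frc[OF assms, of N, folded j_def n_def]
  have t: "y * n = t" using c by (simp add: t_def)
  have m: "n * max (y - q / n) 0 = max (t - q) 0" for q
    using n t[symmetric] by (simp add: max_def field_simps)
  have "hat N i y = n * max (y - (real i - 1) / n) 0 - 2 * (n * max (y - real i / n) 0) + n * max (y - (real i + 1) / n) 0"
    unfolding hat_def n_def by (simp add: algebra_simps)
  also have "\<dots> = max (t - (real i - 1)) 0 - 2 * max (t - real i) 0 + max (t - (real i + 1)) 0"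
    unfolding m ..
  also have "\<dots> = (if i = j then 1 - frc N y else if i = j + 1 then frc N y else 0)"
  proof -
    consider "i = j" | "i = j + 1" | "i + 1 \<le> j" | "j + 2 \<le> i" by linarith
    then show ?thesis
    proof cases
      case 3
      then have "real i + 1 \<le> real j" by linarith
      with 3 show ?thesis using c(2,3) by (simp add: t_def max_def)
    next
      case 4
      then have "real j + 2 \<le> real i" by linarith
      with 4 show ?thesis using c(2,3) by (simp add: t_def max_def)
    qed (use c(2,3) in \<open>auto simp: t_def max_def\<close>)
  qed
  finally show ?thesis by (simp add: j_def)
qed

lemma heav_diff_eq:
  assumes "0 < y" "y < 1"
  shows "heav (y - real i / real (N + 1)) = (if i \<le> cell N y then 1 else 0)"
proof -
  note c = cell_frc[OF assms, of N]
  have "0 \<le> y - real i / real (N + 1) \<longleftrightarrow> real i \<le> y * real (N + 1)"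
    by (simp add: field_simps)
  also have "\<dots> \<longleftrightarrow> i \<le> cell N y"
    using c(2-4) by linarith
  finally show ?thesis by (simp add: heav_def)
qed

lemma dhat_eq:
  assumes "0 < y" "y < 1" "1 \<le> i"
  shows "dhat N i y = (if i = cell N y then - real (N + 1) else if i = cell N y + 1 then real (N + 1) else 0)"
proof -
  \<comment> \<open>Subtraction on natural numbers agrees only for i at least 1; then all three
    kinks are nodes to which \<open>heav_diff_eq\<close> applies.\<close>
  have i: "real i - 1 = real (i - 1)" "real i + 1 = real (i + 1)"
    using assms(3) by (simp_all add: of_nat_diff)
  show ?thesis
    unfolding dhat_def i heav_diff_eq[OF assms(1,2)] using assms(3) by auto
qed

text \<open>On the first and the last cell, interpolation refers to a boundary node, but the sum
  runs over interior nodes only. The vanishing end values make up for the missing hats.\<close>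

lemma sum_two_terms:
  fixes g :: "nat \<Rightarrow> 'b::real_vector"
  assumes "j \<le> N" "g 0 = 0" "g (N + 1) = 0"
  shows "(\<Sum>i=1..N. (if i = j then p else if i = j + 1 then q else 0) *\<^sub>R g i) = p *\<^sub>R g j + q *\<^sub>R g (j + 1)"
proof -
  have "(\<Sum>i=1..N. (if i = j then p else if i = j + 1 then q else 0) *\<^sub>R g i)
      = (\<Sum>i\<in>{0..N+1}. (if i = j then p else if i = j + 1 then q else 0) *\<^sub>R g i)"
  proof (rule sum.mono_neutral_left)
    show "\<forall>i\<in>{0..N + 1} - {1..N}. (if i = j then p else if i = j + 1 then q else 0) *\<^sub>R g i = 0"
    proof
      fix i assume "i \<in> {0..N + 1} - {1..N}"
      then have "i = 0 \<or> i = N + 1" by auto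
      then show "(if i = j then p else if i = j + 1 then q else 0) *\<^sub>R g i = 0"
        using assms by auto
    qed
  qed auto
  also have "\<dots> = (\<Sum>i\<in>{j, j + 1}. (if i = j then p else if i = j + 1 then q else 0) *\<^sub>R g i)"
    using assms(1) by (intro sum.mono_neutral_right) auto
  finally show ?thesis by simp
qed

lemma itp_eq_sum:
  assumes "z \<in> Omega \<Omega>" "g 0 (fst z) = 0" "g (N + 1) (fst z) = 0"
  shows "itp N g z = (\<Sum>i=1..N. hat N i (snd z) *\<^sub>R g i (fst z))"
proof -
  have y: "0 < snd z" "snd z < 1" using assms(1) by (auto simp: Omega_def)
  show ?thesis
    unfolding hat_eq[OF y] itp_def
    using sum_two_terms[of "cell N (snd z)" N "\<lambda>i. g i (fst z)"] cell_frc(1)[OF y] assms(2,3) by simp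
qed

lemma cst_dq_eq_sum:
  assumes "z \<in> Omega \<Omega>" "w 0 (fst z) = 0" "w (N + 1) (fst z) = 0"
  shows "cst N (dq N w) z = (\<Sum>i=1..N. w i (fst z) * dhat N i (snd z))"
proof -
  have y: "0 < snd z" "snd z < 1" using assms(1) by (auto simp: Omega_def)
  have "(\<Sum>i=1..N. w i (fst z) * dhat N i (snd z)) = (\<Sum>i=1..N. (if i = cell N (snd z) then - real (N + 1) else if i = cell N (snd z) + 1 then real (N + 1) else 0) *\<^sub>R w i (fst z))"
    by (rule sum.cong) (simp_all add: dhat_eq[OF y])
  also have "\<dots> = cst N (dq N w) z"
    using sum_two_terms[of "cell N (snd z)" N "\<lambda>i. w i (fst z)"] cell_frc(1)[OF y] assms(2,3)
    by (simp add: cst_def dq_def algebra_simps)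
  finally show ?thesis ..
qed

lemma open_Omega: "open \<Omega> \<Longrightarrow> open (Omega \<Omega>)"
  by (simp add: Omega_def open_Times)

text \<open>Because the end values vanish, the interpolation is the sum of the tensor products of
  the nodal functions with the interior hats. Its x-gradient interpolates the nodal gradients, and
  its y-derivative is constant on each cell.\<close>

lemma H10g_itp:
  assumes \<Omega>: "open \<Omega>" and w: "\<And>i. 1 \<le> i \<Longrightarrow> i \<le> N \<Longrightarrow> H10g \<Omega> (w i) (G i)"
    and z: "\<And>x. x \<in> \<Omega> \<Longrightarrow> w 0 x = 0 \<and> w (N + 1) x = 0 \<and> G 0 x = 0 \<and> G (N + 1) x = 0"
  shows "H10g (Omega \<Omega>) (itp N w) (\<lambda>z. (itp N G z, cst N (dq N w) z))"
proof -
  have U: "Omega \<Omega> \<in> sets lebesgue" using open_Omega[OF \<Omega>] by simp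
  have "H10g (\<Omega> \<times> {0<..<1}) (\<lambda>z. w i (fst z) * hat N i (snd z))
      (\<lambda>z. (hat N i (snd z) *\<^sub>R G i (fst z), w i (fst z) *\<^sub>R dhat N i (snd z)))" if "i \<in> {1..N}" for i
    by (rule H10g_tensor[OF \<Omega> _ w H10g_hat]) (use that in auto)
  then have s: "H10g (Omega \<Omega>) (\<lambda>z. \<Sum>i=1..N. w i (fst z) * hat N i (snd z))
      (\<lambda>z. \<Sum>i=1..N. (hat N i (snd z) *\<^sub>R G i (fst z), w i (fst z) *\<^sub>R dhat N i (snd z)))"
    by (intro H10g_sum U) (auto simp: Omega_def)
  show ?thesis
  proof (rule H10g_cong[OF U s])
    fix z assume z': "z \<in> Omega \<Omega>"
    then have "fst z \<in> \<Omega>" by (auto simp: Omega_def)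
    note z'' = z[OF this]
    show "itp N w z = (\<Sum>i=1..N. w i (fst z) * hat N i (snd z))"
      using itp_eq_sum[OF z', of w N] z'' by (simp add: mult.commute)
    show "(itp N G z, cst N (dq N w) z) = (\<Sum>i=1..N. (hat N i (snd z) *\<^sub>R G i (fst z), w i (fst z) *\<^sub>R dhat N i (snd z)))"
      using itp_eq_sum[OF z', of G N] cst_dq_eq_sum[OF z', of w N] z''
      by (simp add: prod_eq_iff fst_sum snd_sum)
  qed
qed

section \<open>Integrals in y of hats and cell indicators\<close>

lemma integral_Ioo:
  fixes f :: "real \<Rightarrow> real"
  assumes "(f has_integral I) {0..1}" "f \<in> borel_measurable borel" "\<And>y. 0 < y \<Longrightarrow> y < 1 \<Longrightarrow> \<bar>f y\<bar> \<le> B"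
  shows "integrable (lebesgue_on {0<..<1}) f" "integral\<^sup>L (lebesgue_on {0<..<1}) f = I"
proof -
  have fm: "finite_measure (lebesgue_on {0<..<1::real})"
    by (intro finite_measure_lebesgue_on) auto
  show i: "integrable (lebesgue_on {0<..<1}) f"
    by (rule finite_measure.integrable_const_bound[OF fm _ borel_measurable_lebesgue_on[OF assms(2)], where B = B])
      (auto intro!: AE_I2 assms(3) simp: space_restrict_space)
  show "integral\<^sup>L (lebesgue_on {0<..<1}) f = I"
    using lebesgue_integral_eq_integral[OF i] assms(1) by (simp add: has_integral_Icc_iff_Ioo integral_unique)
qed

lemma has_integral_max:
  assumes "0 \<le> c" "c \<le> 1"
  shows "((\<lambda>y. max (y - c) 0) has_integral ((1 - c)\<^sup>2 / 2)) {0..1::real}"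
proof -
  have "((\<lambda>y. max (y - c) 0) has_integral ((max (1 - c) 0)\<^sup>2 / 2 - (max (0 - c) 0)\<^sup>2 / 2)) {0..1::real}"
  proof (rule fundamental_theorem_of_calculus_strong[of "{c}"])
    fix y assume y: "y \<in> {0..1} - {c}"
    have "((\<lambda>y. (max (y - c) 0)\<^sup>2 / 2) has_real_derivative max (y - c) 0) (at y)"
    proof (cases "y > c")
      case True
      have "((\<lambda>y. (y - c)\<^sup>2 / 2) has_real_derivative max (y - c) 0) (at y)"
        using True by (auto intro!: derivative_eq_intros)
      then show ?thesis
        by (rule has_field_derivative_transform_within_open[where S = "{c<..}"]) (use True in auto)
    next
      case False
      have "((\<lambda>y. 0) has_real_derivative max (y - c) 0) (at y)"
        using False by auto
      then show ?thesis
        by (rule has_field_derivative_transform_within_open[where S = "{..<c}"]) (use False y in auto)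
    qed
    then show "((\<lambda>y. (max (y - c) 0)\<^sup>2 / 2) has_vector_derivative max (y - c) 0) (at y)"
      by (simp add: has_real_derivative_iff_has_vector_derivative)
  qed (auto intro!: continuous_intros)
  then show ?thesis
    using assms by simp
qed

lemma has_integral_heav:
  assumes "0 \<le> c" "c \<le> 1"
  shows "((\<lambda>y. heav (y - c)) has_integral (1 - c)) {0..1::real}"
proof -
  have "((\<lambda>y. heav (y - c)) has_integral (max (1 - c) 0 - max (0 - c) 0)) {0..1::real}"
  proof (rule fundamental_theorem_of_calculus_strong[of "{c}"])
    fix y assume y: "y \<in> {0..1} - {c}"
    have "((\<lambda>y. max (y - c) 0) has_real_derivative heav (y - c)) (at y)"
    proof (cases "y > c")
      case True
      have "((\<lambda>y. y - c) has_real_derivative heav (y - c)) (at y)"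
        using True by (auto intro!: derivative_eq_intros simp: heav_def)
      then show ?thesis
        by (rule has_field_derivative_transform_within_open[where S = "{c<..}"]) (use True in auto)
    next
      case False
      have "((\<lambda>y. 0) has_real_derivative heav (y - c)) (at y)"
        using False y by (auto simp: heav_def)
      then show ?thesis
        by (rule has_field_derivative_transform_within_open[where S = "{..<c}"]) (use False y in auto)
    qed
    then show "((\<lambda>y. max (y - c) 0) has_vector_derivative heav (y - c)) (at y)"
      by (simp add: has_real_derivative_iff_has_vector_derivative)
  qed (auto intro!: continuous_intros)
  then show ?thesis
    using assms by simp
qed

lemma integral_hat:
  assumes i: "1 \<le> i" "i \<le> N"
  shows "integrable (lebesgue_on {0<..<1}) (hat N i)"
    and "integral\<^sup>L (lebesgue_on {0<..<1}) (hat N i) = 1 / real (N + 1)"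
proof -
  define n where "n = real (N + 1)"
  have n: "n > 0" by (simp add: n_def)
  have r: "0 \<le> (real i - 1) / n" "(real i - 1) / n \<le> 1" "0 \<le> real i / n" "real i / n \<le> 1"
    "0 \<le> (real i + 1) / n" "(real i + 1) / n \<le> 1"
    using i by (simp_all add: n_def)
  have "(hat N i has_integral n * ((1 - (real i - 1) / n)\<^sup>2 / 2 - 2 * ((1 - real i / n)\<^sup>2 / 2) + (1 - (real i + 1) / n)\<^sup>2 / 2)) {0..1}"
    unfolding hat_def[abs_def] n_def[symmetric]
    by (intro has_integral_mult_right has_integral_add has_integral_diff has_integral_max r)
  also have "n * ((1 - (real i - 1) / n)\<^sup>2 / 2 - 2 * ((1 - real i / n)\<^sup>2 / 2) + (1 - (real i + 1) / n)\<^sup>2 / 2) = 1 / n"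
  proof -
    \<comment> \<open>The second difference with step q of (1 - c)^2 / 2 as a function of c is
      exactly q^2.\<close>
    define p q where "p = real i / n" and "q = 1 / n"
    have "(real i - 1) / n = p - q" "(real i + 1) / n = p + q"
      by (simp_all add: p_def q_def diff_divide_distrib add_divide_distrib)
    moreover have "(1 - (p - q))\<^sup>2 / 2 - 2 * ((1 - p)\<^sup>2 / 2) + (1 - (p + q))\<^sup>2 / 2 = q * q"
      by (simp add: power2_eq_square algebra_simps) (simp add: field_simps)
    moreover have "n * (q * q) = 1 / n"
      using n by (simp add: q_def)
    ultimately show ?thesis
      by (simp add: p_def)
  qed
  finally have hi: "(hat N i has_integral (1 / n)) {0..1}" .
  have bd: "\<bar>hat N i y\<bar> \<le> 1" if "0 < y" "y < 1" for y
    using cell_frc[OF that, of N] by (simp add: hat_eq[OF that])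
  have m: "hat N i \<in> borel_measurable borel"
    unfolding hat_def[abs_def] by measurable
  show "integrable (lebesgue_on {0<..<1}) (hat N i)"
    "integral\<^sup>L (lebesgue_on {0<..<1}) (hat N i) = 1 / real (N + 1)"
    by (rule integral_Ioo[OF hi m bd, unfolded n_def]; assumption)+
qed

text \<open>Restricted to the unit interval, the indicator of the half-open cell j; the form with
  \<open>heav\<close> gives its integral at once.\<close>

definition cind :: "nat \<Rightarrow> nat \<Rightarrow> real \<Rightarrow> real" where
  "cind N j y = heav (y - real j / real (N + 1)) - heav (y - real (j + 1) / real (N + 1))"

lemma cind_eq: "0 < y \<Longrightarrow> y < 1 \<Longrightarrow> cind N j y = (if j = cell N y then 1 else 0)"
  unfolding cind_def heav_diff_eq by auto

lemma integral_cind: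
  assumes j: "j \<le> N"
  shows "integrable (lebesgue_on {0<..<1}) (cind N j)"
    and "integral\<^sup>L (lebesgue_on {0<..<1}) (cind N j) = 1 / real (N + 1)"
proof -
  have r: "0 \<le> real j / real (N + 1)" "real j / real (N + 1) \<le> 1"
    "0 \<le> real (j + 1) / real (N + 1)" "real (j + 1) / real (N + 1) \<le> 1"
    using j by simp_all
  have "(cind N j has_integral ((1 - real j / real (N + 1)) - (1 - real (j + 1) / real (N + 1)))) {0..1}"
    unfolding cind_def[abs_def] by (intro has_integral_diff has_integral_heav r)
  also have "(1 - real j / real (N + 1)) - (1 - real (j + 1) / real (N + 1)) = 1 / real (N + 1)"
    by (simp add: add_divide_distrib)
  finally have hi: "(cind N j has_integral (1 / real (N + 1))) {0..1}" .
  have bd: "\<bar>cind N j y\<bar> \<le> 1" if "0 < y" "y < 1" for y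
    by (simp add: cind_eq[OF that])
  have m: "cind N j \<in> borel_measurable borel"
    unfolding cind_def[abs_def] by measurable
  show "integrable (lebesgue_on {0<..<1}) (cind N j)"
    "integral\<^sup>L (lebesgue_on {0<..<1}) (cind N j) = 1 / real (N + 1)"
    by (rule integral_Ioo[OF hi m bd]; assumption)+
qed

text \<open>Every interior hat has integral h. This identity and \<open>integral_cst\<close> convert
  the sums over nodes in the discrete equation into integrals over the cylinder, where they can be
  compared pointwise with the continuous equation.\<close>

lemma integral_itp:
  fixes g :: "nat \<Rightarrow> 'a::euclidean_space \<Rightarrow> real"
  assumes \<Omega>: "open \<Omega>" and g: "\<And>i. 1 \<le> i \<Longrightarrow> i \<le> N \<Longrightarrow> integrable (lebesgue_on \<Omega>) (g i)"
    and z: "\<And>x. x \<in> \<Omega> \<Longrightarrow> g 0 x = 0 \<and> g (N + 1) x = 0"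
  shows "integrable (lebesgue_on (Omega \<Omega>)) (itp N g)"
    and "integral\<^sup>L (lebesgue_on (Omega \<Omega>)) (itp N g) = (\<Sum>i=1..N. integral\<^sup>L (lebesgue_on \<Omega>) (g i)) / real (N + 1)"
proof -
  have t: "integrable (lebesgue_on (Omega \<Omega>)) (\<lambda>z. g i (fst z) * hat N i (snd z))"
    "(LINT z|lebesgue_on (Omega \<Omega>). g i (fst z) * hat N i (snd z)) = integral\<^sup>L (lebesgue_on \<Omega>) (g i) * (1 / real (N + 1))"
    if "i \<in> {1..N}" for i
  proof -
    have i: "1 \<le> i" "i \<le> N" using that by auto
    note t = integral_tensor[OF \<Omega> open_greaterThanLessThan g[OF i] integral_hat(1)[OF i], folded Omega_def]
    show "integrable (lebesgue_on (Omega \<Omega>)) (\<lambda>z. g i (fst z) * hat N i (snd z))"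
      by (rule t(1))
    show "(LINT z|lebesgue_on (Omega \<Omega>). g i (fst z) * hat N i (snd z)) = integral\<^sup>L (lebesgue_on \<Omega>) (g i) * (1 / real (N + 1))"
      using t(2) integral_hat(2)[OF i] by simp
  qed
  have e: "itp N g z = (\<Sum>i=1..N. g i (fst z) * hat N i (snd z))" if "z \<in> space (lebesgue_on (Omega \<Omega>))" for z
  proof -
    have z': "z \<in> Omega \<Omega>" "fst z \<in> \<Omega>"
      using that by (auto simp: space_restrict_space Omega_def)
    show ?thesis
      using itp_eq_sum[OF z'(1), of g N] z[OF z'(2)] by (simp add: mult.commute)
  qed
  show "integrable (lebesgue_on (Omega \<Omega>)) (itp N g)"
    by (subst Bochner_Integration.integrable_cong[OF refl e]) (auto intro!: Bochner_Integration.integrable_sum t)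
  have "integral\<^sup>L (lebesgue_on (Omega \<Omega>)) (itp N g) = (LINT z|lebesgue_on (Omega \<Omega>). (\<Sum>i=1..N. g i (fst z) * hat N i (snd z)))"
    by (rule Bochner_Integration.integral_cong[OF refl e])
  also have "\<dots> = (\<Sum>i=1..N. integral\<^sup>L (lebesgue_on \<Omega>) (g i) * (1 / real (N + 1)))"
    using t by (subst Bochner_Integration.integral_sum) auto
  finally show "integral\<^sup>L (lebesgue_on (Omega \<Omega>)) (itp N g) = (\<Sum>i=1..N. integral\<^sup>L (lebesgue_on \<Omega>) (g i)) / real (N + 1)"
    by (simp add: sum_divide_distrib)
qed

text \<open>Here the sum runs over all N + 1 cells, and no end conditions are required, since every
  cell indicator has integral h.\<close>

lemma integral_cst:
  fixes g :: "nat \<Rightarrow> 'a::euclidean_space \<Rightarrow> real"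
  assumes \<Omega>: "open \<Omega>" and g: "\<And>i. i \<le> N \<Longrightarrow> integrable (lebesgue_on \<Omega>) (g i)"
  shows "integrable (lebesgue_on (Omega \<Omega>)) (cst N g)"
    and "integral\<^sup>L (lebesgue_on (Omega \<Omega>)) (cst N g) = (\<Sum>i=0..N. integral\<^sup>L (lebesgue_on \<Omega>) (g i)) / real (N + 1)"
proof -
  have t: "integrable (lebesgue_on (Omega \<Omega>)) (\<lambda>z. g i (fst z) * cind N i (snd z))"
    "(LINT z|lebesgue_on (Omega \<Omega>). g i (fst z) * cind N i (snd z)) = integral\<^sup>L (lebesgue_on \<Omega>) (g i) * (1 / real (N + 1))"
    if "i \<in> {0..N}" for i
  proof -
    have i: "i \<le> N" using that by auto
    note t = integral_tensor[OF \<Omega> open_greaterThanLessThan g[OF i] integral_cind(1)[OF i], folded Omega_def]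
    show "integrable (lebesgue_on (Omega \<Omega>)) (\<lambda>z. g i (fst z) * cind N i (snd z))"
      by (rule t(1))
    show "(LINT z|lebesgue_on (Omega \<Omega>). g i (fst z) * cind N i (snd z)) = integral\<^sup>L (lebesgue_on \<Omega>) (g i) * (1 / real (N + 1))"
      using t(2) integral_cind(2)[OF i] by simp
  qed
  have e: "cst N g z = (\<Sum>i=0..N. g i (fst z) * cind N i (snd z))" if "z \<in> space (lebesgue_on (Omega \<Omega>))" for z
  proof -
    have y: "0 < snd z" "snd z < 1"
      using that by (auto simp: space_restrict_space Omega_def)
    show ?thesis
      using cell_frc(1)[OF y, of N] by (simp add: cind_eq[OF y] cst_def if_distrib[of "(*) _"] cong: if_cong)
  qed
  show "integrable (lebesgue_on (Omega \<Omega>)) (cst N g)"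
    by (subst Bochner_Integration.integrable_cong[OF refl e]) (auto intro!: Bochner_Integration.integrable_sum t)
  have "integral\<^sup>L (lebesgue_on (Omega \<Omega>)) (cst N g) = (LINT z|lebesgue_on (Omega \<Omega>). (\<Sum>i=0..N. g i (fst z) * cind N i (snd z)))"
    by (rule Bochner_Integration.integral_cong[OF refl e])
  also have "\<dots> = (\<Sum>i=0..N. integral\<^sup>L (lebesgue_on \<Omega>) (g i) * (1 / real (N + 1)))"
    using t by (subst Bochner_Integration.integral_sum) auto
  finally show "integral\<^sup>L (lebesgue_on (Omega \<Omega>)) (cst N g) = (\<Sum>i=0..N. integral\<^sup>L (lebesgue_on \<Omega>) (g i)) / real (N + 1)"
    by (simp add: sum_divide_distrib)
qed

section \<open>The nonlinear flux\<close>

lemma square_convex: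
  fixes s t l :: real
  assumes "0 \<le> l" "l \<le> 1"
  shows "((1 - l) * s + l * t)\<^sup>2 \<le> (1 - l) * s\<^sup>2 + l * t\<^sup>2"
proof -
  have "(1 - l) * s\<^sup>2 + l * t\<^sup>2 - ((1 - l) * s + l * t)\<^sup>2 = l * (1 - l) * (s - t)\<^sup>2"
    by (simp add: power2_eq_square algebra_simps)
  also have "\<dots> \<ge> 0"
    using assms by simp
  finally show ?thesis by simp
qed

lemma norm_convex:
  assumes "0 \<le> l" "l \<le> 1"
  shows "norm ((1 - l) *\<^sub>R a + l *\<^sub>R b) \<le> (1 - l) * norm a + l * norm b"
  using norm_triangle_ineq[of "(1 - l) *\<^sub>R a" "l *\<^sub>R b"] assms by simp

lemma norm_power2_convex:
  assumes "0 \<le> l" "l \<le> 1"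
  shows "(norm ((1 - l) *\<^sub>R a + l *\<^sub>R b))\<^sup>2 \<le> (1 - l) * (norm a)\<^sup>2 + l * (norm b)\<^sup>2"
  using power_mono[OF norm_convex[OF assms, of a b] norm_ge_zero, of 2] square_convex[OF assms, of "norm a" "norm b"]
  by linarith

text \<open>Freezes both nodal coefficients P and Q at a common value c. It serves the fluxes of the
  comparison function as well as, with real numbers for vectors, the source term.\<close>

lemma inner_convex_perturb:
  assumes l: "0 \<le> l" "l \<le> 1" and e: "norm (P - c) \<le> e" "norm (Q - c) \<le> e"
  shows "\<bar>(1 - l) * (P \<bullet> a) + l * (Q \<bullet> b) - c \<bullet> ((1 - l) *\<^sub>R a + l *\<^sub>R b)\<bar> \<le> e * ((1 - l) * norm a + l * norm b)"
proof -
  have "\<bar>(P - c) \<bullet> a\<bar> \<le> e * norm a" "\<bar>(Q - c) \<bullet> b\<bar> \<le> e * norm b"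
    using order_trans[OF Cauchy_Schwarz_ineq2 mult_right_mono[OF _ norm_ge_zero]] e by blast+
  then have "(1 - l) * \<bar>(P - c) \<bullet> a\<bar> + l * \<bar>(Q - c) \<bullet> b\<bar> \<le> (1 - l) * (e * norm a) + l * (e * norm b)"
    using l by (intro add_mono mult_left_mono) auto
  moreover have "\<bar>(1 - l) * ((P - c) \<bullet> a) + l * ((Q - c) \<bullet> b)\<bar> \<le> (1 - l) * \<bar>(P - c) \<bullet> a\<bar> + l * \<bar>(Q - c) \<bullet> b\<bar>"
    using l abs_triangle_ineq[of "(1 - l) * ((P - c) \<bullet> a)" "l * ((Q - c) \<bullet> b)"] by (simp add: abs_mult)
  ultimately show ?thesis
    by (simp add: inner_simps algebra_simps)
qed

text \<open>Expansion of a square. The weight m / 4 leaves room for three uses: after the Poincare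
  inequality the absorbed terms amount to at most half of the coercive ones.\<close>

lemma young:
  fixes a b m :: real
  assumes "m > 0"
  shows "a * b \<le> m / 4 * b\<^sup>2 + a\<^sup>2 / m"
proof -
  have "0 \<le> (m / 2 * b - a)\<^sup>2 / m"
    using assms by simp
  also have "\<dots> = m / 4 * b\<^sup>2 + a\<^sup>2 / m - a * b"
    using assms by (simp add: power2_eq_square field_simps)
  finally show ?thesis by simp
qed

section \<open>Monotonicity, Lipschitz bound and the pointwise estimate\<close>

definition flux :: "(real \<Rightarrow> real) \<Rightarrow> 'a::euclidean_space \<Rightarrow> 'a" where
  "flux \<beta> p = acoef \<beta> (norm p) *\<^sub>R p"

text \<open>The derivative bounds are stated in integrated form on the closed half-line, which
  includes the endpoint 0.\<close>

locale nonlinearity =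
  fixes \<beta> :: "real \<Rightarrow> real" and \<epsilon> :: real
  assumes eps_pos: "\<epsilon> > 0"
    and beta_0: "\<beta> 0 = 0"
    and beta_lower: "0 \<le> s \<Longrightarrow> s \<le> t \<Longrightarrow> \<epsilon> * (t - s) \<le> \<beta> t - \<beta> s"
    and beta_upper: "0 \<le> s \<Longrightarrow> s \<le> t \<Longrightarrow> \<beta> t - \<beta> s \<le> (t - s) / \<epsilon>"
begin

lemma flux_0: "flux \<beta> 0 = 0"
  by (simp add: flux_def)

text \<open>Subtracting \<epsilon> t from \<beta> leaves a nondecreasing function, whose radial
  coefficients at \<open>p\<close> and \<open>q\<close> are a and c. By Cauchy-Schwarz for
  \<open>p\<close> and \<open>q\<close> the claim reduces to (a s - c t)(s - t) being nonnegative
  for the norms s and t. Zero vectors are treated apart because of the division by the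
  norms.\<close>

lemma flux_strongly_monotone: "\<epsilon> * (norm (p - q))\<^sup>2 \<le> (flux \<beta> p - flux \<beta> q) \<bullet> (p - q)"
proof -
  have zero: "\<epsilon> * (norm p)\<^sup>2 \<le> flux \<beta> p \<bullet> p" for p :: "'c::euclidean_space"
  proof -
    have "flux \<beta> p \<bullet> p = \<beta> (norm p) * norm p"
      by (simp add: flux_def acoef_def dot_square_norm power2_eq_square)
    moreover have "\<epsilon> * norm p * norm p \<le> \<beta> (norm p) * norm p"
      using beta_lower[of 0 "norm p"] beta_0 by (intro mult_right_mono) auto
    ultimately show ?thesis
      by (simp add: power2_eq_square mult.assoc)
  qed
  show ?thesis
  proof (cases "p = 0 \<or> q = 0")
    case True
    then show ?thesis
      using zero[of p] zero[of q] by (auto simp: flux_0)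
  next
    case False
    define s t P where "s = norm p" and "t = norm q" and "P = p \<bullet> q"
    have st: "s > 0" "t > 0" using False by (simp_all add: s_def t_def)
    have P: "P \<le> s * t" by (simp add: P_def s_def t_def norm_cauchy_schwarz)
    define a c where "a = \<beta> s / s - \<epsilon>" and "c = \<beta> t / t - \<epsilon>"
    have as: "a * s = \<beta> s - \<epsilon> * s" "c * t = \<beta> t - \<epsilon> * t"
      using st by (simp_all add: a_def c_def field_simps)
    have ac: "a \<ge> 0" "c \<ge> 0"
      using beta_lower[of 0 s] beta_lower[of 0 t] beta_0 st by (simp_all add: a_def c_def field_simps)
    have "0 \<le> (a * s - c * t) * (s - t)"
    proof (cases "s \<le> t")
      case True
      then have "a * s - c * t \<le> 0"
        using beta_lower[of s t] st by (simp add: as algebra_simps)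
      with True show ?thesis by (simp add: mult_nonpos_nonpos)
    next
      case False
      then have "a * s - c * t \<ge> 0"
        using beta_lower[of t s] st by (simp add: as algebra_simps)
      with False show ?thesis by simp
    qed
    also have "\<dots> = a * s\<^sup>2 + c * t\<^sup>2 - (a + c) * (s * t)"
      by (simp add: power2_eq_square algebra_simps)
    also have "\<dots> \<le> a * s\<^sup>2 + c * t\<^sup>2 - (a + c) * P"
      using P ac by (simp add: mult_left_mono)
    also have "\<dots> = (flux \<beta> p - flux \<beta> q) \<bullet> (p - q) - \<epsilon> * (norm (p - q))\<^sup>2"
    proof -
      have n1: "(norm (p - q))\<^sup>2 = s\<^sup>2 - 2 * P + t\<^sup>2"
        by (simp add: s_def t_def P_def power2_norm_eq_inner inner_diff inner_commute)
      have n2: "(flux \<beta> p - flux \<beta> q) \<bullet> (p - q) = (a + \<epsilon>) * s\<^sup>2 + (c + \<epsilon>) * t\<^sup>2 - (a + c + 2 * \<epsilon>) * P"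
        unfolding s_def t_def P_def a_def c_def flux_def acoef_def
        by (simp add: inner_diff inner_commute power2_norm_eq_inner algebra_simps)
      show ?thesis
        unfolding n1 n2 by (simp add: algebra_simps)
    qed
    finally show ?thesis by simp
  qed
qed

text \<open>With a the coefficient at \<open>p\<close>, the difference splits into a (p - q) and a q
  - flux q. The norm of the latter is |a (|q| - |p|) + \<beta>(|p|) - \<beta>(|q|)|. Each of the
  resulting three terms is at most |p - q| / \<epsilon>, which explains the 3.\<close>

lemma flux_lipschitz:
  fixes p q :: "'c::euclidean_space"
  shows "norm (flux \<beta> p - flux \<beta> q) \<le> 3 / \<epsilon> * norm (p - q)"
proof -
  have a_le: "\<bar>acoef \<beta> (norm p)\<bar> \<le> 1 / \<epsilon>" for p :: 'c
  proof (cases "p = 0")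
    case False
    have "0 \<le> \<beta> (norm p)" "\<beta> (norm p) \<le> norm p / \<epsilon>"
      using beta_lower[of 0 "norm p"] beta_upper[of 0 "norm p"] beta_0 eps_pos
      by (auto intro: order_trans[rotated])
    with False show ?thesis
      using eps_pos by (simp add: acoef_def abs_div field_simps)
  qed (use eps_pos in \<open>simp add: acoef_def\<close>)
  have b: "\<bar>\<beta> (norm p) - \<beta> (norm q)\<bar> \<le> 1 / \<epsilon> * norm (p - q)" for p q :: 'c
  proof -
    have ord: "\<bar>\<beta> t - \<beta> s\<bar> \<le> (t - s) / \<epsilon>" if "0 \<le> s" "s \<le> t" for s t
    proof -
      have "0 \<le> \<epsilon> * (t - s)"
        using eps_pos that by simp
      also have "\<dots> \<le> \<beta> t - \<beta> s"
        by (rule beta_lower[OF that])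
      finally show ?thesis
        using beta_upper[OF that] by simp
    qed
    have "\<bar>\<beta> s - \<beta> t\<bar> \<le> \<bar>s - t\<bar> / \<epsilon>" if "0 \<le> s" "0 \<le> t" for s t
      using ord[of s t] ord[of t s] that by (cases "s \<le> t") (simp_all add: abs_minus_commute)
    from this[of "norm p" "norm q"] have "\<bar>\<beta> (norm p) - \<beta> (norm q)\<bar> \<le> \<bar>norm p - norm q\<bar> / \<epsilon>"
      by simp
    also have "\<bar>norm p - norm q\<bar> / \<epsilon> \<le> norm (p - q) / \<epsilon>"
      using eps_pos norm_triangle_ineq3[of p q] by (intro divide_right_mono) auto
    finally show ?thesis by simp
  qed
  define a where "a = acoef \<beta> (norm p)"
  have "flux \<beta> p - flux \<beta> q = a *\<^sub>R (p - q) + (a *\<^sub>R q - flux \<beta> q)"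
    by (simp add: flux_def a_def algebra_simps)
  then have "norm (flux \<beta> p - flux \<beta> q) \<le> norm (a *\<^sub>R (p - q)) + norm (a *\<^sub>R q - flux \<beta> q)"
    by (metis norm_triangle_ineq)
  also have "norm (a *\<^sub>R (p - q)) \<le> 1 / \<epsilon> * norm (p - q)"
    unfolding a_def norm_scaleR by (rule mult_right_mono[OF a_le norm_ge_zero])
  also have "norm (a *\<^sub>R q - flux \<beta> q) \<le> 2 / \<epsilon> * norm (p - q)"
  proof -
    have ac: "acoef \<beta> (norm r) * norm r = \<beta> (norm r)" for r :: 'c
      using beta_0 by (simp add: acoef_def)
    have "norm (a *\<^sub>R q - flux \<beta> q) = \<bar>a * norm q - acoef \<beta> (norm q) * norm q\<bar>"
      by (simp add: flux_def abs_mult flip: scaleR_diff_left left_diff_distrib)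
    also have "acoef \<beta> (norm q) * norm q = \<beta> (norm q)"
      by (rule ac)
    also have "a * norm q - \<beta> (norm q) = a * (norm q - norm p) + (\<beta> (norm p) - \<beta> (norm q))"
      by (simp add: a_def right_diff_distrib ac)
    also have "\<bar>\<dots>\<bar> \<le> \<bar>a * (norm q - norm p)\<bar> + \<bar>\<beta> (norm p) - \<beta> (norm q)\<bar>"
      by (rule abs_triangle_ineq)
    also have "\<bar>a * (norm q - norm p)\<bar> \<le> 1 / \<epsilon> * norm (p - q)"
      unfolding abs_mult using a_le[of p] norm_triangle_ineq3[of q p]
      using eps_pos by (intro mult_mono) (auto simp: a_def norm_minus_commute)
    finally show ?thesis
      using b[of p q] by simp
  qed
  finally show ?thesis by simp
qed

lemma flux_measurable: "flux \<beta> \<in> borel_measurable borel"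
proof (intro borel_measurable_continuous_onI lipschitz_on_continuous_on)
  show "(3 / \<epsilon>)-lipschitz_on UNIV (flux \<beta>)"
    using flux_lipschitz eps_pos by (intro lipschitz_onI) (auto simp: dist_norm)
qed

lemma sqint_flux:
  assumes "sqint M g"
  shows "sqint M (\<lambda>x. flux \<beta> (g x))"
proof (rule sqint_boundI[where c = "3 / \<epsilon>", OF assms])
  show "(\<lambda>x. flux \<beta> (g x)) \<in> borel_measurable M"
    by (rule measurable_compose[OF sqint_measurable[OF assms] flux_measurable])
  show "AE x in M. norm (flux \<beta> (g x)) \<le> 3 / \<epsilon> * norm (g x)"
    using flux_lipschitz[of "g x" 0 for x] by (intro AE_I2) (simp add: flux_0)
qed

text \<open>One point of a cell at relative height l. The G are nodal gradients of the discrete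
  solution, the P those of the comparison function; p and g are the x-gradients of the comparison
  function and of \<open>u\<close> at the point itself, and Du, Dp, py, uy the analogues in y.
  Fluxes are passed from G to P by monotonicity, which yields the left side, from P to p at cost e
  and from p to g at cost |p - g|, both by the Lipschitz bound. The two large brackets are the
  integrands of the discrete and of the continuous equation.\<close>

lemma pointwise_estimate:
  fixes G0 G1 P0 P1 p g :: "'c::euclidean_space" and v0 v1 f0 f1 fz Du Dp py uy l e :: real
  assumes l: "0 \<le> l" "l \<le> 1" and e: "0 \<le> e"
    and P: "norm (P0 - p) \<le> e" "norm (P1 - p) \<le> e"
    and f: "\<bar>f0 - fz\<bar> \<le> e" "\<bar>f1 - fz\<bar> \<le> e" and D: "\<bar>Dp - py\<bar> \<le> e"
    and m: "0 < m" "m \<le> \<epsilon>" "m \<le> 1" and K: "K = (3 / \<epsilon>)\<^sup>2 + 1"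
  defines "V0 \<equiv> G0 - P0" and "V1 \<equiv> G1 - P1" and "Dv \<equiv> Du - Dp"
  defines "q0 \<equiv> (1 - l) * v0\<^sup>2 + l * v1\<^sup>2" and "q1 \<equiv> (1 - l) * (norm V0)\<^sup>2 + l * (norm V1)\<^sup>2"
  shows "m * (q1 + Dv\<^sup>2)
    \<le> ((1 - l) * (flux \<beta> G0 \<bullet> V0) + l * (flux \<beta> G1 \<bullet> V1) + Du * Dv - ((1 - l) * (f0 * v0) + l * (f1 * v1)))
      - (flux \<beta> g \<bullet> ((1 - l) *\<^sub>R V0 + l *\<^sub>R V1) + uy * Dv - fz * ((1 - l) * v0 + l * v1))
      + (m / 4 * (q1 + Dv\<^sup>2 + q0) + 3 * K / m * ((norm (p - g))\<^sup>2 + (py - uy)\<^sup>2 + e\<^sup>2))"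
proof -
  define A where "A = 3 / \<epsilon>"
  have A: "A > 0" using eps_pos by (simp add: A_def)
  define B where "B = (1 - l) * norm V0 + l * norm V1"
  have B0: "B \<ge> 0" using l by (simp add: B_def)
  have mono: "m * q1 \<le> ((1 - l) * (flux \<beta> G0 \<bullet> V0) + l * (flux \<beta> G1 \<bullet> V1)) - ((1 - l) * (flux \<beta> P0 \<bullet> V0) + l * (flux \<beta> P1 \<bullet> V1))"
  proof -
    have "m * (norm V0)\<^sup>2 \<le> (flux \<beta> G0 - flux \<beta> P0) \<bullet> V0" "m * (norm V1)\<^sup>2 \<le> (flux \<beta> G1 - flux \<beta> P1) \<bullet> V1"
      using flux_strongly_monotone[of G0 P0] flux_strongly_monotone[of G1 P1]
        mult_right_mono[OF m(2), of "(norm V0)\<^sup>2"] mult_right_mono[OF m(2), of "(norm V1)\<^sup>2"]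
      unfolding V0_def V1_def by simp_all
    then have "(1 - l) * (m * (norm V0)\<^sup>2) + l * (m * (norm V1)\<^sup>2)
        \<le> (1 - l) * ((flux \<beta> G0 - flux \<beta> P0) \<bullet> V0) + l * ((flux \<beta> G1 - flux \<beta> P1) \<bullet> V1)"
      using l by (intro add_mono mult_left_mono) auto
    then show ?thesis
      by (simp add: q1_def inner_diff_left algebra_simps)
  qed
  have "Du * Dv - Dp * Dv = Dv\<^sup>2"
    by (simp add: Dv_def power2_eq_square algebra_simps)
  then have D2: "m * Dv\<^sup>2 \<le> Du * Dv - Dp * Dv"
    using mult_right_mono[OF m(3), of "Dv\<^sup>2"] by simp
  have e1: "(1 - l) * (flux \<beta> P0 \<bullet> V0) + l * (flux \<beta> P1 \<bullet> V1) - flux \<beta> p \<bullet> ((1 - l) *\<^sub>R V0 + l *\<^sub>R V1) \<ge> - (A * e * B)"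
  proof -
    have "norm (flux \<beta> P0 - flux \<beta> p) \<le> A * e" "norm (flux \<beta> P1 - flux \<beta> p) \<le> A * e"
      using flux_lipschitz[of P0 p] flux_lipschitz[of P1 p] P A
      by (auto simp: A_def[symmetric] intro: order_trans mult_left_mono)
    from inner_convex_perturb[OF l this, of V0 V1] show ?thesis
      by (simp add: B_def abs_le_iff)
  qed
  have e2: "(flux \<beta> p - flux \<beta> g) \<bullet> ((1 - l) *\<^sub>R V0 + l *\<^sub>R V1) \<ge> - (A * norm (p - g) * B)"
  proof -
    have "\<bar>(flux \<beta> p - flux \<beta> g) \<bullet> ((1 - l) *\<^sub>R V0 + l *\<^sub>R V1)\<bar>
        \<le> norm (flux \<beta> p - flux \<beta> g) * norm ((1 - l) *\<^sub>R V0 + l *\<^sub>R V1)"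
      by (rule Cauchy_Schwarz_ineq2)
    also have "\<dots> \<le> A * norm (p - g) * B"
      using flux_lipschitz[of p g] norm_convex[OF l, of V0 V1] A
      by (intro mult_mono) (auto simp: A_def[symmetric] B_def)
    finally show ?thesis by linarith
  qed
  have e3: "(Dp - uy) * Dv \<ge> - ((e + \<bar>py - uy\<bar>) * \<bar>Dv\<bar>)"
  proof -
    have "\<bar>(Dp - uy) * Dv\<bar> \<le> (e + \<bar>py - uy\<bar>) * \<bar>Dv\<bar>"
      unfolding abs_mult using D by (intro mult_right_mono) linarith+
    then show ?thesis by linarith
  qed
  define W where "W = (1 - l) * \<bar>v0\<bar> + l * \<bar>v1\<bar>"
  have e4: "(1 - l) * (f0 * v0) + l * (f1 * v1) - fz * ((1 - l) * v0 + l * v1) \<le> e * W"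
    using inner_convex_perturb[OF l, of f0 fz e f1 v0 v1] f by (simp add: W_def abs_le_iff)
  have y1: "A * (e + norm (p - g)) * B \<le> m / 4 * q1 + (A * (e + norm (p - g)))\<^sup>2 / m"
  proof -
    have "B\<^sup>2 \<le> q1"
      unfolding B_def q1_def by (rule square_convex[OF l])
    then have "m / 4 * B\<^sup>2 \<le> m / 4 * q1"
      using m by (intro mult_left_mono) auto
    then show ?thesis
      using young[OF m(1), of "A * (e + norm (p - g))" B] by linarith
  qed
  have y2: "(e + \<bar>py - uy\<bar>) * \<bar>Dv\<bar> \<le> m / 4 * Dv\<^sup>2 + (e + \<bar>py - uy\<bar>)\<^sup>2 / m"
    using young[OF m(1), of "e + \<bar>py - uy\<bar>" "\<bar>Dv\<bar>"] by simp
  have y3: "e * W \<le> m / 4 * q0 + e\<^sup>2 / m"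
  proof -
    have "W\<^sup>2 \<le> q0"
      unfolding W_def q0_def using square_convex[OF l, of "\<bar>v0\<bar>" "\<bar>v1\<bar>"] by simp
    then have "m / 4 * W\<^sup>2 \<le> m / 4 * q0"
      using m by (intro mult_left_mono) auto
    then show ?thesis
      using young[OF m(1), of e W] by linarith
  qed
  have s2: "(e + d)\<^sup>2 \<le> 2 * e\<^sup>2 + 2 * d\<^sup>2" for d :: real
    using norm_add_power2_le[of e d] by simp
  have "(A * (e + norm (p - g)))\<^sup>2 + (e + \<bar>py - uy\<bar>)\<^sup>2 + e\<^sup>2
      \<le> A\<^sup>2 * (2 * e\<^sup>2 + 2 * (norm (p - g))\<^sup>2) + (2 * e\<^sup>2 + 2 * (py - uy)\<^sup>2) + e\<^sup>2"
    using mult_left_mono[OF s2[of "norm (p - g)"], of "A\<^sup>2"] s2[of "\<bar>py - uy\<bar>"]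
    by (simp add: power_mult_distrib)
  \<comment> \<open>The coefficient of \<open>e\<^sup>2\<close> on the left is
    \<open>2 * A\<^sup>2 + 3\<close>, which accounts for the factor 3 in front of
    \<open>K = A\<^sup>2 + 1\<close>.\<close>
  also have "\<dots> \<le> 3 * K * ((norm (p - g))\<^sup>2 + (py - uy)\<^sup>2 + e\<^sup>2)"
  proof -
    have "3 * K * (X + Y + Z) - (A\<^sup>2 * (2 * Z + 2 * X) + (2 * Z + 2 * Y) + Z) = A\<^sup>2 * (X + 3 * Y + Z) + 3 * X + Y" for X Y Z :: real
      unfolding K A_def[symmetric] by (simp add: algebra_simps)
    moreover have "0 \<le> A\<^sup>2 * (X + 3 * Y + Z) + 3 * X + Y" if "X \<ge> 0" "Y \<ge> 0" "Z \<ge> 0" for X Y Z :: real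
      using that by simp
    ultimately show ?thesis
      by (metis diff_ge_0_iff_ge zero_le_power2)
  qed
  finally have "((A * (e + norm (p - g)))\<^sup>2 + (e + \<bar>py - uy\<bar>)\<^sup>2 + e\<^sup>2) / m
      \<le> 3 * K * ((norm (p - g))\<^sup>2 + (py - uy)\<^sup>2 + e\<^sup>2) / m"
    using m by (intro divide_right_mono) auto
  then have y4: "(A * (e + norm (p - g)))\<^sup>2 / m + (e + \<bar>py - uy\<bar>)\<^sup>2 / m + e\<^sup>2 / m
      \<le> 3 * K / m * ((norm (p - g))\<^sup>2 + (py - uy)\<^sup>2 + e\<^sup>2)"
    by (simp add: add_divide_distrib)
  have y1': "A * e * B + A * norm (p - g) * B \<le> m / 4 * q1 + (A * (e + norm (p - g)))\<^sup>2 / m"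
    using y1 by (simp only: distrib_left distrib_right)
  have e2': "- (A * norm (p - g) * B)
      \<le> flux \<beta> p \<bullet> ((1 - l) *\<^sub>R V0 + l *\<^sub>R V1) - flux \<beta> g \<bullet> ((1 - l) *\<^sub>R V0 + l *\<^sub>R V1)"
    using e2 by (simp only: inner_diff_left)
  have e3': "- ((e + \<bar>py - uy\<bar>) * \<bar>Dv\<bar>) \<le> Dp * Dv - uy * Dv"
    using e3 by (simp only: left_diff_distrib)
  \<comment> \<open>The final bookkeeping in abstract letters, so that linear arithmetic meets no
    products: X and Y carry the chains of flux and y-terms, E the perturbation errors, Z their
    squares from Young.\<close>
  have arith: "mq + mD \<le> X1 + Y1 - F1 - (X4 + Y3 - F2) + (a4 + b4 + c4 + R)"
    if "mq \<le> X1 - X2" "mD \<le> Y1 - Y2" "- E1 \<le> X2 - X3" "- E2 \<le> X3 - X4" "- E3 \<le> Y2 - Y3" "F1 - F2 \<le> E4"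
      "E1 + E2 \<le> a4 + Z1" "E3 \<le> b4 + Z2" "E4 \<le> c4 + Z3" "Z1 + Z2 + Z3 \<le> R"
    for mq mD X1 X2 X3 X4 Y1 Y2 Y3 F1 F2 E1 E2 E3 E4 a4 b4 c4 Z1 Z2 Z3 R :: real
    using that by linarith
  show ?thesis
    unfolding distrib_left[of m] distrib_left[of "m / 4"]
    by (rule arith[OF mono D2 e1 e2' e3' e4 y1' y2 y3 y4])
qed

end

text \<open>Mean value theorem; continuity of \<beta> at 0 is what admits intervals that start
  there.\<close>

lemma nonlinearityI:
  assumes "\<epsilon> > 0" "\<beta> 0 = 0" "continuous_on {0..} \<beta>" "\<forall>t>0. (\<beta> has_real_derivative \<beta>' t) (at t)"
    "\<forall>t>0. \<epsilon> \<le> \<beta>' t \<and> \<beta>' t \<le> 1 / \<epsilon>"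
  shows "nonlinearity \<beta> \<epsilon>"
proof
  fix s t :: real assume st: "0 \<le> s" "s \<le> t"
  have "\<epsilon> * (t - s) \<le> \<beta> t - \<beta> s \<and> \<beta> t - \<beta> s \<le> (t - s) / \<epsilon>"
  proof (cases "s = t")
    case False
    with st have "s < t" by simp
    moreover have "continuous_on {s..t} \<beta>"
      using assms(3) by (rule continuous_on_subset) (use st in auto)
    moreover have "\<beta> differentiable (at x)" if "s < x" "x < t" for x
      using assms(4) that st unfolding real_differentiable_def by (meson order_le_less_trans)
    ultimately obtain l z where z: "s < z" "z < t" "(\<beta> has_real_derivative l) (at z)" "\<beta> t - \<beta> s = (t - s) * l"
      using MVT[of s t \<beta>] by blast
    have "z > 0" using z st by simp
    then have "l = \<beta>' z"
      using assms(4) z(3) DERIV_unique by blast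
    with \<open>z > 0\<close> have l: "\<epsilon> \<le> l" "l \<le> 1 / \<epsilon>"
      using assms(5) by auto
    show ?thesis
      using mult_left_mono[OF l(1), of "t - s"] mult_left_mono[OF l(2), of "t - s"] st z(4)
      by (simp add: mult.commute)
  qed simp
  then show "\<epsilon> * (t - s) \<le> \<beta> t - \<beta> s" "\<beta> t - \<beta> s \<le> (t - s) / \<epsilon>"
    by auto
qed (use assms in auto)

section \<open>Slices and consistency\<close>

text \<open>The projection of the compact set K to the first factor is compact and lies in \<Omega>.
  The height y is arbitrary, so the end nodes, where the slice vanishes, are included.\<close>

lemma test_fun_slice:
  assumes "test_fun (Omega \<Omega>) \<phi>"
  shows "test_fun \<Omega> (\<lambda>x. \<phi> (x, y))"
proof -
  obtain K where K: "smooth \<phi>" "compact K" "K \<subseteq> Omega \<Omega>" "\<And>z. z \<notin> K \<Longrightarrow> \<phi> z = 0"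
    using assms by (rule test_funE) (rule that)
  show ?thesis
  proof (rule test_funI)
    have "bounded_linear (\<lambda>x::'a. (x, 0::real))"
      by (intro bounded_linear_Pair bounded_linear_ident bounded_linear_zero)
    from smooth_affine[OF this K(1), of "(0, y)"] show "smooth (\<lambda>x. \<phi> (x, y))"
      by simp
    show "compact (fst ` K)"
      using K(2) by (intro compact_continuous_image continuous_intros)
    show "fst ` K \<subseteq> \<Omega>"
      using K(3) by (auto simp: Omega_def)
    show "\<phi> (x, y) = 0" if "x \<notin> fst ` K" for x
      using that by (intro K(4)) force
  qed
qed

lemma cgrad_slice:
  assumes "smooth \<phi>"
  shows "cgrad (\<lambda>x. \<phi> (x, y)) x = fst (cgrad \<phi> (x, y))"
proof (rule cgrad_eqI)
  have "((\<lambda>x. \<phi> (x, y)) has_derivative (\<lambda>v. cgrad \<phi> (x, y) \<bullet> (v, 0))) (at x)"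
    by (rule has_derivative_compose[OF _ smooth_has_derivative_cgrad[OF assms]])
      (auto intro!: derivative_eq_intros)
  then show "((\<lambda>x. \<phi> (x, y)) has_derivative (\<lambda>v. fst (cgrad \<phi> (x, y)) \<bullet> v)) (at x)"
    by (simp add: inner_prod_def)
qed

lemma slice_has_real_derivative:
  assumes "smooth \<phi>"
  shows "((\<lambda>y. \<phi> (x, y)) has_real_derivative snd (cgrad \<phi> (x, y))) (at y)"
proof -
  have "((\<lambda>y. \<phi> (x, y)) has_derivative (\<lambda>v. cgrad \<phi> (x, y) \<bullet> (0, v))) (at y)"
    by (rule has_derivative_compose[OF _ smooth_has_derivative_cgrad[OF assms]])
      (auto intro!: derivative_eq_intros)
  then show ?thesis
    by (simp add: inner_prod_def has_field_derivative_def)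
qed

lemma test_fun_cgrad_eq_0:
  assumes "test_fun U \<phi>" "x \<notin> U"
  shows "cgrad \<phi> x = 0"
  unfolding cgrad_def
  by (rule sum.neutral) (simp add: test_fun_eq_0[OF test_fun_partial[OF assms(1)] assms(2)])

lemma test_fun_cgrad_lipschitz:
  fixes \<phi> :: "'a::euclidean_space \<Rightarrow> real"
  assumes "test_fun U \<phi>"
  obtains L where "L \<ge> 0" "\<And>x y. norm (cgrad \<phi> x - cgrad \<phi> y) \<le> L * norm (x - y)"
proof -
  have "\<forall>i\<in>Basis. \<exists>L. L \<ge> 0 \<and> (\<forall>x y. \<bar>frechet_derivative \<phi> (at x) i - frechet_derivative \<phi> (at y) i\<bar> \<le> L * norm (x - y))"
  proof
    fix i :: 'a assume i: "i \<in> Basis"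
    obtain L where "L \<ge> 0" "\<And>x y. \<bar>frechet_derivative \<phi> (at x) i - frechet_derivative \<phi> (at y) i\<bar> \<le> L * norm (x - y)"
      by (rule test_fun_lipschitz[OF test_fun_partial[OF assms i]]) (rule that)
    then show "\<exists>L. L \<ge> 0 \<and> (\<forall>x y. \<bar>frechet_derivative \<phi> (at x) i - frechet_derivative \<phi> (at y) i\<bar> \<le> L * norm (x - y))"
      by (intro exI[of _ L]) simp
  qed
  from bchoice[OF this] obtain L where "\<forall>i\<in>Basis. L i \<ge> 0 \<and>
      (\<forall>x y. \<bar>frechet_derivative \<phi> (at x) i - frechet_derivative \<phi> (at y) i\<bar> \<le> L i * norm (x - y))" ..
  then have L: "L i \<ge> 0" "\<bar>frechet_derivative \<phi> (at x) i - frechet_derivative \<phi> (at y) i\<bar> \<le> L i * norm (x - y)"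
    if "i \<in> Basis" for i x y
    using that by simp_all
  show ?thesis
  proof
    show "(\<Sum>i\<in>Basis. L i) \<ge> 0"
      by (intro sum_nonneg L)
    fix x y
    have "cgrad \<phi> x - cgrad \<phi> y = (\<Sum>i\<in>Basis. (frechet_derivative \<phi> (at x) i - frechet_derivative \<phi> (at y) i) *\<^sub>R i)"
      by (simp add: cgrad_def sum_subtractf scaleR_diff_left)
    also have "norm \<dots> \<le> (\<Sum>i\<in>Basis. L i * norm (x - y))"
      by (rule order_trans[OF norm_sum]) (auto intro!: sum_mono L)
    finally show "norm (cgrad \<phi> x - cgrad \<phi> y) \<le> (\<Sum>i\<in>Basis. L i) * norm (x - y)"
      by (simp add: sum_distrib_right)
  qed
qed

text \<open>By the mean value theorem the quotient is the y-derivative at some t in the same cell,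
  at distance at most h from y; the gradient is Lipschitz.\<close>

lemma difference_quotient_error:
  assumes "smooth \<phi>" "0 \<le> L" "\<And>z z'. norm (cgrad \<phi> z - cgrad \<phi> z') \<le> L * norm (z - z')"
    and "0 < h" "y0 \<le> y" "y \<le> y0 + h"
  shows "\<bar>(\<phi> (x, y0 + h) - \<phi> (x, y0)) / h - snd (cgrad \<phi> (x, y))\<bar> \<le> L * h"
proof -
  obtain t where t: "y0 < t" "t < y0 + h" "\<phi> (x, y0 + h) - \<phi> (x, y0) = (y0 + h - y0) * snd (cgrad \<phi> (x, t))"
    using MVT2[of y0 "y0 + h" "\<lambda>y. \<phi> (x, y)" "\<lambda>t. snd (cgrad \<phi> (x, t))"] slice_has_real_derivative[OF assms(1)] assms(4)
    by auto
  then have "(\<phi> (x, y0 + h) - \<phi> (x, y0)) / h - snd (cgrad \<phi> (x, y)) = snd (cgrad \<phi> (x, t) - cgrad \<phi> (x, y))"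
    using assms(4) by simp
  also have "\<bar>\<dots>\<bar> \<le> norm (cgrad \<phi> (x, t) - cgrad \<phi> (x, y))"
    using norm_snd_le[of "snd p" "fst p" for p :: "'a \<times> real"] by (metis prod.collapse real_norm_def)
  also have "\<dots> \<le> L * norm ((x, t) - (x, y))"
    by (rule assms(3))
  also have "\<dots> \<le> L * h"
    using t assms(2,5,6) by (intro mult_left_mono) (auto simp: norm_Pair)
  finally show ?thesis .
qed

lemma itp_diff: "itp N (\<lambda>j x. a j x - b j x) z = itp N a z - itp N b z"
  by (simp add: itp_def algebra_simps)

lemma dq_diff: "dq N (\<lambda>j x. a j x - b j x) j x = dq N a j x - dq N b j x"
  by (simp add: dq_def algebra_simps)

text \<open>Telescoping writes (N+1) v_i as a sum of i quotients, and Cauchy-Schwarz costs a factor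
  i, at most N+1. The sum over the N nodes then gives N/(N+1), below 1 because the interval has unit
  length.\<close>

lemma discrete_Poincare:
  fixes v :: "nat \<Rightarrow> 'a \<Rightarrow> real"
  assumes "v 0 x = 0"
  shows "(\<Sum>i=1..N. (v i x)\<^sup>2) \<le> (\<Sum>k=0..N. (dq N v k x)\<^sup>2)"
proof -
  define n where "n = real (N + 1)"
  define S where "S = (\<Sum>k=0..N. (dq N v k x)\<^sup>2)"
  have n: "n > 0" by (simp add: n_def)
  have S: "S \<ge> 0" by (simp add: S_def sum_nonneg)
  have v: "n * v i x = (\<Sum>k<i. dq N v k x)" for i
    using assms by (induction i) (simp_all add: dq_def n_def algebra_simps)
  have "(v i x)\<^sup>2 \<le> S / n" if i: "i \<in> {1..N}" for i
  proof -
    have "(n * v i x)\<^sup>2 = (\<Sum>k<i. 1 * dq N v k x)\<^sup>2"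
      by (simp add: v)
    also have "\<dots> \<le> (\<Sum>k<i. 1\<^sup>2) * (\<Sum>k<i. (dq N v k x)\<^sup>2)"
      by (rule Cauchy_Schwarz_ineq_sum)
    also have "\<dots> \<le> n * S"
    proof (rule mult_mono)
      show "(\<Sum>k<i. 1\<^sup>2) \<le> n" using i by (simp add: n_def)
      show "(\<Sum>k<i. (dq N v k x)\<^sup>2) \<le> S"
        unfolding S_def using i by (intro sum_mono2) auto
    qed (use n in \<open>auto intro: sum_nonneg\<close>)
    finally have "n * (n * (v i x)\<^sup>2) \<le> n * S"
      by (simp add: power_mult_distrib power2_eq_square mult_ac)
    then show ?thesis
      using n by (simp add: field_simps)
  qed
  then have "(\<Sum>i=1..N. (v i x)\<^sup>2) \<le> (\<Sum>i=1..N. S / n)"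
    by (rule sum_mono)
  also have "\<dots> = (real N / n) * S" by simp
  also have "\<dots> \<le> 1 * S"
    using S n by (intro mult_right_mono) (simp_all add: n_def)
  finally show ?thesis by (simp add: S_def)
qed

section \<open>The semidiscrete scheme\<close>

locale scheme = nonlinearity \<beta> \<epsilon> for \<beta> :: "real \<Rightarrow> real" and \<epsilon> :: real +
  fixes \<Omega> :: "'a::euclidean_space set" and f u :: "'a \<times> real \<Rightarrow> real" and U :: "nat \<Rightarrow> nat \<Rightarrow> 'a \<Rightarrow> real"
  assumes open_\<Omega>: "open \<Omega>" and bounded_\<Omega>: "bounded \<Omega>"
    and test_f: "test_fun (Omega \<Omega>) f"
    and sol: "weak_sol_cont \<beta> \<Omega> f u"
    and dsol: "weak_sol_disc \<beta> \<Omega> N (\<lambda>j x. f (x, real j / real (N + 1))) (U N)"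
begin

abbreviation M where "M \<equiv> lebesgue_on (Omega \<Omega>)"
abbreviation M1 where "M1 \<equiv> lebesgue_on \<Omega>"

definition Gu :: "'a \<times> real \<Rightarrow> 'a \<times> real" where
  "Gu = wgrad (Omega \<Omega>) u"

text \<open>The weak gradient of the zero function is only almost everywhere zero, hence the case distinction.\<close>
definition G :: "nat \<Rightarrow> nat \<Rightarrow> 'a \<Rightarrow> 'a" where
  "G N j = (if j = 0 \<or> j = N + 1 then (\<lambda>x. 0) else wgrad \<Omega> (U N j))"

lemma sets_\<Omega>: "\<Omega> \<in> sets lebesgue" and sets_Omega: "Omega \<Omega> \<in> sets lebesgue"
  using open_\<Omega> open_Omega[OF open_\<Omega>] by auto

lemma finite_M: "finite_measure M"
  using bounded_\<Omega> sets_Omega by (intro finite_measure_lebesgue_on) (auto simp: Omega_def intro: bounded_Times)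

lemma space_M: "space M = Omega \<Omega>"
  by (simp add: space_restrict_space)

lemma H10g_u: "H10g (Omega \<Omega>) u Gu"
  unfolding Gu_def using sol by (intro H10g_wgrad open_Omega open_\<Omega>) (simp add: weak_sol_cont_def)

lemma U_0: "U N 0 = (\<lambda>x. 0)" and U_Suc: "U N (N + 1) = (\<lambda>x. 0)"
  and H10_U: "j \<le> N + 1 \<Longrightarrow> H10 \<Omega> (U N j)"
  using dsol[of N] by (auto simp: weak_sol_disc_def Let_def)

lemma G_0: "G N 0 x = 0" "G N (N + 1) x = 0"
  by (simp_all add: G_def)

lemma H10g_U: "j \<le> N + 1 \<Longrightarrow> H10g \<Omega> (U N j) (G N j)"
  using H10g_wgrad[OF open_\<Omega> H10_U[of j N]] H10g_zero[OF sets_\<Omega>]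
  by (auto simp: G_def U_0 U_Suc[simplified])

text \<open>The equation holds for \<open>wgrad\<close> of the test function; any named gradient
  differs from it only on a null set, which the integrals ignore.\<close>

lemma weak_form_cont:
  assumes v: "H10g (Omega \<Omega>) v V"
  shows "(LINT z|M. flux \<beta> (fst (Gu z)) \<bullet> fst (V z)) + (LINT z|M. snd (Gu z) * snd (V z)) = (LINT z|M. f z * v z)"
proof -
  let ?W = "wgrad (Omega \<Omega>) v"
  have H: "H10 (Omega \<Omega>) v"
    using v H10_iff_H10g[OF sets_Omega] by blast
  have W: "H10g (Omega \<Omega>) v ?W"
    by (rule H10g_wgrad[OF open_Omega[OF open_\<Omega>] H])
  have ae: "AE z in M. ?W z = V z"
    by (rule wgrad_AE[OF open_Omega[OF open_\<Omega>] v])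
  have sg: "sqint M Gu" "sqint M V" "sqint M ?W"
    using H10g_sqint_grad H10g_u v W by blast+
  have "(LINT z|M. flux \<beta> (fst (Gu z)) \<bullet> fst (?W z)) = (LINT z|M. flux \<beta> (fst (Gu z)) \<bullet> fst (V z))"
    using ae sg by (intro integral_cong_AE borel_measurable_integrable sqint_inner sqint_flux sqint_fst)
      (auto elim!: eventually_mono)
  moreover have "(LINT z|M. snd (Gu z) * snd (?W z)) = (LINT z|M. snd (Gu z) * snd (V z))"
    using ae sg by (intro integral_cong_AE borel_measurable_integrable sqint_mult sqint_snd)
      (auto elim!: eventually_mono)
  moreover have "(LINT z|M. flux \<beta> (fst (Gu z)) \<bullet> fst (?W z)) + (LINT z|M. snd (Gu z) * snd (?W z)) = (LINT z|M. f z * v z)"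
    using sol H unfolding weak_sol_cont_def set_integral_lebesgue_on[OF sets_Omega] Gu_def
    by (simp add: flux_def)
  ultimately show ?thesis by simp
qed

lemma test_f_slice: "sqint M1 (\<lambda>x. f (x, y))"
  by (intro sqint_lebesgue_on test_fun_sqint[OF test_fun_slice[OF test_f]] sets_\<Omega>)

lemma sqint_dq: "(\<And>j. j \<le> N + 1 \<Longrightarrow> sqint M1 (w j)) \<Longrightarrow> j \<le> N \<Longrightarrow> sqint M1 (dq N w j)"
  unfolding dq_def by (intro sqint_cmult sqint_diff) auto

lemma weak_form_disc:
  assumes v: "\<And>j. j \<le> N + 1 \<Longrightarrow> H10g \<Omega> (v j) (V j)" and v0: "v 0 = (\<lambda>x. 0)" "v (N + 1) = (\<lambda>x. 0)"
  shows "(\<Sum>j=1..N. LINT x|M1. flux \<beta> (G N j x) \<bullet> V j x) + (\<Sum>j=0..N. LINT x|M1. dq N (U N) j x * dq N v j x)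
    = (\<Sum>j=1..N. LINT x|M1. f (x, real j / real (N + 1)) * v j x)"
proof -
  have H: "H10 \<Omega> (v j)" if "j \<le> N + 1" for j
    using v[OF that] H10_iff_H10g[OF sets_\<Omega>] by blast
  have sU: "sqint M1 (U N j)" "sqint M1 (G N j)" "sqint M1 (v j)" "sqint M1 (V j)" if "j \<le> N + 1" for j
    using H10g_sqint H10g_sqint_grad H10g_U[OF that] v[OF that] by blast+
  have W: "H10g \<Omega> (v j) (wgrad \<Omega> (v j))" "AE x in M1. wgrad \<Omega> (v j) x = V j x" if "j \<le> N + 1" for j
    using H10g_wgrad[OF open_\<Omega> H[OF that]] wgrad_AE[OF open_\<Omega> v[OF that]] .
  have "(LINT x|M1. (\<Sum>j=1..N. acoef \<beta> (norm (wgrad \<Omega> (U N j) x)) * (wgrad \<Omega> (U N j) x \<bullet> wgrad \<Omega> (v j) x)))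
      = (\<Sum>j=1..N. LINT x|M1. flux \<beta> (G N j x) \<bullet> V j x)"
  proof -
    have i: "integrable M1 (\<lambda>x. flux \<beta> (G N j x) \<bullet> wgrad \<Omega> (v j) x)" "integrable M1 (\<lambda>x. flux \<beta> (G N j x) \<bullet> V j x)"
      if "j \<in> {1..N}" for j
      using that sU[of j] H10g_sqint_grad[OF W(1)[of j]] by (auto intro!: sqint_inner sqint_flux)
    have "(LINT x|M1. (\<Sum>j=1..N. acoef \<beta> (norm (wgrad \<Omega> (U N j) x)) * (wgrad \<Omega> (U N j) x \<bullet> wgrad \<Omega> (v j) x)))
        = (LINT x|M1. (\<Sum>j=1..N. flux \<beta> (G N j x) \<bullet> wgrad \<Omega> (v j) x))"
      by (intro Bochner_Integration.integral_cong refl sum.cong) (auto simp: flux_def G_def)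
    also have "\<dots> = (\<Sum>j=1..N. LINT x|M1. flux \<beta> (G N j x) \<bullet> wgrad \<Omega> (v j) x)"
      by (rule Bochner_Integration.integral_sum) (rule i(1))
    also have "\<dots> = (\<Sum>j=1..N. LINT x|M1. flux \<beta> (G N j x) \<bullet> V j x)"
    proof (rule sum.cong[OF refl])
      fix j assume j: "j \<in> {1..N}"
      then have "AE x in M1. wgrad \<Omega> (v j) x = V j x" by (intro W) auto
      then show "(LINT x|M1. flux \<beta> (G N j x) \<bullet> wgrad \<Omega> (v j) x) = (LINT x|M1. flux \<beta> (G N j x) \<bullet> V j x)"
        using i[OF j] by (intro integral_cong_AE borel_measurable_integrable) (auto elim!: eventually_mono)
    qed
    finally show ?thesis .
  qed
  moreover have "(LINT x|M1. (\<Sum>j=0..N. ((U N (j+1) x - U N j x) / (1 / real (N + 1))) * ((v (j+1) x - v j x) / (1 / real (N + 1)))))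
      = (\<Sum>j=0..N. LINT x|M1. dq N (U N) j x * dq N v j x)"
  proof -
    have "(LINT x|M1. (\<Sum>j=0..N. ((U N (j+1) x - U N j x) / (1 / real (N + 1))) * ((v (j+1) x - v j x) / (1 / real (N + 1)))))
        = (LINT x|M1. (\<Sum>j=0..N. dq N (U N) j x * dq N v j x))"
      by (intro Bochner_Integration.integral_cong refl sum.cong) (simp add: dq_def mult_ac)
    also have "\<dots> = (\<Sum>j=0..N. LINT x|M1. dq N (U N) j x * dq N v j x)"
      using sU by (intro Bochner_Integration.integral_sum sqint_mult sqint_dq) auto
    finally show ?thesis .
  qed
  moreover have "(LINT x|M1. (\<Sum>j=1..N. f (x, real j / real (N + 1)) * v j x))
      = (\<Sum>j=1..N. LINT x|M1. f (x, real j / real (N + 1)) * v j x)"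
    using sU by (intro Bochner_Integration.integral_sum sqint_mult test_f_slice) auto
  moreover have "(LINT x|M1. (\<Sum>j=1..N. acoef \<beta> (norm (wgrad \<Omega> (U N j) x)) * (wgrad \<Omega> (U N j) x \<bullet> wgrad \<Omega> (v j) x)))
      + (LINT x|M1. (\<Sum>j=0..N. ((U N (j+1) x - U N j x) / (1 / real (N + 1))) * ((v (j+1) x - v j x) / (1 / real (N + 1)))))
      = (LINT x|M1. (\<Sum>j=1..N. f (x, real j / real (N + 1)) * v j x))"
    using dsol[of N] H v0 unfolding weak_sol_disc_def Let_def set_integral_lebesgue_on[OF sets_\<Omega>] by blast
  ultimately show ?thesis by simp
qed

text \<open>The discrete equation divided by N + 1. Flux and source, which live on nodes, are
  represented by interpolations; the quotients, which live on cells, by piecewise constants.\<close>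

lemma weak_form_disc_Omega:
  assumes v: "\<And>j. j \<le> N + 1 \<Longrightarrow> H10g \<Omega> (v j) (V j)" and v0: "v 0 = (\<lambda>x. 0)" "v (N + 1) = (\<lambda>x. 0)"
    and V0: "\<And>x. V 0 x = 0" "\<And>x. V (N + 1) x = 0"
  shows "integrable M (itp N (\<lambda>j x. flux \<beta> (G N j x) \<bullet> V j x))"
    "integrable M (cst N (\<lambda>j x. dq N (U N) j x * dq N v j x))"
    "integrable M (itp N (\<lambda>j x. f (x, real j / real (N + 1)) * v j x))"
    "integral\<^sup>L M (itp N (\<lambda>j x. flux \<beta> (G N j x) \<bullet> V j x)) + integral\<^sup>L M (cst N (\<lambda>j x. dq N (U N) j x * dq N v j x))
      = integral\<^sup>L M (itp N (\<lambda>j x. f (x, real j / real (N + 1)) * v j x))"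
proof -
  have s: "sqint M1 (U N j)" "sqint M1 (G N j)" "sqint M1 (v j)" "sqint M1 (V j)" if "j \<le> N + 1" for j
    using H10g_sqint H10g_sqint_grad H10g_U[OF that] v[OF that] by blast+
  have 1: "integrable M1 (\<lambda>x. flux \<beta> (G N i x) \<bullet> V i x)" if "1 \<le> i" "i \<le> N" for i
    using s[of i] that by (intro sqint_inner sqint_flux) auto
  have 2: "integrable M1 (\<lambda>x. dq N (U N) i x * dq N v i x)" if "i \<le> N" for i
    using s that by (intro sqint_mult sqint_dq) auto
  have 3: "integrable M1 (\<lambda>x. f (x, real i / real (N + 1)) * v i x)" if "1 \<le> i" "i \<le> N" for i
    using s[of i] that by (intro sqint_mult test_f_slice) auto
  note i1 = integral_itp[OF open_\<Omega>, of N "\<lambda>j x. flux \<beta> (G N j x) \<bullet> V j x", OF 1]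
  note i2 = integral_cst[OF open_\<Omega>, of N "\<lambda>j x. dq N (U N) j x * dq N v j x", OF 2]
  note i3 = integral_itp[OF open_\<Omega>, of N "\<lambda>j x. f (x, real j / real (N + 1)) * v j x", OF 3]
  show "integrable M (itp N (\<lambda>j x. flux \<beta> (G N j x) \<bullet> V j x))"
    by (rule i1(1)) (use V0 in auto)
  show "integrable M (cst N (\<lambda>j x. dq N (U N) j x * dq N v j x))"
    by (rule i2(1))
  show "integrable M (itp N (\<lambda>j x. f (x, real j / real (N + 1)) * v j x))"
    by (rule i3(1)) (use v0 in auto)
  have "integral\<^sup>L M (itp N (\<lambda>j x. flux \<beta> (G N j x) \<bullet> V j x)) = (\<Sum>j=1..N. LINT x|M1. flux \<beta> (G N j x) \<bullet> V j x) / real (N + 1)"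
    by (rule i1(2)) (use V0 in auto)
  moreover have "integral\<^sup>L M (itp N (\<lambda>j x. f (x, real j / real (N + 1)) * v j x))
      = (\<Sum>j=1..N. LINT x|M1. f (x, real j / real (N + 1)) * v j x) / real (N + 1)"
    by (rule i3(2)) (use v0 in auto)
  moreover have "integral\<^sup>L M (cst N (\<lambda>j x. dq N (U N) j x * dq N v j x))
      = (\<Sum>j=0..N. LINT x|M1. dq N (U N) j x * dq N v j x) / real (N + 1)"
    by (rule i2(2))
  ultimately show "integral\<^sup>L M (itp N (\<lambda>j x. flux \<beta> (G N j x) \<bullet> V j x)) + integral\<^sup>L M (cst N (\<lambda>j x. dq N (U N) j x * dq N v j x))
      = integral\<^sup>L M (itp N (\<lambda>j x. f (x, real j / real (N + 1)) * v j x))"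
    using weak_form_disc[OF v v0] by (simp only: flip: add_divide_distrib)
qed

end

text \<open>Serves the splitting of the total error into discrete difference, interpolation error of
  \<phi> and distance from \<phi> to \<open>u\<close>.\<close>

lemma norm_add3_power2_le: "(norm (x + y + z))\<^sup>2 \<le> 3 * (norm x)\<^sup>2 + 3 * (norm y)\<^sup>2 + 3 * (norm z)\<^sup>2"
  for x y z :: "'a::real_normed_vector"
proof -
  have "(norm (x + y + z))\<^sup>2 \<le> (norm x + norm y + norm z)\<^sup>2"
    by (intro power_mono order_trans[OF norm_triangle_ineq] add_mono norm_triangle_ineq) auto
  also have "\<dots> \<le> 3 * (norm x)\<^sup>2 + 3 * (norm y)\<^sup>2 + 3 * (norm z)\<^sup>2"
    using zero_le_power2[of "norm x - norm y"] zero_le_power2[of "norm y - norm z"] zero_le_power2[of "norm x - norm z"]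
    by (simp add: power2_eq_square algebra_simps)
  finally show ?thesis .
qed

section \<open>The error estimate and strong convergence\<close>

context scheme
begin

text \<open>The jet of the interpolated discrete solution: value, x-gradient and y-derivative. Its
  L2 distance to \<open>Wu\<close> is the H1 distance to \<open>u\<close>.\<close>

definition W :: "nat \<Rightarrow> 'a \<times> real \<Rightarrow> real \<times> 'a \<times> real" where
  "W N z = (itp N (U N) z, itp N (G N) z, cst N (dq N (U N)) z)"

definition Wu :: "'a \<times> real \<Rightarrow> real \<times> 'a \<times> real" where
  "Wu z = (u z, Gu z)"

text \<open>Coercivity constant of the whole operator: \<epsilon> for the flux and 1 for the linear
  term in y.\<close>

definition m where "m = min \<epsilon> 1"
definition K where "K = (3 / \<epsilon>)\<^sup>2 + 1"
text \<open>The energy bound \<open>6 * K / m\<^sup>2\<close> enters \<open>estimate\<close> with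
  weight 6, and the 9 comes from the interpolation error of \<phi>. Only \<epsilon> is involved, so
  the constant survives a change of \<phi>.\<close>

definition C where "C = 36 * K / m\<^sup>2 + 9"

lemma m: "0 < m" "m \<le> \<epsilon>" "m \<le> 1"
  using eps_pos by (auto simp: m_def)

lemma K: "K > 0"
  by (simp add: K_def add_nonneg_pos)

lemma H10g_W: "H10g (Omega \<Omega>) (itp N (U N)) (\<lambda>z. (itp N (G N) z, cst N (dq N (U N)) z))"
  using G_0[of N] U_0[of N] U_Suc[of N] by (intro H10g_itp open_\<Omega> H10g_U) auto

lemma sqint_W: "sqint M (W N)" and sqint_Wu: "sqint M Wu"
  using H10g_sqint_Pair[OF H10g_W] H10g_sqint_Pair[OF H10g_u] unfolding W_def[abs_def] Wu_def[abs_def] by simp_all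

text \<open>Integrated form of \<open>pointwise_estimate\<close>. A single L serves as Lipschitz
  constant for \<open>f\<close>, \<phi> and the gradient of \<phi>, so that each consistency error
  is at most e = L h.\<close>

lemma estimate:
  assumes \<phi>: "test_fun (Omega \<Omega>) \<phi>"
    and L: "0 \<le> L" "\<And>z z'. \<bar>f z - f z'\<bar> \<le> L * norm (z - z')"
      "\<And>z z'. \<bar>\<phi> z - \<phi> z'\<bar> \<le> L * norm (z - z')"
      "\<And>z z'. norm (cgrad \<phi> z - cgrad \<phi> z') \<le> L * norm (z - z')"
  shows "sqdist M (W N) Wu
    \<le> C * (sqdist M (jet \<phi>) Wu + (L / real (N + 1))\<^sup>2 * measure M (space M))"
proof -
  define n where "n = real (N + 1)"
  have n: "n > 0" by (simp add: n_def)
  define e where "e = L / n"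
  have e: "e \<ge> 0" using L(1) n by (simp add: e_def)
  define ph where "ph j x = \<phi> (x, real j / n)" for j x
  define Ph where "Ph j x = fst (cgrad \<phi> (x, real j / n))" for j x
  define v where "v j x = U N j x - ph j x" for j x
  define V where "V j x = G N j x - Ph j x" for j x
  define fj where "fj j x = f (x, real j / real (N + 1))" for j x
  note sm = test_fun_smooth[OF \<phi>]
  \<comment> \<open>The end nodes sit at heights 0 and 1, outside the cylinder. Hence \<phi> and its
    gradient vanish there, and the differences \<open>v\<close> satisfy the end conditions of the
    discrete test space.\<close>
  have out: "(x, real 0 / n) \<notin> Omega \<Omega>" "(x, real (N + 1) / n) \<notin> Omega \<Omega>" for x
    using n by (auto simp: Omega_def n_def)
  have ph0: "ph 0 x = 0" "ph (N + 1) x = 0" and Ph0: "Ph 0 x = 0" "Ph (N + 1) x = 0" for x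
    using test_fun_eq_0[OF \<phi> out(1)] test_fun_eq_0[OF \<phi> out(2)]
      test_fun_cgrad_eq_0[OF \<phi> out(1)] test_fun_cgrad_eq_0[OF \<phi> out(2)]
    by (simp_all add: ph_def Ph_def)
  have v0: "v 0 = (\<lambda>x. 0)" "v (N + 1) = (\<lambda>x. 0)"
    unfolding v_def[abs_def] using U_0[of N] U_Suc[of N] ph0 by simp_all
  have V0: "V 0 x = 0" "V (N + 1) x = 0" for x
    unfolding V_def using G_0[of N] Ph0 by simp_all
  have Hv: "H10g \<Omega> (v j) (V j)" if "j \<le> N + 1" for j
  proof -
    have "cgrad (ph j) = Ph j"
      unfolding ph_def[abs_def] Ph_def[abs_def] by (rule ext) (rule cgrad_slice[OF sm])
    moreover have "test_fun \<Omega> (ph j)"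
      unfolding ph_def[abs_def] by (rule test_fun_slice[OF \<phi>])
    ultimately have "H10g \<Omega> (ph j) (Ph j)"
      using H10g_test_fun[OF sets_\<Omega>] by metis
    then show ?thesis
      unfolding v_def[abs_def] V_def[abs_def] by (rule H10g_diff[OF sets_\<Omega> H10g_U[OF that]])
  qed
  have Hitp: "H10g (Omega \<Omega>) (itp N v) (\<lambda>z. (itp N V z, cst N (dq N v) z))"
    by (rule H10g_itp[OF open_\<Omega> Hv]) (use v0 V0 in auto)
  have s: "sqint M1 (v j)" "sqint M1 (V j)" if "j \<le> N + 1" for j
    using H10g_sqint[OF Hv[OF that]] H10g_sqint_grad[OF Hv[OF that]] .
  have sw: "sqint M (itp N v)" "sqint M (itp N V)" "sqint M (cst N (dq N v))"
    using H10g_sqint[OF Hitp] sqint_fst[OF H10g_sqint_grad[OF Hitp]] sqint_snd[OF H10g_sqint_grad[OF Hitp]] by simp_all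
  have sGu: "sqint M (\<lambda>z. fst (Gu z))" "sqint M (\<lambda>z. snd (Gu z))"
    using sqint_fst sqint_snd H10g_sqint_grad[OF H10g_u] by blast+
  have sf: "sqint M f"
    by (intro sqint_lebesgue_on test_fun_sqint[OF test_f] sets_Omega)
  have s\<phi>: "sqint M (jet \<phi>)"
    by (rule test_fun_sqint_Pair[OF sets_Omega \<phi>])
  \<comment> \<open>Interpolations of squares rather than squares of interpolations: the former are
    what nodal monotonicity produces, and by convexity they dominate the latter.\<close>
  define q0 where "q0 = itp N (\<lambda>j x. (v j x)\<^sup>2)"
  define q1 where "q1 = itp N (\<lambda>j x. (norm (V j x))\<^sup>2)"
  define q2 where "q2 = cst N (\<lambda>j x. (dq N v j x)\<^sup>2)"
  have iv: "integrable M1 (\<lambda>x. (v j x)\<^sup>2)" "integrable M1 (\<lambda>x. (norm (V j x))\<^sup>2)" if "1 \<le> j" "j \<le> N" for j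
    using s[of j] that by (auto intro: sqint_integrable_power2 sqint_integrable)
  have id: "integrable M1 (\<lambda>x. (dq N v j x)\<^sup>2)" if "j \<le> N" for j
    using s that by (intro sqint_integrable_power2 sqint_dq)
  note iq0 = integral_itp[OF open_\<Omega>, of N "\<lambda>j x. (v j x)\<^sup>2", OF iv(1), folded q0_def]
  note iq1 = integral_itp[OF open_\<Omega>, of N "\<lambda>j x. (norm (V j x))\<^sup>2", OF iv(2), folded q1_def]
  note iq2 = integral_cst[OF open_\<Omega>, of N "\<lambda>j x. (dq N v j x)\<^sup>2", OF id, folded q2_def]
  have q: "integrable M q0" "integrable M q1" "integrable M q2"
    using iq0(1) iq1(1) iq2(1) v0 V0 by simp_all
  have "integral\<^sup>L M q0 = (\<Sum>i=1..N. LINT x|M1. (v i x)\<^sup>2) / n"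
    unfolding n_def by (rule iq0(2)) (use v0 in auto)
  also have "\<dots> = (LINT x|M1. (\<Sum>i=1..N. (v i x)\<^sup>2)) / n"
    using iv(1) by (subst Bochner_Integration.integral_sum) auto
  \<comment> \<open>The values of \<open>v\<close>, absent from the coercive side, are bounded here
    by the quotients that occur there.\<close>
  also have "\<dots> \<le> (LINT x|M1. (\<Sum>k=0..N. (dq N v k x)\<^sup>2)) / n"
    using n iv(1) id v0 by (intro divide_right_mono integral_mono Bochner_Integration.integrable_sum discrete_Poincare) auto
  also have "\<dots> = (\<Sum>k=0..N. LINT x|M1. (dq N v k x)\<^sup>2) / n"
    using id by (subst Bochner_Integration.integral_sum) auto
  also have "\<dots> = integral\<^sup>L M q2"
    unfolding n_def by (rule iq2(2)[symmetric])
  finally have q0_le: "integral\<^sup>L M q0 \<le> integral\<^sup>L M q2" .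
  \<comment> \<open>\<open>T\<close> and \<open>S\<close> have mean zero: they are the discrete and the continuous equation tested with \<open>v\<close>.\<close>
  define T where "T z = itp N (\<lambda>j x. flux \<beta> (G N j x) \<bullet> V j x) z + cst N (\<lambda>j x. dq N (U N) j x * dq N v j x) z
      - itp N (\<lambda>j x. fj j x * v j x) z" for z
  define S where "S z = flux \<beta> (fst (Gu z)) \<bullet> itp N V z + snd (Gu z) * cst N (dq N v) z - f z * itp N v z" for z
  note wd = weak_form_disc_Omega[OF Hv v0 V0, folded fj_def]
  have T: "integrable M T" "integral\<^sup>L M T = 0"
    unfolding T_def[abs_def] using wd by simp_all
  have S: "integrable M S" "integral\<^sup>L M S = 0"
  proof -
    have i: "integrable M (\<lambda>z. flux \<beta> (fst (Gu z)) \<bullet> itp N V z)" "integrable M (\<lambda>z. snd (Gu z) * cst N (dq N v) z)"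
      "integrable M (\<lambda>z. f z * itp N v z)"
      using sw sGu sf by (auto intro: sqint_inner sqint_flux sqint_mult)
    then show "integrable M S" "integral\<^sup>L M S = 0"
      unfolding S_def[abs_def] using weak_form_cont[OF Hitp] by simp_all
  qed
  define d where "d z = (norm ((\<phi> z, cgrad \<phi> z) - Wu z))\<^sup>2" for z
  have d: "integrable M d" "integral\<^sup>L M d = sqdist M (jet \<phi>) Wu"
    unfolding d_def[abs_def] sqdist_def using sqint_integrable[OF sqint_diff[OF s\<phi> sqint_Wu]] by simp_all
  have ic: "integrable M (\<lambda>z. c)" for c :: real
    by (rule finite_measure.integrable_const[OF finite_M])
  \<comment> \<open>Both nodes adjacent to a point are within distance h of it.\<close>
  have close: "norm ((x, real (cell N y) / n) - (x, y)) \<le> 1 / n" "norm ((x, real (cell N y + 1) / n) - (x, y)) \<le> 1 / n"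
    "real (cell N y) / n \<le> y" "y \<le> real (cell N y) / n + 1 / n"
    if "0 < y" "y < 1" for x :: 'a and y
  proof -
    note c = cell_frc[OF that, of N, folded n_def]
    have "y = (real (cell N y) + frc N y) / n"
      using c(4) n by (simp add: field_simps)
    then have y: "y = real (cell N y) / n + frc N y / n"
      by (simp add: add_divide_distrib)
    have fr: "0 \<le> frc N y / n" "frc N y / n \<le> 1 / n"
      using c(2,3) n by (auto intro: divide_right_mono)
    then show 1: "real (cell N y) / n \<le> y" "y \<le> real (cell N y) / n + 1 / n"
      using y by linarith+
    have "real (cell N y + 1) / n = real (cell N y) / n + 1 / n"
      by (simp add: add_divide_distrib)
    with 1 show "norm ((x, real (cell N y) / n) - (x, y)) \<le> 1 / n" "norm ((x, real (cell N y + 1) / n) - (x, y)) \<le> 1 / n"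
      by (simp_all add: norm_Pair)
  qed
  have err: "\<bar>fj i x - f (x, y)\<bar> \<le> e" "\<bar>ph i x - \<phi> (x, y)\<bar> \<le> e" "norm (Ph i x - fst (cgrad \<phi> (x, y))) \<le> e"
    if y: "0 < y" "y < 1" and i: "i = cell N y \<or> i = cell N y + 1" for i x y
  proof -
    have dist: "norm ((x, real i / n) - (x, y)) \<le> 1 / n"
      using close[OF y] i by auto
    have le: "L * norm ((x, real i / n) - (x, y)) \<le> e"
      using mult_left_mono[OF dist L(1)] by (simp add: e_def)
    show "\<bar>fj i x - f (x, y)\<bar> \<le> e"
      using order_trans[OF L(2) le] by (simp add: fj_def n_def)
    show "\<bar>ph i x - \<phi> (x, y)\<bar> \<le> e"
      using order_trans[OF L(3) le] by (simp add: ph_def)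
    have "norm (fst p) \<le> norm p" for p :: "'a \<times> real"
      using norm_fst_le[of "fst p" "snd p"] by simp
    from this[of "cgrad \<phi> (x, real i / n) - cgrad \<phi> (x, y)"]
    show "norm (Ph i x - fst (cgrad \<phi> (x, y))) \<le> e"
      using order_trans[OF L(4) le] by (simp add: Ph_def)
  qed
  have errD: "\<bar>dq N ph (cell N y) x - snd (cgrad \<phi> (x, y))\<bar> \<le> e" if y: "0 < y" "y < 1" for x y
  proof -
    have "\<bar>(\<phi> (x, real (cell N y) / n + 1 / n) - \<phi> (x, real (cell N y) / n)) / (1 / n) - snd (cgrad \<phi> (x, y))\<bar> \<le> L * (1 / n)"
      by (rule difference_quotient_error[OF sm L(1) L(4)]) (use n close(3,4)[OF y] in auto)
    moreover have r: "real (cell N y + 1) / n = real (cell N y) / n + 1 / n"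
      by (simp add: add_divide_distrib)
    have "dq N ph (cell N y) x = (\<phi> (x, real (cell N y) / n + 1 / n) - \<phi> (x, real (cell N y) / n)) / (1 / n)"
      unfolding dq_def ph_def r n_def[symmetric] by simp
    ultimately show ?thesis
      by (simp add: e_def)
  qed
  have pw: "m * (q1 z + q2 z) \<le> T z - S z + (m / 4 * (q1 z + q2 z + q0 z) + 3 * K / m * (d z + e\<^sup>2))"
    if z: "z \<in> Omega \<Omega>" for z
  proof -
    obtain x y where zxy: "z = (x, y)" by (cases z)
    have y: "0 < y" "y < 1" using z by (auto simp: zxy Omega_def)
    define j where "j = cell N y"
    define l where "l = frc N y"
    have l: "0 \<le> l" "l \<le> 1" using cell_frc(2,3)[OF y, of N] by (simp_all add: l_def)
    have Vj: "G N i x - Ph i x = V i x" for i by (simp add: V_def)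
    have Dj: "dq N (U N) j x - dq N ph j x = dq N v j x"
      unfolding v_def[abs_def] by (rule dq_diff[symmetric])
    have "m * (q1 z + q2 z) \<le> T z - S z + (m / 4 * (q1 z + q2 z + q0 z)
        + 3 * K / m * ((norm (fst (cgrad \<phi> z) - fst (Gu z)))\<^sup>2 + (snd (cgrad \<phi> z) - snd (Gu z))\<^sup>2 + e\<^sup>2))"
      using pointwise_estimate[OF l e, of "Ph j x" "fst (cgrad \<phi> (x, y))" "Ph (j + 1) x" "fj j x" "f (x, y)" "fj (j + 1) x"
          "dq N ph j x" "snd (cgrad \<phi> (x, y))" m K "G N j x" "G N (j + 1) x" "dq N (U N) j x" "v j x" "v (j + 1) x"
          "fst (Gu (x, y))" "snd (Gu (x, y))", OF _ _ _ _ _ m K_def]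
        err[OF y] errD[OF y]
      unfolding Vj Dj
      by (simp add: q0_def q1_def q2_def T_def S_def itp_def cst_def zxy flip: j_def l_def)
    also have "\<dots> \<le> T z - S z + (m / 4 * (q1 z + q2 z + q0 z) + 3 * K / m * (d z + e\<^sup>2))"
    proof -
      have "(norm (fst (cgrad \<phi> z) - fst (Gu z)))\<^sup>2 + (snd (cgrad \<phi> z) - snd (Gu z))\<^sup>2 = (norm (cgrad \<phi> z - Gu z))\<^sup>2"
        by (simp add: norm_prod_def)
      also have "\<dots> \<le> d z"
        by (simp add: d_def Wu_def norm_Pair)
      finally have "(norm (fst (cgrad \<phi> z) - fst (Gu z)))\<^sup>2 + (snd (cgrad \<phi> z) - snd (Gu z))\<^sup>2 + e\<^sup>2 \<le> d z + e\<^sup>2"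
        by simp
      from mult_left_mono[OF this, of "3 * K / m"] show ?thesis
        using K m by simp
    qed
    finally show ?thesis .
  qed
  define \<mu> where "\<mu> = measure M (space M)"
  define \<delta> where "\<delta> = integral\<^sup>L M d"
  \<comment> \<open>Under the integral both equations drop out, leaving the absorbable terms and the
    data error.\<close>
  have "(LINT z|M. m * (q1 z + q2 z)) \<le> (LINT z|M. T z - S z + (m / 4 * (q1 z + q2 z + q0 z) + 3 * K / m * (d z + e\<^sup>2)))"
    using q T(1) S(1) d(1) ic pw by (intro integral_mono) (auto simp: space_M)
  then have "m * (integral\<^sup>L M q1 + integral\<^sup>L M q2)
      \<le> m / 4 * (integral\<^sup>L M q1 + integral\<^sup>L M q2 + integral\<^sup>L M q0) + 3 * K / m * (\<delta> + e\<^sup>2 * \<mu>)"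
    using q T S d(1) ic by (simp add: \<delta>_def \<mu>_def mult.commute[of "e\<^sup>2"])
  moreover have nn: "integral\<^sup>L M q1 \<ge> 0" "integral\<^sup>L M q2 \<ge> 0"
  proof -
    have "0 \<le> q1 z" "0 \<le> q2 z" if "z \<in> space M" for z
    proof -
      have y: "0 < snd z" "snd z < 1" using that by (auto simp: space_M Omega_def)
      show "0 \<le> q1 z" "0 \<le> q2 z"
        using cell_frc(2,3)[OF y, of N] by (simp_all add: q1_def q2_def itp_def cst_def)
    qed
    then show "integral\<^sup>L M q1 \<ge> 0" "integral\<^sup>L M q2 \<ge> 0"
      by (auto intro!: Bochner_Integration.integral_nonneg)
  qed
  \<comment> \<open>Absorption: \<open>q0_le\<close> doubles the coercive terms at worst, so half of
    the left side survives.\<close>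
  moreover have "m / 4 * (integral\<^sup>L M q1 + integral\<^sup>L M q2 + integral\<^sup>L M q0) \<le> m / 2 * (integral\<^sup>L M q1 + integral\<^sup>L M q2)"
  proof -
    have "integral\<^sup>L M q1 + integral\<^sup>L M q2 + integral\<^sup>L M q0 \<le> 2 * (integral\<^sup>L M q1 + integral\<^sup>L M q2)"
    proof -
      have "a + b + c \<le> 2 * (a + b)" if "c \<le> b" "0 \<le> a" "0 \<le> b" for a b c :: real
        using that by (simp add: algebra_simps)
      from this[OF q0_le nn] show ?thesis .
    qed
    from mult_left_mono[OF this, of "m / 4"] m show ?thesis by simp
  qed
  ultimately have "m / 2 * (integral\<^sup>L M q1 + integral\<^sup>L M q2) \<le> 3 * K / m * (\<delta> + e\<^sup>2 * \<mu>)"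
    by (simp add: algebra_simps)
  from mult_left_mono[OF this, of "2 / m"] m
  have Q: "integral\<^sup>L M q1 + integral\<^sup>L M q2 \<le> 6 * K / m\<^sup>2 * (\<delta> + e\<^sup>2 * \<mu>)"
    by (simp add: power2_eq_square)
  have fin: "(norm (W N z - Wu z))\<^sup>2 \<le> 3 * (q0 z + q1 z + q2 z) + 9 * e\<^sup>2 + 3 * d z" if z: "z \<in> Omega \<Omega>" for z
  proof -
    obtain x y where zxy: "z = (x, y)" by (cases z)
    have y: "0 < y" "y < 1" using z by (auto simp: zxy Omega_def)
    define j where "j = cell N y"
    define l where "l = frc N y"
    have l: "0 \<le> l" "l \<le> 1" using cell_frc(2,3)[OF y, of N] by (simp_all add: l_def)
    define A where "A = (itp N v z, itp N V z, cst N (dq N v) z)"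
    \<comment> \<open>Interpolation error of \<phi>. Each of its three components is at most e,
      which gives \<open>3 * e\<^sup>2\<close>, and the splitting into three parts turns this into
      \<open>9 * e\<^sup>2\<close>.\<close>
    define B where "B = (itp N ph z - \<phi> z, itp N Ph z - fst (cgrad \<phi> z), cst N (dq N ph) z - snd (cgrad \<phi> z))"
    have "W N z - Wu z = A + B + ((\<phi> z, cgrad \<phi> z) - Wu z)"
    proof -
      have "itp N v z = itp N (U N) z - itp N ph z" "itp N V z = itp N (G N) z - itp N Ph z"
        unfolding v_def[abs_def] V_def[abs_def] by (rule itp_diff)+
      moreover have "cst N (dq N v) z = cst N (dq N (U N)) z - cst N (dq N ph) z"
        unfolding cst_def v_def[abs_def] by (rule dq_diff)
      ultimately show ?thesis
        by (simp add: W_def Wu_def A_def B_def prod_eq_iff)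
    qed
    then have "(norm (W N z - Wu z))\<^sup>2 \<le> 3 * (norm A)\<^sup>2 + 3 * (norm B)\<^sup>2 + 3 * d z"
      unfolding d_def by (simp only: norm_add3_power2_le)
    moreover have "(norm A)\<^sup>2 \<le> q0 z + q1 z + q2 z"
    proof -
      have "(itp N v z)\<^sup>2 \<le> q0 z"
        using square_convex[OF l, of "v j x" "v (j + 1) x"] by (simp add: itp_def q0_def zxy flip: j_def l_def)
      moreover have "(norm (itp N V z))\<^sup>2 \<le> q1 z"
        using norm_power2_convex[OF l, of "V j x" "V (j + 1) x"] by (simp add: itp_def q1_def zxy flip: j_def l_def)
      ultimately show ?thesis
        by (simp add: A_def norm_Pair q2_def cst_def)
    qed
    moreover have "(norm B)\<^sup>2 \<le> 3 * e\<^sup>2"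
    proof -
      have conv: "norm ((1 - l) *\<^sub>R a + l *\<^sub>R b - c) \<le> e" if "norm (a - c) \<le> e" "norm (b - c) \<le> e" for a b c :: "'c::real_normed_vector"
      proof -
        have "(1 - l) *\<^sub>R a + l *\<^sub>R b - c = (1 - l) *\<^sub>R (a - c) + l *\<^sub>R (b - c)"
          by (simp add: algebra_simps)
        also have "norm \<dots> \<le> (1 - l) * norm (a - c) + l * norm (b - c)"
          using norm_triangle_ineq[of "(1 - l) *\<^sub>R (a - c)" "l *\<^sub>R (b - c)"] l by simp
        also have "\<dots> \<le> (1 - l) * e + l * e"
          using that l by (intro add_mono mult_left_mono) auto
        finally show ?thesis by (simp add: algebra_simps)
      qed
      have b1: "norm (itp N ph z - \<phi> z) \<le> e"
        using conv[of "ph j x" "\<phi> z" "ph (j + 1) x"] err(2)[OF y] by (simp add: itp_def zxy flip: j_def l_def)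
      have b2: "norm (itp N Ph z - fst (cgrad \<phi> z)) \<le> e"
        using conv[of "Ph j x" "fst (cgrad \<phi> z)" "Ph (j + 1) x"] err(3)[OF y] by (simp add: itp_def zxy flip: j_def l_def)
      have b3: "norm (cst N (dq N ph) z - snd (cgrad \<phi> z)) \<le> e"
        using errD[OF y] by (simp add: cst_def zxy)
      have "(norm B)\<^sup>2 = (norm (itp N ph z - \<phi> z))\<^sup>2 + (norm (itp N Ph z - fst (cgrad \<phi> z)))\<^sup>2 + (norm (cst N (dq N ph) z - snd (cgrad \<phi> z)))\<^sup>2"
        by (simp add: B_def norm_Pair)
      also have "\<dots> \<le> e\<^sup>2 + e\<^sup>2 + e\<^sup>2"
        by (intro add_mono power_mono b1 b2 b3 norm_ge_zero)
      finally show ?thesis by simp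
    qed
    moreover have "X \<le> 3 * Q + 9 * E + D" if "X \<le> 3 * A + 3 * B + D" "A \<le> Q" "B \<le> 3 * E" for X A B D E Q :: real
      using that by linarith
    ultimately show ?thesis by blast
  qed
  have "sqdist M (W N) Wu \<le> (LINT z|M. 3 * (q0 z + q1 z + q2 z) + 9 * e\<^sup>2 + 3 * d z)"
    unfolding sqdist_def using q d(1) ic fin sqint_integrable[OF sqint_diff[OF sqint_W sqint_Wu]]
    by (intro integral_mono) (auto simp: space_M)
  also have "\<dots> = 3 * (integral\<^sup>L M q0 + integral\<^sup>L M q1 + integral\<^sup>L M q2) + 9 * e\<^sup>2 * \<mu> + 3 * \<delta>"
    using q d(1) ic by (simp add: \<delta>_def \<mu>_def)
  also have "\<dots> \<le> 6 * (6 * K / m\<^sup>2 * (\<delta> + e\<^sup>2 * \<mu>)) + 9 * (\<delta> + e\<^sup>2 * \<mu>)"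
  proof -
    have "0 \<le> \<delta>" by (simp add: \<delta>_def d_def)
    moreover have "3 * (a + b + c) + 9 * P + 3 * D \<le> 6 * R + 9 * (D + P)"
      if "b + c \<le> R" "a \<le> c" "0 \<le> b" "0 \<le> D" for a b c P D R :: real
    proof -
      have "3 * (a + b + c) \<le> 6 * (b + c)" using that by (simp add: distrib_left)
      also have "\<dots> \<le> 6 * R" using that(1) by (rule mult_left_mono) simp
      finally show ?thesis using that(4) by (simp add: distrib_left)
    qed
    ultimately show ?thesis
      unfolding mult.assoc[of 9] using Q q0_le nn(1) by blast
  qed
  also have "\<dots> = C * (\<delta> + e\<^sup>2 * \<mu>)"
    by (simp add: C_def algebra_simps)
  finally show ?thesis
    by (simp add: \<delta>_def d(2) e_def n_def \<mu>_def)
qed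

lemma sqdist_W_tendsto_0: "(\<lambda>N. sqdist M (W N) Wu) \<longlonglongrightarrow> 0"
proof (rule order_tendstoI)
  fix a :: real assume "a < 0"
  then show "\<forall>\<^sub>F N in sequentially. a < sqdist M (W N) Wu"
    by (intro always_eventually allI less_le_trans[OF _ sqdist_nonneg])
next
  fix a :: real assume a: "a > 0"
  have C: "C > 0" using K m by (simp add: C_def add_nonneg_pos)
  \<comment> \<open>The tolerance a / C can be prescribed in advance because C does not depend on
    \<phi>; the Lipschitz constant L is fixed only afterwards.\<close>
  obtain \<phi> where \<phi>: "test_fun (Omega \<Omega>) \<phi>" "sqdist M (jet \<phi>) Wu < a / C"
    using H10g_u a C unfolding H10g_def Wu_def[abs_def] by (meson divide_pos_pos)
  obtain L1 where L1: "L1 \<ge> 0" "\<And>x y. \<bar>f x - f y\<bar> \<le> L1 * norm (x - y)"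
    by (rule test_fun_lipschitz[OF test_f]) (rule that)
  obtain L2 where L2: "L2 \<ge> 0" "\<And>x y. \<bar>\<phi> x - \<phi> y\<bar> \<le> L2 * norm (x - y)"
    by (rule test_fun_lipschitz[OF \<phi>(1)]) (rule that)
  obtain L3 where L3: "L3 \<ge> 0" "\<And>x y. norm (cgrad \<phi> x - cgrad \<phi> y) \<le> L3 * norm (x - y)"
    by (rule test_fun_cgrad_lipschitz[OF \<phi>(1)]) (rule that)
  define L where "L = L1 + L2 + L3"
  have L: "L1 * t \<le> L * t" "L2 * t \<le> L * t" "L3 * t \<le> L * t" if "t \<ge> 0" for t
    using that L1(1) L2(1) L3(1) by (auto simp: L_def intro!: mult_right_mono)
  have est: "sqdist M (W N) Wu \<le> C * (sqdist M (jet \<phi>) Wu + (L / real (N + 1))\<^sup>2 * measure M (space M))" for N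
  proof (rule estimate[OF \<phi>(1)])
    show "0 \<le> L" using L1(1) L2(1) L3(1) by (simp add: L_def)
  qed (use order_trans[OF L1(2) L(1)] order_trans[OF L2(2) L(2)] order_trans[OF L3(2) L(3)] in auto)
  have "(\<lambda>N. L * inverse (real (Suc N))) \<longlonglongrightarrow> L * 0"
    by (intro tendsto_intros LIMSEQ_inverse_real_of_nat)
  then have "(\<lambda>N. L / real (N + 1)) \<longlonglongrightarrow> 0"
    by (simp add: divide_inverse)
  then have "(\<lambda>N. C * (sqdist M (jet \<phi>) Wu + (L / real (N + 1))\<^sup>2 * measure M (space M)))
      \<longlonglongrightarrow> C * (sqdist M (jet \<phi>) Wu + 0\<^sup>2 * measure M (space M))"
    by (intro tendsto_intros)
  moreover have "C * (sqdist M (jet \<phi>) Wu + 0\<^sup>2 * measure M (space M)) < a"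
    using \<phi>(2) C by (simp add: field_simps)
  ultimately have "\<forall>\<^sub>F N in sequentially. C * (sqdist M (jet \<phi>) Wu + (L / real (N + 1))\<^sup>2 * measure M (space M)) < a"
    by (rule order_tendstoD(2))
  then show "\<forall>\<^sub>F N in sequentially. sqdist M (W N) Wu < a"
    by eventually_elim (rule le_less_trans[OF est])
qed

section \<open>Boundedness and weak convergence of the interpolations\<close>

lemma H1_inner_eq:
  assumes "H10g (Omega \<Omega>) w A" "H10g (Omega \<Omega>) v B"
  shows "H1_inner (Omega \<Omega>) w v = (LINT z|M. (w z, A z) \<bullet> (v z, B z))"
proof -
  have ae: "AE z in M. wgrad (Omega \<Omega>) w z = A z" "AE z in M. wgrad (Omega \<Omega>) v z = B z"
    using assms open_Omega[OF open_\<Omega>] by (auto intro: wgrad_AE)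
  have H: "H10g (Omega \<Omega>) w (wgrad (Omega \<Omega>) w)" "H10g (Omega \<Omega>) v (wgrad (Omega \<Omega>) v)"
    using assms H10_iff_H10g[OF sets_Omega] by (auto intro!: H10g_wgrad open_Omega open_\<Omega>)
  have "H1_inner (Omega \<Omega>) w v = (LINT z|M. (w z, wgrad (Omega \<Omega>) w z) \<bullet> (v z, wgrad (Omega \<Omega>) v z))"
    by (simp add: H1_inner_def set_integral_lebesgue_on[OF sets_Omega] inner_prod_def)
  also have "\<dots> = (LINT z|M. (w z, A z) \<bullet> (v z, B z))"
  proof (rule integral_cong_AE)
    show "AE z in M. (w z, wgrad (Omega \<Omega>) w z) \<bullet> (v z, wgrad (Omega \<Omega>) v z) = (w z, A z) \<bullet> (v z, B z)"
      using ae by eventually_elim simp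
  qed (intro borel_measurable_integrable sqint_inner H10g_sqint_Pair H assms)+
  finally show ?thesis .
qed

lemma interp_eq: "interp N (U N) = itp N (U N)"
  by (rule ext) (rule interp_eq_itp)

lemma H10_interp: "H10 (Omega \<Omega>) (interp N (U N))"
  unfolding interp_eq H10_iff_H10g[OF sets_Omega] using H10g_W by blast

text \<open>The distances to \<open>u\<close> converge and are therefore bounded; the triangle
  inequality adds the fixed norm of \<open>u\<close>.\<close>

lemma H1_norm_interp_bounded: "\<exists>B. \<forall>N. H1_norm (Omega \<Omega>) (interp N (U N)) \<le> B"
proof -
  have "Bseq (\<lambda>N. sqdist M (W N) Wu)"
    using sqdist_W_tendsto_0 by (intro convergent_imp_Bseq convergentI)
  then obtain B where B: "\<And>N. \<bar>sqdist M (W N) Wu\<bar> \<le> B"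
    unfolding Bseq_def by auto
  have "H1_norm (Omega \<Omega>) (interp N (U N)) \<le> sqrt (2 * B + 2 * sqdist M Wu (\<lambda>z. 0))" for N
  proof -
    have "H1_inner (Omega \<Omega>) (interp N (U N)) (interp N (U N)) = sqdist M (W N) (\<lambda>z. 0)"
      unfolding interp_eq H1_inner_eq[OF H10g_W H10g_W] sqdist_def W_def by (simp add: power2_norm_eq_inner)
    also have "\<dots> \<le> 2 * sqdist M (W N) Wu + 2 * sqdist M Wu (\<lambda>z. 0)"
      by (rule sqdist_triangle[OF sqint_W sqint_Wu sqint_zero])
    also have "\<dots> \<le> 2 * B + 2 * sqdist M Wu (\<lambda>z. 0)"
      using B[of N] by simp
    finally show ?thesis
      unfolding H1_norm_def by (rule real_sqrt_le_mono)
  qed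
  then show ?thesis by blast
qed

text \<open>Strong convergence of the jets \<open>W N\<close> to \<open>Wu\<close> and
  Cauchy-Schwarz against the jet of a fixed v.\<close>

lemma weak_conv_interp: "weak_conv_H10 (Omega \<Omega>) (\<lambda>N. interp N (U N)) u"
  unfolding weak_conv_H10_def
proof (intro allI impI)
  fix v assume "H10 (Omega \<Omega>) v"
  then obtain V where v: "H10g (Omega \<Omega>) v V"
    using H10_iff_H10g[OF sets_Omega] by blast
  define Y where "Y z = (v z, V z)" for z
  have Y: "sqint M Y"
    unfolding Y_def[abs_def] by (rule H10g_sqint_Pair[OF v])
  have i: "H1_inner (Omega \<Omega>) (interp N (U N)) v = (LINT z|M. W N z \<bullet> Y z)"
    "H1_inner (Omega \<Omega>) u v = (LINT z|M. Wu z \<bullet> Y z)" for N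
    unfolding interp_eq W_def Wu_def Y_def by (rule H1_inner_eq[OF H10g_W v] H1_inner_eq[OF H10g_u v])+
  have bound: "\<bar>H1_inner (Omega \<Omega>) (interp N (U N)) v - H1_inner (Omega \<Omega>) u v\<bar>
      \<le> sqrt (sqdist M (W N) Wu) * sqrt (LINT z|M. (norm (Y z))\<^sup>2)" for N
  proof -
    have "H1_inner (Omega \<Omega>) (interp N (U N)) v - H1_inner (Omega \<Omega>) u v = (LINT z|M. (W N z - Wu z) \<bullet> Y z)"
      unfolding i inner_diff_left
      by (rule Bochner_Integration.integral_diff[OF sqint_inner[OF sqint_W Y] sqint_inner[OF sqint_Wu Y], symmetric])
    then show ?thesis
      using sqint_Cauchy_Schwarz[OF sqint_diff[OF sqint_W sqint_Wu] Y] by (simp add: sqdist_def)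
  qed
  have "(\<lambda>N. sqrt (sqdist M (W N) Wu) * sqrt (LINT z|M. (norm (Y z))\<^sup>2)) \<longlonglongrightarrow> sqrt 0 * sqrt (LINT z|M. (norm (Y z))\<^sup>2)"
    by (intro tendsto_intros sqdist_W_tendsto_0)
  then have lim: "(\<lambda>N. sqrt (sqdist M (W N) Wu) * sqrt (LINT z|M. (norm (Y z))\<^sup>2)) \<longlonglongrightarrow> 0"
    by simp
  have "(\<lambda>N. H1_inner (Omega \<Omega>) (interp N (U N)) v - H1_inner (Omega \<Omega>) u v) \<longlonglongrightarrow> 0"
    by (rule Lim_null_comparison[OF always_eventually lim]) (simp only: real_norm_def bound simp_thms)
  then show "(\<lambda>N. H1_inner (Omega \<Omega>) (interp N (U N)) v) \<longlonglongrightarrow> H1_inner (Omega \<Omega>) u v"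
    by (rule LIM_zero_cancel)
qed

end

theorem theorem4:
  fixes \<Omega>1 :: "'a::euclidean_space set"
    and \<epsilon> :: real and \<beta> \<beta>' :: "real \<Rightarrow> real"
    and f u :: "'a \<times> real \<Rightarrow> real"
    and U :: "nat \<Rightarrow> nat \<Rightarrow> 'a \<Rightarrow> real"
  assumes "open \<Omega>1" and "bounded \<Omega>1" and "C2_boundary \<Omega>1"
    and "\<epsilon> > 0"
    and "\<beta> 0 = 0" and "continuous_on {0..} \<beta>"
    and "\<forall>t>0. (\<beta> has_real_derivative \<beta>' t) (at t)"
    and "continuous_on {0<..} \<beta>'"
    and "\<forall>t>0. \<epsilon> \<le> \<beta>' t \<and> \<beta>' t \<le> 1 / \<epsilon>"
    and "convex_on {0<..} (\<lambda>t. \<beta> t * t)"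
    and "test_fun (Omega \<Omega>1) f"
    and "weak_sol_cont \<beta> \<Omega>1 f u"
    and "\<forall>N. weak_sol_disc \<beta> \<Omega>1 N (\<lambda>j x. f (x, real j / real (N + 1))) (U N)"
  shows "(\<forall>N. H10 (Omega \<Omega>1) (interp N (U N)))
    \<and> (\<exists>C. \<forall>N. H1_norm (Omega \<Omega>1) (interp N (U N)) \<le> C)
    \<and> weak_conv_H10 (Omega \<Omega>1) (\<lambda>N. interp N (U N)) u"
proof -
  interpret nonlinearity \<beta> \<epsilon>
    by (rule nonlinearityI) (use assms in auto)
  interpret scheme \<beta> \<epsilon> \<Omega>1 f u U
    by unfold_locales (use assms in auto)
  show ?thesis
    using H10_interp H1_norm_interp_bounded weak_conv_interp by blast
qed

end
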